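(* Suppose there is an algorithm $A$ that, given a simply-connected domain $\Omega$ with $0\in\Omega$, with a linear-time computable boundary and with inner radius $>\frac12$, and given a number $n$, computes the first $20n$ digits of the conformal radius $r(\Omega,0)$. Then one can use one call to $A$ to solve any instance of $\#\mathit{SAT}(n)$ with a linear time overhead. In other words, $\mathbf{\#P}$ is poly-time reducible to computing the conformal radius of a set.
   Context: For a simply-connected domain $\Omega\subsetneq\mathbb{C}$ with $w\in\Omega$, let $\psi$ be the unique conformal map of $\Omega$ onto the unit disk $\mathbb{D}$ with $\psi(w)=0$, $\psi'(w)>0$; the conformal radius is $r(\Omega,w)=1/\psi'(w)$. Inner radius $>\frac12$ means $\mathrm{dist}(0,\partial\Omega)>\frac12$. $\#\mathit{SAT}(n)$ is the problem: given a propositional formula $\Phi$ in $n$ variables, compute the number of its satisfying truth assignments. $\mathbf{\#P}$ is the class of counting problems for which $\#\mathit{SAT}$ is a complete problem. A bounded set $S\subset\mathbb{R}^2$ is computable in time $t(n)$ if there is a function $f_S$ such that $f_S(n,i/2^n,j/2^n)$, $i,j\in\mathbb{Z}$, is computed in time $t(n)$ and equals $1$ if $B((i/2^n,j/2^n),2^{-n})\cap S\ne\emptyset$, equals $0$ if $B((i/2^n,j/2^n),2\cdot2^{-n})\cap S=\emptyset$, and is $0$ or $1$ in all other cases. Linear-time computable means $t(n)=O(n)$; in the reduction, the computation of the boundary is given access to the formula $\Phi$. The domain is given to $A$ through its boundary, represented by such a function. *)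

theory Defs
  imports
    "HOL-Complex_Analysis.Complex_Analysis"
    "HOL-Library.Discrete_Functions"
begin

section \<open>Conformal radius\<close>

definition normalized_riemann_map :: "complex set \<Rightarrow> complex \<Rightarrow> (complex \<Rightarrow> complex) \<Rightarrow> bool" where
  "normalized_riemann_map \<Omega> w \<psi> \<longleftrightarrow>
     \<psi> holomorphic_on \<Omega> \<and> bij_betw \<psi> \<Omega> (ball 0 1) \<and>
     \<psi> w = 0 \<and> deriv \<psi> w \<in> \<real> \<and> Re (deriv \<psi> w) > 0"

text \<open>The map is unique on \<open>\<Omega>\<close> only (HOL functions are total), so the description operator is
  applied to the radius, which depends only on the values of the map near \<open>w\<close>.\<close>

definition conformal_radius :: "complex set \<Rightarrow> complex \<Rightarrow> real" where
  "conformal_radius \<Omega> w =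
     (THE r. \<exists>\<psi>. normalized_riemann_map \<Omega> w \<psi> \<and> r = 1 / Re (deriv \<psi> w))"

definition admissible_domain :: "complex set \<Rightarrow> bool" where
  "admissible_domain \<Omega> \<longleftrightarrow>
     open \<Omega> \<and> simply_connected \<Omega> \<and> \<Omega> \<noteq> UNIV \<and> 0 \<in> \<Omega> \<and> infdist 0 (frontier \<Omega>) > 1 / 2"


section \<open>Random access machines with logarithmic cost\<close>

text \<open>
  The model of computation is the random access machine of Cook--Reckhow and
  Aho--Hopcroft--Ullman, with the logarithmic cost criterion: integer registers, direct and
  indirect addressing, the operations \<open>+\<close>, \<open>-\<close>, \<open>*\<close> and integer division, and every step charged
  with the bit lengths of all the numbers (contents and addresses) it touches. It is polynomially
  equivalent to Turing machines. Control flow is structured instead of given by jumps.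
  A program may also query a function \<open>Q\<close>; a query is charged with the lengths of the question
  and the answer.
\<close>

definition len :: "int \<Rightarrow> nat" where
  "len z = floor_log (nat \<bar>z\<bar>) + 1"

type_synonym mem = "nat \<Rightarrow> int"

datatype loc = Reg nat | Ind nat
datatype operand = Lit int | At loc
datatype binop = Add | Sub | Mult | Div

datatype prog =
    Skip
  | Set loc operand
  | Op binop loc operand operand
  | Query loc operand
  | Seq prog prog
  | If operand prog prog
  | While operand prog

fun addr :: "loc \<Rightarrow> mem \<Rightarrow> nat" where
  "addr (Reg r) s = r"
| "addr (Ind r) s = nat (s r)"

fun addr_cost :: "loc \<Rightarrow> mem \<Rightarrow> nat" where
  "addr_cost (Reg r) s = len (int r)"
| "addr_cost (Ind r) s = len (int r) + len (s r)"

fun val :: "operand \<Rightarrow> mem \<Rightarrow> int" where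
  "val (Lit z) s = z"
| "val (At l) s = s (addr l s)"

fun val_cost :: "operand \<Rightarrow> mem \<Rightarrow> nat" where
  "val_cost (Lit z) s = len z"
| "val_cost (At l) s = addr_cost l s + len (s (addr l s))"

fun apply_op :: "binop \<Rightarrow> int \<Rightarrow> int \<Rightarrow> int" where
  "apply_op Add x y = x + y"
| "apply_op Sub x y = x - y"
| "apply_op Mult x y = x * y"
| "apply_op Div x y = x div y"

text \<open>\<open>exec Q c s t s'\<close>: with access to \<open>Q\<close>, the program \<open>c\<close> started in memory \<open>s\<close> halts
  in memory \<open>s'\<close> at total cost \<open>t\<close>. Tests ask whether the operand is positive.\<close>

inductive exec :: "(int \<Rightarrow> int) \<Rightarrow> prog \<Rightarrow> mem \<Rightarrow> nat \<Rightarrow> mem \<Rightarrow> bool" for Q where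
  exec_Skip: "exec Q Skip s 1 s"
| exec_Set: "z = val a s \<Longrightarrow>
    exec Q (Set d a) s (1 + val_cost a s + addr_cost d s + len z) (s(addr d s := z))"
| exec_Op: "z = apply_op f (val a s) (val b s) \<Longrightarrow>
    exec Q (Op f d a b) s (1 + val_cost a s + val_cost b s + addr_cost d s + len z)
      (s(addr d s := z))"
| exec_Query: "z = Q (val a s) \<Longrightarrow>
    exec Q (Query d a) s (1 + val_cost a s + addr_cost d s + len z) (s(addr d s := z))"
| exec_Seq: "exec Q c1 s t1 s1 \<Longrightarrow> exec Q c2 s1 t2 s2 \<Longrightarrow> exec Q (Seq c1 c2) s (t1 + t2) s2"
| exec_IfTrue: "val a s > 0 \<Longrightarrow> exec Q c1 s t s1 \<Longrightarrow>
    exec Q (If a c1 c2) s (1 + val_cost a s + t) s1"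
| exec_IfFalse: "\<not> val a s > 0 \<Longrightarrow> exec Q c2 s t s1 \<Longrightarrow>
    exec Q (If a c1 c2) s (1 + val_cost a s + t) s1"
| exec_WhileFalse: "\<not> val a s > 0 \<Longrightarrow> exec Q (While a c) s (1 + val_cost a s) s"
| exec_WhileTrue: "val a s > 0 \<Longrightarrow> exec Q c s t1 s1 \<Longrightarrow> exec Q (While a c) s1 t2 s2 \<Longrightarrow>
    exec Q (While a c) s (1 + val_cost a s + t1 + t2) s2"

definition input :: "int list \<Rightarrow> mem" where
  "input xs = (\<lambda>k. if k < length xs then xs ! k else 0)"

text \<open>A program run with this trivial function is an ordinary program without access to anything.\<close>

definition no_access :: "int \<Rightarrow> int" where
  "no_access = (\<lambda>_. 0)"


section \<open>Computable planar sets\<close>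

text \<open>Points of the plane are complex numbers; \<open>f n i j\<close> answers for precision \<open>2\<^sup>-\<^sup>n\<close>
  at the point \<open>(i/2\<^sup>n, j/2\<^sup>n)\<close>.\<close>

type_synonym set_rep = "nat \<Rightarrow> int \<Rightarrow> int \<Rightarrow> bool"

definition represents :: "set_rep \<Rightarrow> complex set \<Rightarrow> bool" where
  "represents f S \<longleftrightarrow> bounded S \<and>
     (\<forall>n i j. let z = Complex (of_int i / 2 ^ n) (of_int j / 2 ^ n) in
        (ball z (1 / 2 ^ n) \<inter> S \<noteq> {} \<longrightarrow> f n i j) \<and>
        (ball z (2 / 2 ^ n) \<inter> S = {} \<longrightarrow> \<not> f n i j))"

text \<open>The program \<open>c\<close>, with access to \<open>Q\<close> and an additional input \<open>p\<close>, computes \<open>f\<close> within the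
  time bound \<open>T\<close>.\<close>

definition computes_rep ::
  "(int \<Rightarrow> int) \<Rightarrow> prog \<Rightarrow> int \<Rightarrow> set_rep \<Rightarrow> (nat \<Rightarrow> int \<Rightarrow> int \<Rightarrow> nat) \<Rightarrow> bool" where
  "computes_rep Q c p f T \<longleftrightarrow>
     (\<forall>n i j. \<exists>t s. exec Q c (input [int n, i, j, p]) t s \<and> s 0 = of_bool (f n i j) \<and> t \<le> T n i j)"

text \<open>Since reading \<open>i\<close> and \<open>j\<close> is charged with their lengths, the bound is linear in
  \<open>n + len i + len j\<close>; this is \<open>O(n)\<close> for query points ranging over any fixed square, and hence
  on a neighbourhood of a given bounded set.\<close>

definition linear_time :: "set_rep \<Rightarrow> bool" where
  "linear_time f \<longleftrightarrow>
     (\<exists>c C. computes_rep no_access c 0 f (\<lambda>n i j. C * (n + len i + len j)))"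


section \<open>Solvers for the conformal radius, and calls to them\<close>

text \<open>The solver receives the function representing the boundary, and \<open>n\<close>. The first \<open>20n\<close> binary
  digits of \<open>r\<close> (after the binary point, preceded by the integer part) are handed over as
  the integer \<open>\<lfloor>2\<^sup>2\<^sup>0\<^sup>n r\<rfloor>\<close> having these digits.\<close>

type_synonym solver = "set_rep \<Rightarrow> nat \<Rightarrow> int"

definition computes_conformal_radius :: "solver \<Rightarrow> bool" where
  "computes_conformal_radius A \<longleftrightarrow>
     (\<forall>\<Omega> f n. admissible_domain \<Omega> \<and> represents f (frontier \<Omega>) \<and> linear_time f \<longrightarrow>
        A f n = \<lfloor>2 ^ (20 * n) * conformal_radius \<Omega> 0\<rfloor>)"

text \<open>On input \<open>p\<close> the output \<open>v\<close> is computed by \<open>pre\<close>, one call of \<open>A\<close> on \<open>f\<close> and \<open>m\<close>, and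
  \<open>post\<close>, with overhead at most \<open>T\<close>. The argument \<open>m\<close> is left by \<open>pre\<close> in register 0, where the
  answer appears; all other registers survive the call. The call is charged with \<open>m\<close>, i.e. this
  argument is counted in unary.\<close>

definition one_call ::
  "(int \<Rightarrow> int) \<Rightarrow> solver \<Rightarrow> prog \<Rightarrow> prog \<Rightarrow> int \<Rightarrow> set_rep \<Rightarrow> nat \<Rightarrow> int \<Rightarrow> nat \<Rightarrow> bool" where
  "one_call Q A pre post p f m v T \<longleftrightarrow>
     (\<exists>t1 s1 t2 s2. exec Q pre (input [p]) t1 s1 \<and> s1 0 = int m \<and>
        exec Q post (s1(0 := A f m)) t2 s2 \<and> s2 0 = v \<and> t1 + m + t2 \<le> T)"


section \<open>Counting satisfying assignments\<close>

datatype form = Var nat | Neg form | And form form | Or form form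

fun vars :: "form \<Rightarrow> nat set" where
  "vars (Var v) = {v}"
| "vars (Neg a) = vars a"
| "vars (And a b) = vars a \<union> vars b"
| "vars (Or a b) = vars a \<union> vars b"

fun sat :: "(nat \<Rightarrow> bool) \<Rightarrow> form \<Rightarrow> bool" where
  "sat \<alpha> (Var v) = \<alpha> v"
| "sat \<alpha> (Neg a) = (\<not> sat \<alpha> a)"
| "sat \<alpha> (And a b) = (sat \<alpha> a \<and> sat \<alpha> b)"
| "sat \<alpha> (Or a b) = (sat \<alpha> a \<or> sat \<alpha> b)"

text \<open>The instances of \<open>#SAT(n)\<close> are the formulas with variables among \<open>0, \<dots>, n - 1\<close>.\<close>

definition sharp_SAT :: "nat \<Rightarrow> form \<Rightarrow> nat" where
  "sharp_SAT n \<phi> = card {\<alpha> \<in> {..<n} \<rightarrow>\<^sub>E (UNIV :: bool set). sat \<alpha> \<phi>}"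

text \<open>Access to a formula: the question is an assignment, the value of variable \<open>v\<close> being
  the bit \<open>v\<close> of the number.\<close>

definition access :: "form \<Rightarrow> int \<Rightarrow> int" where
  "access \<phi> u = of_bool (sat (bit u) \<phi>)"

text \<open>One and the same three programs serve all instances: \<open>bd\<close> computes the boundary
  function handed to \<open>A\<close>, while \<open>pre\<close> and \<open>post\<close> surround the call. The call is made with the \<open>n\<close>
  of the instance, hence for \<open>20n\<close> digits. The constant is independent of the formula.\<close>

definition sharp_SAT_by_one_call_linear :: "solver \<Rightarrow> bool" where
  "sharp_SAT_by_one_call_linear A \<longleftrightarrow>
     (\<exists>bd pre post C. \<forall>n \<phi>. vars \<phi> \<subseteq> {..<n} \<longrightarrow>
        (\<exists>\<Omega> f. admissible_domain \<Omega> \<and> represents f (frontier \<Omega>) \<and> linear_time f \<and>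
           computes_rep (access \<phi>) bd (int n) f
             (\<lambda>k i j. C * (k + len i + len j + len (int n))) \<and>
           one_call (access \<phi>) A pre post (int n) f n (int (sharp_SAT n \<phi>)) (C * (n + 1))))"


section \<open>The class \<open>#P\<close> and polynomial-time reductions\<close>

text \<open>Polish notation. All symbols are nonzero, so that registers that were never written cannot
  contribute to a formula and its size is bounded by the running time of its producer.\<close>

fun tokens :: "form \<Rightarrow> nat list" where
  "tokens (Neg a) = 1 # tokens a"
| "tokens (And a b) = 2 # tokens a @ tokens b"
| "tokens (Or a b) = 3 # tokens a @ tokens b"
| "tokens (Var v) = [v + 4]"

definition holds_instance :: "mem \<Rightarrow> nat \<Rightarrow> form \<Rightarrow> bool" where
  "holds_instance s n \<phi> \<longleftrightarrow>
     s 0 = int n \<and> s 1 = int (length (tokens \<phi>)) \<and>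
     (\<forall>k < length (tokens \<phi>). s (k + 2) = int (tokens \<phi> ! k))"

text \<open>Problem instances (binary words) are coded as natural numbers, of size their bit length.
  \<open>#P\<close> is the class of counting problems for which \<open>#SAT\<close> is complete, that is, the problems
  with a parsimonious polynomial-time reduction to \<open>#SAT\<close>. The number \<open>n\<close> of variables is
  counted in unary.\<close>

definition sharp_P :: "(nat \<Rightarrow> nat) set" where
  "sharp_P = {g. \<exists>c C d. \<forall>x. \<exists>t s n \<phi>.
     exec no_access c (input [int x]) t s \<and> holds_instance s n \<phi> \<and> vars \<phi> \<subseteq> {..<n} \<and>
     t + n \<le> C * len (int x) ^ d \<and> g x = sharp_SAT n \<phi>}"

text \<open>Polynomial-time reduction with a single call. No formula is available here: all
  programs start from the bare instance \<open>x\<close>.\<close>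

definition poly_reducible_to_conformal_radius :: "(nat \<Rightarrow> nat) \<Rightarrow> solver \<Rightarrow> bool" where
  "poly_reducible_to_conformal_radius g A \<longleftrightarrow>
     (\<exists>bd pre post C d. \<forall>x. \<exists>\<Omega> f m.
        admissible_domain \<Omega> \<and> represents f (frontier \<Omega>) \<and> linear_time f \<and>
        computes_rep no_access bd (int x) f
          (\<lambda>k i j. C * (k + len i + len j + len (int x)) ^ d) \<and>
        one_call no_access A pre post (int x) f m (int (g x)) (C * len (int x) ^ d))"

end

theory Submission
  imports Defs
begin

text \<open>
  An assignment \<open>a < 2\<^sup>n\<close> gets a point \<open>\<zeta>\<^sub>a\<close> of the unit circle. The domain is the unit disc without
  small discs of radius \<open>\<delta>\<close> around (points slightly outside) the \<open>\<zeta>\<^sub>a\<close> with \<open>a\<close> satisfying. Every such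
  notch lowers \<open>r\<close> by about \<open>\<delta>\<^sup>2 / 2\<close>, nearly independently of the others: on the circle of radius \<open>\<delta>\<close>
  around \<open>\<zeta>\<close> the Poisson kernel \<open>P\<^sub>\<zeta>(z) = (1 - \<bar>z\<bar>\<^sup>2) / \<bar>z - \<zeta>\<bar>\<^sup>2\<close> is to leading order
  \<open>- (2 / \<delta>\<^sup>2) log \<bar>z\<bar>\<close>, so the boundary values of \<open>\<bar>z\<bar> exp (c \<Sum> P\<^sub>\<zeta>(z))\<close>, the modulus of a holomorphic
  function, can be pushed above or below 1 by constants \<open>c\<close> close to \<open>\<delta>\<^sup>2 / 2\<close>, and the maximum
  principle compares \<open>r exp (c v)\<close> with 1, \<open>v\<close> being the number of notches. With \<open>\<delta>\<close> of order
  \<open>2\<^sup>-\<^sup>6\<^sup>n\<close> all errors together are less than half a notch, and \<open>v\<close> is found by rounding.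

  The boundary is easy to compute: at scales coarser than \<open>2\<^sup>-\<^sup>6\<^sup>n\<close> it looks like the circle, and at
  finer ones at most one \<open>\<zeta>\<^sub>a\<close> is near a given point, so a single evaluation of the formula suffices,
  which then takes time linear in the precision.
\<close>

section \<open>Conformal radius and boundary values\<close>

text \<open>What is compared is a Green function: \<open>log |\<psi>|\<close> tends to 0 at the
  boundary and has a logarithmic pole at 0, and \<open>log |z|\<close> plus \<open>c\<close> times
  the sum of the kernels is a trial function with the same pole. Every kernel equals 1 at 0, so the
  correction there is exactly \<open>c * v\<close>: the number of notches enters, their positions do
  not.

  Error budget with \<open>M = 2 ^ n\<close> and \<open>q = 1 / M ^ 6\<close>: a single notch is
  misjudged by a relative error of order \<open>q\<close>, in total by \<open>M * q\<close> notches;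
  mutual influence and second-order terms add about \<open>M ^ 4 * q ^ 2\<close> notches. After
  scaling by \<open>M ^ 20\<close> one notch is worth \<open>9 / 32 * M ^ 8\<close>, so taking the
  floor does no harm.

  The tightest time bound is that of the boundary program, where \<open>n\<close> counts only
  through \<open>len (int n)\<close>. At coarse precision not even \<open>2 ^ n\<close> may be
  computed, so the notches have to disappear in the tolerance between the radii \<open>e\<close> and
  \<open>2 * e\<close> that a representing function is granted. For \<open>k > 6 * n\<close> any
  work linear in \<open>n\<close> is paid for by \<open>k\<close>.\<close>

lemma normalized_riemann_map_exists:
  assumes "open \<Omega>" "simply_connected \<Omega>" "\<Omega> \<noteq> UNIV" "w \<in> \<Omega>"
  shows "\<exists>\<psi>. normalized_riemann_map \<Omega> w \<psi>"
proof -
  obtain f g where f: "f holomorphic_on \<Omega>" and g: "g holomorphic_on ball 0 1"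
    and fg: "\<forall>z\<in>\<Omega>. f z \<in> ball 0 1 \<and> g (f z) = z" "\<forall>z\<in>ball 0 1. g z \<in> \<Omega> \<and> f (g z) = z"
    using Riemann_mapping_theorem[of \<Omega>] assms by auto
  have "f w \<in> ball 0 1" using fg assms by auto
  then obtain m m' where m: "m (f w) = 0" "m holomorphic_on ball 0 1" "m ` ball 0 1 \<subseteq> ball 0 1"
      "m' ` ball 0 1 \<subseteq> ball 0 1"
      "\<And>z. z \<in> ball 0 1 \<Longrightarrow> m (m' z) = z" "\<And>z. z \<in> ball 0 1 \<Longrightarrow> m' (m z) = z"
    using ball_biholomorphism_exists by metis
  have hol1: "(m \<circ> f) holomorphic_on \<Omega>"
    using f m fg by (intro holomorphic_on_compose holomorphic_on_subset[OF m(2)]) auto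
  have bij1: "bij_betw (m \<circ> f) \<Omega> (ball 0 1)"
  proof (rule bij_betw_byWitness[where f' = "g \<circ> m'"])
    show "\<forall>a\<in>\<Omega>. (g \<circ> m') ((m \<circ> f) a) = a" using fg m(6) by simp
    show "\<forall>a'\<in>ball 0 1. (m \<circ> f) ((g \<circ> m') a') = a'"
    proof
      fix a :: complex assume a: "a \<in> ball 0 1"
      then have "m' a \<in> ball 0 1" using m(4) by blast
      then show "(m \<circ> f) ((g \<circ> m') a) = a" using fg m(5)[OF a] by simp
    qed
    show "(m \<circ> f) ` \<Omega> \<subseteq> ball 0 1" using fg m(3) by auto
    show "(g \<circ> m') ` ball 0 1 \<subseteq> \<Omega>" using fg m(4) by auto
  qed
  define d where "d = deriv (m \<circ> f) w"
  have "d \<noteq> 0" unfolding d_def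
    using holomorphic_injective_imp_regular[OF hol1 assms(1) _ assms(4)] bij1 by (simp add: bij_betw_def)
  \<comment> \<open>The Riemann map followed by a disc automorphism already sends \<open>w\<close>
    to 0; this rotation makes the derivative equal to the positive number
    \<open>cmod d\<close>.\<close>
  define c where "c = cnj d / of_real (cmod d)"
  have normc: "cmod c = 1" using \<open>d \<noteq> 0\<close> by (simp add: c_def norm_divide)
  have dc: "c * d = of_real (cmod d)"
    using \<open>d \<noteq> 0\<close> by (simp add: c_def field_simps complex_norm_square[symmetric] power2_eq_square)
  let ?\<psi> = "\<lambda>z. c * (m \<circ> f) z"
  have derc: "deriv ?\<psi> w = of_real (cmod d)"
  proof -
    have "(m \<circ> f) field_differentiable at w"
      using hol1 assms(1,4) holomorphic_on_imp_differentiable_at by blast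
    then have "deriv ?\<psi> w = c * d" unfolding d_def by (rule deriv_cmult)
    then show ?thesis using dc by simp
  qed
  have bijc: "bij_betw ((*) c) (ball 0 1) (ball 0 1)"
    by (rule bij_betw_byWitness[where f' = "\<lambda>z. z / c"])
       (use normc in \<open>auto simp: norm_mult norm_divide\<close>)
  have "bij_betw ?\<psi> \<Omega> (ball 0 1)"
    using bij_betw_trans[OF bij1 bijc] by (simp add: o_def)
  moreover have "?\<psi> holomorphic_on \<Omega>"
    using hol1 by (intro holomorphic_intros)
  ultimately show ?thesis
    unfolding normalized_riemann_map_def
    using derc m(1) \<open>d \<noteq> 0\<close> by (intro exI[of _ ?\<psi>]) auto
qed

lemma normalized_riemann_map_inverse:
  assumes "normalized_riemann_map \<Omega> w \<psi>" "open \<Omega>" "w \<in> \<Omega>"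
  obtains \<phi> where "\<phi> holomorphic_on ball 0 1" "\<phi> ` ball 0 1 = \<Omega>" "\<phi> 0 = w"
    "deriv \<phi> 0 = 1 / deriv \<psi> w"
proof -
  have hol: "\<psi> holomorphic_on \<Omega>" and bij: "bij_betw \<psi> \<Omega> (ball 0 1)" and 0: "\<psi> w = 0"
    using assms by (auto simp: normalized_riemann_map_def)
  have im: "\<psi> ` \<Omega> = ball 0 1" and inj: "inj_on \<psi> \<Omega>" using bij by (auto simp: bij_betw_def)
  obtain \<phi> where \<phi>: "\<phi> holomorphic_on \<psi> ` \<Omega>" "\<And>z. z \<in> \<Omega> \<Longrightarrow> deriv \<psi> z * deriv \<phi> (\<psi> z) = 1"
    "\<And>z. z \<in> \<Omega> \<Longrightarrow> \<phi> (\<psi> z) = z"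
    using holomorphic_has_inverse[OF hol assms(2) inj] by metis
  have "\<phi> ` ball 0 1 = \<Omega>" using \<phi>(3) unfolding im[symmetric] by (auto simp: image_iff)
  moreover have "deriv \<phi> 0 = 1 / deriv \<psi> w"
    using \<phi>(2)[OF assms(3)] 0 by (metis divide_eq_eq mult.commute mult_zero_left zero_neq_one)
  ultimately show ?thesis using that \<phi> im 0 assms(3) by metis
qed

text \<open>Schwarz's lemma for \<open>\<psi>' \<circ> \<phi>\<close>, a self-map of the disc fixing
  0, where \<open>\<phi>\<close> inverts \<open>\<psi>\<close>. Exchanging the two maps gives
  equality, which is all the uniqueness that the radius needs.\<close>

lemma normalized_riemann_map_deriv_le:
  assumes \<psi>: "normalized_riemann_map \<Omega> w \<psi>" "normalized_riemann_map \<Omega> w \<psi>'"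
    and "open \<Omega>" "w \<in> \<Omega>"
  shows "Re (deriv \<psi>' w) \<le> Re (deriv \<psi> w)"
proof -
  obtain \<phi> where \<phi>: "\<phi> holomorphic_on ball 0 1" "\<phi> ` ball 0 1 = \<Omega>" "\<phi> 0 = w"
    "deriv \<phi> 0 = 1 / deriv \<psi> w"
    using normalized_riemann_map_inverse[OF \<psi>(1) assms(3,4)] by metis
  have \<psi>': "\<psi>' holomorphic_on \<Omega>" "\<psi>' w = 0" "\<psi>' ` \<Omega> = ball 0 1"
    using \<psi>(2) by (auto simp: normalized_riemann_map_def bij_betw_def)
  have hol: "(\<psi>' \<circ> \<phi>) holomorphic_on ball 0 1"
    using \<phi> \<psi>' by (intro holomorphic_on_compose) auto
  have lt: "norm ((\<psi>' \<circ> \<phi>) z) < 1" if "norm z < 1" for z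
  proof -
    have "\<phi> z \<in> \<Omega>" using that \<phi>(2) by auto
    then show ?thesis using \<psi>'(3) by auto
  qed
  have "norm (deriv (\<psi>' \<circ> \<phi>) 0) \<le> 1"
    by (rule Schwarz_Lemma(2)[OF hol _ lt, of 0]) (use \<phi> \<psi>' in auto)
  also have "deriv (\<psi>' \<circ> \<phi>) 0 = deriv \<psi>' w * deriv \<phi> 0"
  proof (subst deriv_chain)
    show "\<phi> field_differentiable at 0"
      using \<phi>(1) holomorphic_on_imp_differentiable_at by fastforce
    show "\<psi>' field_differentiable at (\<phi> 0)"
      using \<psi>'(1) assms(3,4) \<phi>(3) holomorphic_on_imp_differentiable_at by blast
  qed (use \<phi> in auto)
  finally have "cmod (deriv \<psi>' w) \<le> cmod (deriv \<psi> w)"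
    using \<phi>(4) \<psi>(1) by (auto simp: norm_divide norm_mult field_simps normalized_riemann_map_def
        divide_le_eq split: if_splits)
  moreover have "cmod (deriv \<psi> w) = Re (deriv \<psi> w)" "cmod (deriv \<psi>' w) = Re (deriv \<psi>' w)"
    using \<psi> by (auto simp: normalized_riemann_map_def complex_is_Real_iff cmod_def)
  ultimately show ?thesis by simp
qed

lemma conformal_radius_eq:
  assumes "normalized_riemann_map \<Omega> w \<psi>" "open \<Omega>" "w \<in> \<Omega>"
  shows "conformal_radius \<Omega> w = 1 / Re (deriv \<psi> w)"
  unfolding conformal_radius_def
proof (rule the_equality)
  show "\<exists>\<psi>'. normalized_riemann_map \<Omega> w \<psi>' \<and> 1 / Re (deriv \<psi> w) = 1 / Re (deriv \<psi>' w)"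
    using assms(1) by blast
  show "r = 1 / Re (deriv \<psi> w)" if "\<exists>\<psi>. normalized_riemann_map \<Omega> w \<psi> \<and> r = 1 / Re (deriv \<psi> w)" for r
    using that normalized_riemann_map_deriv_le[OF assms(1) _ assms(2,3)]
      normalized_riemann_map_deriv_le[OF _ assms(1) assms(2,3)] by (metis order_antisym)
qed

text \<open>By the maximum principle for \<open>z * G z\<close>, the function
  \<open>\<phi> \<zeta> * G (\<phi> \<zeta>)\<close>, with \<open>\<phi>\<close> the inverse Riemann
  map, sends the disc into the closed disc and fixes 0. Schwarz's lemma bounds its derivative there,
  which is \<open>deriv \<phi> 0 * G 0\<close>.\<close>

lemma conformal_radius_upper:
  assumes \<Omega>: "open \<Omega>" "simply_connected \<Omega>" "bounded \<Omega>" "0 \<in> \<Omega>"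
    and G: "G holomorphic_on \<Omega>" "continuous_on (closure \<Omega>) G"
    and le: "\<And>p. p \<in> frontier \<Omega> \<Longrightarrow> cmod (p * G p) \<le> 1"
  shows "conformal_radius \<Omega> 0 * cmod (G 0) \<le> 1"
proof -
  have "\<Omega> \<noteq> UNIV" using \<Omega>(3) by auto
  then obtain \<psi> where \<psi>: "normalized_riemann_map \<Omega> 0 \<psi>"
    using normalized_riemann_map_exists \<Omega> by blast
  obtain \<phi> where \<phi>: "\<phi> holomorphic_on ball 0 1" "\<phi> ` ball 0 1 = \<Omega>" "\<phi> 0 = 0"
    "deriv \<phi> 0 = 1 / deriv \<psi> 0"
    using normalized_riemann_map_inverse[OF \<psi> \<Omega>(1,4)] by metis
  have r: "conformal_radius \<Omega> 0 = cmod (deriv \<phi> 0)"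
    using \<psi> conformal_radius_eq[OF \<psi> \<Omega>(1,4)]
    by (auto simp: \<phi>(4) normalized_riemann_map_def complex_is_Real_iff cmod_def norm_divide)
  have le1: "cmod (z * G z) \<le> 1" if "z \<in> \<Omega>" for z
    by (rule maximum_modulus_frontier[of "\<lambda>z. z * G z" \<Omega>])
       (use \<Omega> G le that in \<open>auto intro!: holomorphic_intros continuous_intros simp: interior_open\<close>)
  let ?h = "\<lambda>\<zeta>. \<phi> \<zeta> * G (\<phi> \<zeta>)"
  have hol: "?h holomorphic_on ball 0 1"
    using \<phi> G(1) holomorphic_on_compose[of \<phi> "ball 0 1" G] by (auto intro!: holomorphic_intros simp: o_def)
  have dG: "(\<lambda>\<zeta>. G (\<phi> \<zeta>)) field_differentiable at 0" "\<phi> field_differentiable at 0"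
    using \<phi> G(1) holomorphic_on_compose[of \<phi> "ball 0 1" G]
    by (auto simp: o_def intro!: holomorphic_on_imp_differentiable_at[of _ "ball 0 1"])
  have dh: "deriv ?h 0 = deriv \<phi> 0 * G 0"
    using deriv_mult[OF dG(2,1)] \<phi>(3) by simp
  \<comment> \<open>The maximum principle gives modulus at most 1, while Schwarz's lemma asks for
    less than 1; the factor \<open>t < 1\<close> bridges this and is removed at the end.\<close>
  have "t * (conformal_radius \<Omega> 0 * cmod (G 0)) \<le> 1" if t: "0 < t" "t < 1" for t
  proof -
    have "norm (deriv (\<lambda>\<zeta>. of_real t * ?h \<zeta>) 0) \<le> 1"
    proof (rule Schwarz_Lemma(2)[where \<xi> = 0])
      show "(\<lambda>\<zeta>. of_real t * ?h \<zeta>) holomorphic_on ball 0 1"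
        by (rule holomorphic_on_mult[OF holomorphic_on_const hol])
      show "norm (of_real t * ?h \<zeta>) < 1" if "norm \<zeta> < 1" for \<zeta>
      proof -
        have "\<phi> \<zeta> \<in> \<Omega>" using that \<phi>(2) by auto
        then have "t * cmod (?h \<zeta>) \<le> t * 1" using le1 t by (intro mult_left_mono) auto
        moreover have "norm (of_real t * ?h \<zeta>) = t * cmod (?h \<zeta>)" using t by (simp add: norm_mult)
        ultimately show ?thesis using t by linarith
      qed
    qed (use \<phi> in auto)
    also have "deriv (\<lambda>\<zeta>. of_real t * ?h \<zeta>) 0 = of_real t * deriv ?h 0"
      by (rule deriv_cmult, rule holomorphic_on_imp_differentiable_at[OF hol]) auto
    finally show ?thesis using t by (simp add: dh r norm_mult)
  qed
  then have "t * (conformal_radius \<Omega> 0 * cmod (G 0)) \<le> 1" if "0 < t" "t < 1" for t using that by blast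
  then show ?thesis by (rule field_le_mult_one_interval)
qed

text \<open>The sublevel sets of \<open>\<bar>z G z\<bar>\<close> below the boundary values are relatively compact in \<open>\<Omega>\<close>, so the
  maximum principle for \<open>\<psi> z / (z G z)\<close> needs no boundary behaviour of the conformal map \<open>\<psi>\<close>.\<close>

lemma conformal_radius_lower:
  assumes \<Omega>: "open \<Omega>" "simply_connected \<Omega>" "bounded \<Omega>" "0 \<in> \<Omega>"
    and G: "G holomorphic_on \<Omega>" "continuous_on (closure \<Omega>) G" "\<And>z. z \<in> \<Omega> \<Longrightarrow> G z \<noteq> 0"
    and ge: "\<And>p. p \<in> frontier \<Omega> \<Longrightarrow> cmod (p * G p) \<ge> 1"
  shows "conformal_radius \<Omega> 0 * cmod (G 0) \<ge> 1"
proof -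
  have "\<Omega> \<noteq> UNIV" using \<Omega>(3) by auto
  then obtain \<psi> where \<psi>: "normalized_riemann_map \<Omega> 0 \<psi>"
    using normalized_riemann_map_exists \<Omega> by blast
  have \<psi>': "\<psi> holomorphic_on \<Omega>" "\<psi> 0 = 0" "\<psi> ` \<Omega> = ball 0 1"
    using \<psi> by (auto simp: normalized_riemann_map_def bij_betw_def)
  \<comment> \<open>The quotient \<open>\<psi> z / (z * G z)\<close> with its removable singularity
    filled in; its modulus at 0 is the reciprocal of the quantity to be bounded.\<close>
  define K where "K = (\<lambda>z. (if z = 0 then deriv \<psi> 0 else \<psi> z / z) / G z)"
  have Khol: "K holomorphic_on \<Omega>" unfolding K_def
    using pole_lemma_open[OF \<psi>'(1) \<Omega>(1), of 0] G
    by (intro holomorphic_on_divide) (simp_all add: \<psi>'(2) cong: if_cong)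
  have "t \<le> conformal_radius \<Omega> 0 * cmod (G 0)" if t: "0 < t" "t < 1" for t
  proof -
    define T where "T = {z \<in> \<Omega>. cmod (z * G z) < t}"
    have cont: "continuous_on (closure \<Omega>) (\<lambda>z. cmod (z * G z))"
      using G(2) by (intro continuous_intros)
    have openT: "open T"
    proof -
      have "continuous_on \<Omega> (\<lambda>z. cmod (z * G z))"
        using cont continuous_on_subset closure_subset by blast
      from continuous_open_preimage[OF this \<Omega>(1), of "{..<t}"] show ?thesis
        by (simp add: T_def vimage_def Int_def)
    qed
    have clT: "p \<in> \<Omega> \<and> cmod (p * G p) \<le> t" if "p \<in> closure T" for p
    proof -
      have "closed {z \<in> closure \<Omega>. cmod (z * G z) \<le> t}"
        using continuous_closed_preimage[OF cont, of "{..t}"] by (simp add: vimage_def Int_def)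
      moreover have "T \<subseteq> {z \<in> closure \<Omega>. cmod (z * G z) \<le> t}"
        using closure_subset by (auto simp: T_def)
      ultimately have "p \<in> {z \<in> closure \<Omega>. cmod (z * G z) \<le> t}"
        using that closure_minimal by blast
      moreover then have "p \<notin> frontier \<Omega>" using ge[of p] t by auto
      ultimately show ?thesis using \<Omega>(1) by (auto simp: frontier_def interior_open)
    qed
    have "norm (K 0) \<le> 1 / t"
    proof (rule maximum_modulus_frontier[of K T])
      show "K holomorphic_on interior T"
        using Khol by (rule holomorphic_on_subset) (use interior_subset T_def in auto)
      show "continuous_on (closure T) K"
        using Khol clT by (meson holomorphic_on_imp_continuous_on continuous_on_subset subsetI)
      show "bounded T" using \<Omega>(3) by (rule bounded_subset) (auto simp: T_def)
      show "0 \<in> T" using \<Omega> t by (simp add: T_def)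
      fix z assume "z \<in> frontier T"
      then have z: "z \<in> closure T" "z \<notin> T" using openT by (auto simp: frontier_def interior_open)
      then have z\<Omega>: "z \<in> \<Omega>" and eq: "cmod (z * G z) = t" using clT[of z] by (auto simp: T_def)
      then have "z \<noteq> 0" using t by auto
      then have "norm (K z) = cmod (\<psi> z) / t"
        by (simp add: K_def norm_divide norm_mult eq[symmetric])
      also have "\<dots> \<le> 1 / t" using \<psi>'(3) z\<Omega> t
        by (intro divide_right_mono) (auto simp: dist_norm dest!: equalityD1 intro: less_imp_le)
      finally show "norm (K z) \<le> 1 / t" .
    qed
    moreover have "cmod (deriv \<psi> 0) = Re (deriv \<psi> 0)"
      using \<psi> by (auto simp: normalized_riemann_map_def complex_is_Real_iff cmod_def)
    then have "norm (K 0) = 1 / (conformal_radius \<Omega> 0 * cmod (G 0))"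
      using conformal_radius_eq[OF \<psi> \<Omega>(1,4)] by (simp add: K_def norm_divide)
    moreover have "conformal_radius \<Omega> 0 > 0"
      using \<psi> conformal_radius_eq[OF \<psi> \<Omega>(1,4)] by (auto simp: normalized_riemann_map_def)
    moreover have "cmod (G 0) > 0" using G(3)[OF \<Omega>(4)] by simp
    ultimately show ?thesis using t by (simp add: field_simps)
  qed
  then show ?thesis by (rule dense_le_bounded[OF zero_less_one])
qed

section \<open>Discs with notches\<close>

text \<open>The Herglotz kernel completes the Poisson kernel to a holomorphic function explicitly,
  so the comparison function is single-valued without any choice of harmonic conjugates.\<close>

lemma Re_Herglotz:
  assumes "cmod \<zeta> = 1"
  shows "Re ((\<zeta> + z) / (\<zeta> - z)) = (1 - (cmod z)\<^sup>2) / (cmod (z - \<zeta>))\<^sup>2"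
proof -
  have "(Re \<zeta>)\<^sup>2 + (Im \<zeta>)\<^sup>2 = 1" using assms cmod_power2[of \<zeta>] by simp
  then show ?thesis
    by (simp add: Re_divide cmod_power2) (simp add: algebra_simps power2_eq_square)
qed

lemma nearest_unit_point: "\<exists>p. cmod p = 1 \<and> cmod (z - p) = \<bar>1 - cmod z\<bar>"
proof (cases "z = 0")
  case True then show ?thesis by (intro exI[of _ 1]) simp
next
  case False
  have "z - sgn z = of_real (cmod z - 1) * sgn z"
    using False by (simp add: sgn_eq field_simps)
  then have "cmod (z - sgn z) = \<bar>1 - cmod z\<bar>" using False by (simp add: norm_mult norm_sgn del: of_real_diff)
  then show ?thesis using False by (intro exI[of _ "sgn z"]) (simp add: norm_sgn)
qed

text \<open>A ball is connected, so closeness of the frontier is proved by exhibiting one nearby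
  point inside the domain and one outside. The soundness proofs for the boundary test only look for
  such points.\<close>

lemma ball_meets_frontier:
  fixes z :: complex
  assumes "p \<in> \<Omega>" "q \<notin> \<Omega>" "dist z p < r" "dist z q < r"
  shows "ball z r \<inter> frontier \<Omega> \<noteq> {}"
proof (rule connected_Int_frontier)
  show "ball z r \<inter> \<Omega> \<noteq> {}" "ball z r - \<Omega> \<noteq> {}" using assms by auto
qed simp

text \<open>The centers lie outside the circle in order to make the domain star-shaped: the tangents from 0 to
  a removed disc touch it at distance \<open>sqrt ((1 + h)\<^sup>2 - d\<^sup>2) \<ge> 1\<close>.\<close>

definition notched_disc :: "complex set \<Rightarrow> real \<Rightarrow> real \<Rightarrow> complex set" where
  "notched_disc Z h d = ball 0 1 - (\<Union>\<zeta>\<in>Z. cball (of_real (1 + h) * \<zeta>) d)"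

text \<open>The upper bounds on \<open>d\<close> and \<open>h\<close> give
  \<open>h \<le> d / 40\<close>, so that the outward shift is negligible against the radius. With
  \<open>5 * d \<le> s\<close>, a point within \<open>2 * d\<close> of one center that moves by less
  than \<open>4 / 3 * d\<close> stays clear of all other notches.\<close>

locale notches =
  fixes Z :: "complex set" and h d s :: real
  assumes fin: "finite Z" and unit: "\<And>\<zeta>. \<zeta> \<in> Z \<Longrightarrow> cmod \<zeta> = 1"
    and sep: "\<And>\<zeta> \<xi>. \<zeta> \<in> Z \<Longrightarrow> \<xi> \<in> Z \<Longrightarrow> \<zeta> \<noteq> \<xi> \<Longrightarrow> s \<le> cmod (\<zeta> - \<xi>)"
    and d: "0 < d" "d \<le> 1 / 80" "5 * d \<le> s" and h: "d\<^sup>2 \<le> h" "h \<le> 2 * d\<^sup>2"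
begin

abbreviation "\<Omega> \<equiv> notched_disc Z h d"
definition cen :: "complex \<Rightarrow> complex" where "cen \<zeta> = of_real (1 + h) * \<zeta>"

lemma h_pos: "0 < h" using zero_less_power[OF d(1), of 2] h(1) by linarith
lemma h_le: "h \<le> d / 40"
proof -
  have "2 * d\<^sup>2 \<le> 2 * (d * (1 / 80))" unfolding power2_eq_square using d by (intro mult_left_mono) auto
  then show ?thesis using h by simp
qed

lemma in_domain: "z \<in> \<Omega> \<longleftrightarrow> cmod z < 1 \<and> (\<forall>\<zeta>\<in>Z. d < cmod (z - cen \<zeta>))"
  by (auto simp: notched_disc_def cen_def dist_norm norm_minus_commute not_le)

lemma cmod_cen: "\<zeta> \<in> Z \<Longrightarrow> cmod (cen \<zeta>) = 1 + h"
  using unit h_pos by (simp add: cen_def norm_mult del: of_real_add)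

lemma open_domain: "open \<Omega>" unfolding notched_disc_def
  using fin by (intro open_Diff open_ball closed_UN closed_cball) auto

lemma bounded_domain: "bounded \<Omega>" unfolding notched_disc_def by (intro bounded_diff bounded_ball)

lemma zero_in_domain: "0 \<in> \<Omega>"
  using cmod_cen d h_pos by (auto simp: in_domain)

lemma starlike_domain: "starlike \<Omega>"
  unfolding starlike_def
proof (intro bexI ballI subsetI)
  fix z x assume z: "z \<in> \<Omega>" and "x \<in> closed_segment 0 z"
  then obtain t where t: "0 \<le> t" "t \<le> 1" and x: "x = of_real t * z"
    by (auto simp: in_segment scaleR_conv_of_real)
  have z1: "cmod z < 1" using z by (simp add: in_domain)
  have "cmod x = t * cmod z" using t by (simp add: x norm_mult)
  also have "\<dots> \<le> 1 * cmod z" using t by (intro mult_right_mono) auto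
  finally have "cmod x < 1" using z1 by simp
  moreover have "d < cmod (x - cen \<zeta>)" if \<zeta>: "\<zeta> \<in> Z" for \<zeta>
  proof (rule ccontr)
    assume "\<not> d < cmod (x - cen \<zeta>)"
    then have le: "(cmod (x - cen \<zeta>))\<^sup>2 \<le> d\<^sup>2" using d by (intro power_mono) auto
    define A b C where "A = (cmod z)\<^sup>2" and "b = Re z * Re (cen \<zeta>) + Im z * Im (cen \<zeta>)"
      and "C = (1 + h)\<^sup>2 - d\<^sup>2"
    have cc: "(Re (cen \<zeta>))\<^sup>2 + (Im (cen \<zeta>))\<^sup>2 = (1 + h)\<^sup>2"
      using cmod_cen[OF \<zeta>] cmod_power2 by metis
    have expand: "(cmod (of_real u * z - cen \<zeta>))\<^sup>2 - d\<^sup>2 = u\<^sup>2 * A - 2 * u * b + C" for u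
      unfolding cmod_power2 A_def b_def C_def cc[symmetric] by (simp add: algebra_simps power2_eq_square)
    have A: "0 \<le> A" "A < 1" using z1 by (auto simp: A_def power_less_one_iff abs_square_less_1)
    have C: "C \<ge> 1" using h h_pos by (simp add: C_def power2_sum)
    have 1: "t\<^sup>2 * A - 2 * t * b + C \<le> 0" using le expand[of t] by (simp add: x)
    have "t \<noteq> 0" using 1 C by auto
    then have "0 < t" using t by simp
    \<comment> \<open>Along a ray the squared distance minus \<open>d ^ 2\<close> is a quadratic in
      the parameter whose roots have product \<open>C / A > 1\<close>. Thus a ray that has entered a
      removed disc by parameter \<open>t \<le> 1\<close> cannot have left it at parameter 1; the
      identity states this without roots.\<close>
    have "t * (A - 2 * b + C) = (t\<^sup>2 * A - 2 * t * b + C) + (1 - t) * (t * A - C)"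
      by (simp add: algebra_simps power2_eq_square)
    also have "\<dots> \<le> 0"
    proof -
      have "t * A \<le> 1 * 1" using t A by (intro mult_mono) auto
      then have "(1 - t) * (t * A - C) \<le> 0" using t C by (intro mult_nonneg_nonpos) auto
      then show ?thesis using 1 by simp
    qed
    finally have "A - 2 * b + C \<le> 0" using \<open>0 < t\<close> by (simp add: mult_le_0_iff)
    then have "(cmod (z - cen \<zeta>))\<^sup>2 \<le> d\<^sup>2" using expand[of 1] by simp
    then have "cmod (z - cen \<zeta>) \<le> d" using d power2_le_imp_le by auto
    then show False using z \<zeta> by (auto simp: in_domain)
  qed
  ultimately show "x \<in> \<Omega>" by (simp add: in_domain)
qed (rule zero_in_domain)

lemma frontier_domain:
  assumes "p \<in> frontier \<Omega>"
  shows "cmod p \<le> 1" "\<And>\<zeta>. \<zeta> \<in> Z \<Longrightarrow> d \<le> cmod (p - cen \<zeta>)"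
    "cmod p = 1 \<or> (\<exists>\<zeta>\<in>Z. cmod (p - cen \<zeta>) = d)" "1 - d \<le> cmod p"
proof -
  have "p \<in> closure \<Omega>" "p \<notin> \<Omega>" using assms open_domain by (auto simp: frontier_def interior_open)
  have 1: "\<Omega> \<subseteq> cball 0 1" by (auto simp: in_domain)
  have 2: "\<Omega> \<subseteq> - ball (cen \<zeta>) d" if "\<zeta> \<in> Z" for \<zeta>
  proof
    fix z assume "z \<in> \<Omega>"
    then have "d < cmod (z - cen \<zeta>)" using that by (simp add: in_domain)
    then show "z \<in> - ball (cen \<zeta>) d" by (simp add: dist_norm norm_minus_commute)
  qed
  show le: "cmod p \<le> 1" using closure_minimal[OF 1] \<open>p \<in> closure \<Omega>\<close> by auto
  show ge: "d \<le> cmod (p - cen \<zeta>)" if "\<zeta> \<in> Z" for \<zeta>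
    using closure_minimal[OF 2[OF that] closed_Compl[OF open_ball]] \<open>p \<in> closure \<Omega>\<close>
    by (auto simp: dist_norm norm_minus_commute)
  show or: "cmod p = 1 \<or> (\<exists>\<zeta>\<in>Z. cmod (p - cen \<zeta>) = d)"
  proof (rule ccontr)
    assume neg: "\<not> ?thesis"
    have "cmod p < 1" using le neg by linarith
    moreover have "\<forall>\<zeta>\<in>Z. d < cmod (p - cen \<zeta>)" using ge neg by (metis less_le)
    ultimately show False using \<open>p \<notin> \<Omega>\<close> by (simp add: in_domain)
  qed
  show "1 - d \<le> cmod p"
    using or
  proof
    assume "\<exists>\<zeta>\<in>Z. cmod (p - cen \<zeta>) = d"
    then obtain \<zeta> where \<zeta>: "\<zeta> \<in> Z" "cmod (p - cen \<zeta>) = d" by blast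
    have "cmod (cen \<zeta>) \<le> cmod p + cmod (p - cen \<zeta>)"
      using norm_triangle_sub[of "cen \<zeta>" p] norm_minus_commute[of "cen \<zeta>" p] by simp
    then show ?thesis using \<zeta> cmod_cen h_pos by auto
  qed (use d in auto)
qed

lemma admissible: "admissible_domain \<Omega>"
proof -
  have "\<Omega> \<noteq> UNIV" using bounded_domain by auto
  then have "frontier \<Omega> \<noteq> {}" using frontier_not_empty zero_in_domain by blast
  then have "1 - d \<le> infdist 0 (frontier \<Omega>)"
    unfolding infdist_def using frontier_domain(4) by (auto intro!: cINF_greatest)
  then have "infdist 0 (frontier \<Omega>) > 1 / 2" using d by linarith
  then show ?thesis unfolding admissible_domain_def
    using open_domain starlike_imp_simply_connected[OF starlike_domain] zero_in_domain \<open>\<Omega> \<noteq> UNIV\<close>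
    by auto
qed

section \<open>Bounds for the conformal radius by comparison functions\<close>

definition herglotz :: "complex \<Rightarrow> complex" where
  "herglotz z = (\<Sum>\<zeta>\<in>Z. (\<zeta> + z) / (\<zeta> - z))"

text \<open>Each pole of the kernels lies in its own removed disc, at distance \<open>h < d\<close>
  from the center. Hence the comparison functions are regular up to the boundary.\<close>

lemma not_in_Z: "p \<notin> Z" if "p \<in> closure \<Omega>"
proof
  assume p: "p \<in> Z"
  have "p \<in> \<Omega> \<or> p \<in> frontier \<Omega>" using that open_domain by (auto simp: frontier_def interior_open)
  then have "d \<le> cmod (p - cen p)" using p frontier_domain(2) in_domain by force
  also have "p - cen p = - of_real h * p" by (simp add: cen_def algebra_simps)
  then have "cmod (p - cen p) = h" using unit[OF p] h_pos by (simp add: norm_mult)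
  finally show False using h_le d by auto
qed

lemma cmod_herglotz_exp:
  "cmod (z * exp (of_real c * herglotz z)) = cmod z * exp (c * (\<Sum>\<zeta>\<in>Z. (1 - (cmod z)\<^sup>2) / (cmod (z - \<zeta>))\<^sup>2))"
  using unit by (simp add: norm_mult herglotz_def Re_Herglotz)

lemma herglotz_exp_regular:
  "(\<lambda>z. exp (of_real c * herglotz z)) holomorphic_on \<Omega>"
  "continuous_on (closure \<Omega>) (\<lambda>z. exp (of_real c * herglotz z))"
  "cmod (exp (of_real c * herglotz 0)) = exp (c * card Z)"
proof -
  show "(\<lambda>z. exp (of_real c * herglotz z)) holomorphic_on \<Omega>"
    unfolding herglotz_def
    by (intro holomorphic_intros) (use not_in_Z[OF subsetD[OF closure_subset]] in auto)
  show "continuous_on (closure \<Omega>) (\<lambda>z. exp (of_real c * herglotz z))"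
    unfolding herglotz_def
    by (intro continuous_intros) (use not_in_Z in auto)
  have "herglotz 0 = (\<Sum>\<zeta>\<in>Z. 1)" unfolding herglotz_def
    using unit[of 0] by (intro sum.cong) auto
  then show "cmod (exp (of_real c * herglotz 0)) = exp (c * card Z)" by simp
qed

lemma cmod_minus_cen:
  assumes "\<zeta> \<in> Z"
  shows "cmod (p - cen \<zeta>) - h \<le> cmod (p - \<zeta>)" "cmod (p - \<zeta>) \<le> cmod (p - cen \<zeta>) + h"
proof -
  have "(p - \<zeta>) - (p - cen \<zeta>) = of_real h * \<zeta>" by (simp add: cen_def algebra_simps)
  then have eq: "cmod ((p - \<zeta>) - (p - cen \<zeta>)) = h"
    using unit[OF assms] h_pos by (simp add: norm_mult)
  show "cmod (p - cen \<zeta>) - h \<le> cmod (p - \<zeta>)" "cmod (p - \<zeta>) \<le> cmod (p - cen \<zeta>) + h"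
    using norm_triangle_ineq3[of "p - \<zeta>" "p - cen \<zeta>"] eq by linarith+
qed

text \<open>On the unit circle all kernels vanish and the comparison function has modulus 1. On a
  notch circle the kernel of that notch alone suffices, the others being nonnegative;
  \<open>c\<close> is adjusted to its smallest possible value there, with \<open>d + h\<close>
  bounding the distance to the pole.\<close>

lemma radius_lower:
  "1 \<le> conformal_radius \<Omega> 0 * exp ((d + h)\<^sup>2 / (2 * (1 - d)\<^sup>2) * card Z)"
proof -
  define c where "c = (d + h)\<^sup>2 / (2 * (1 - d)\<^sup>2)"
  have c0: "c \<ge> 0" by (simp add: c_def)
  have "1 \<le> conformal_radius \<Omega> 0 * cmod (exp (of_real c * herglotz 0))"
  proof (rule conformal_radius_lower[OF open_domain starlike_imp_simply_connected[OF starlike_domain]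
        bounded_domain zero_in_domain herglotz_exp_regular(1,2)])
    fix p assume p: "p \<in> frontier \<Omega>"
    note fr = frontier_domain[OF p]
    define \<rho> where "\<rho> = cmod p"
    have \<rho>: "1 - d \<le> \<rho>" "\<rho> \<le> 1" using fr by (auto simp: \<rho>_def)
    have tau: "0 \<le> 1 - \<rho>\<^sup>2" using \<rho> d by (simp add: abs_square_le_1)
    let ?P = "\<lambda>\<zeta>. (1 - \<rho>\<^sup>2) / (cmod (p - \<zeta>))\<^sup>2"
    have "1 \<le> \<rho> * exp (c * (\<Sum>\<zeta>\<in>Z. ?P \<zeta>))"
      using fr(3)
    proof
      assume "\<exists>\<zeta>\<in>Z. cmod (p - cen \<zeta>) = d"
      then obtain \<xi> where \<xi>: "\<xi> \<in> Z" "cmod (p - cen \<xi>) = d" by blast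
      have near: "d - h \<le> cmod (p - \<xi>)" "cmod (p - \<xi>) \<le> d + h"
        using cmod_minus_cen[OF \<xi>(1), of p] \<xi>(2) by auto
      have "(1 - \<rho>\<^sup>2) / (d + h)\<^sup>2 \<le> ?P \<xi>"
        using near tau h_le h_pos d by (intro divide_left_mono power_mono mult_pos_pos zero_less_power) auto
      also have "?P \<xi> \<le> (\<Sum>\<zeta>\<in>Z. ?P \<zeta>)"
        using fin \<xi> tau by (intro member_le_sum) auto
      finally have "c * ((1 - \<rho>\<^sup>2) / (d + h)\<^sup>2) \<le> c * (\<Sum>\<zeta>\<in>Z. ?P \<zeta>)"
        using c0 by (intro mult_left_mono)
      moreover have "c * ((1 - \<rho>\<^sup>2) / (d + h)\<^sup>2) = (1 - \<rho>\<^sup>2) / (2 * (1 - d)\<^sup>2)"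
        using d h_pos by (simp add: c_def)
      ultimately have "1 + (1 - \<rho>\<^sup>2) / (2 * (1 - d)\<^sup>2) \<le> exp (c * (\<Sum>\<zeta>\<in>Z. ?P \<zeta>))"
        using exp_ge_add_one_self[of "c * (\<Sum>\<zeta>\<in>Z. ?P \<zeta>)"] by linarith
      then have "\<rho> * (1 + (1 - \<rho>\<^sup>2) / (2 * (1 - d)\<^sup>2)) \<le> \<rho> * exp (c * (\<Sum>\<zeta>\<in>Z. ?P \<zeta>))"
        using \<rho> d by (intro mult_left_mono) auto
      moreover have "1 \<le> \<rho> * (1 + (1 - \<rho>\<^sup>2) / (2 * (1 - d)\<^sup>2))"
      proof -
        \<comment> \<open>The left side vanishes at \<open>\<rho> = 1\<close>, hence the factor
          \<open>1 - \<rho>\<close>. The factor \<open>(1 - d) ^ 2\<close> in the definition of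
          \<open>c\<close> is what makes the cofactor nonnegative on the whole range
          \<open>1 - d \<le> \<rho> \<le> 1\<close>.\<close>
        have *: "\<rho> * (1 + (1 - \<rho>\<^sup>2) / (2 * (1 - d)\<^sup>2)) - 1
            = (1 - \<rho>) * (\<rho> * (1 + \<rho>) / (2 * (1 - d)\<^sup>2) - 1)"
          using d by (simp add: field_simps power2_eq_square power3_eq_cube)
        have "(1 - d) * (2 * (1 - d)) \<le> \<rho> * (1 + \<rho>)"
          using \<rho> d by (intro mult_mono) auto
        moreover have "0 < (1 - d) * (2 * (1 - d))" using d by (intro mult_pos_pos) auto
        ultimately have "1 \<le> \<rho> * (1 + \<rho>) / ((1 - d) * (2 * (1 - d)))"
          by (subst pos_le_divide_eq) auto
        then have "1 \<le> \<rho> * (1 + \<rho>) / (2 * (1 - d)\<^sup>2)"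
          by (simp add: power2_eq_square mult_ac)
        then have "0 \<le> (1 - \<rho>) * (\<rho> * (1 + \<rho>) / (2 * (1 - d)\<^sup>2) - 1)"
          using \<rho> by (intro mult_nonneg_nonneg) auto
        then show ?thesis using * by linarith
      qed
      ultimately show ?thesis by linarith
    qed (simp add: \<rho>_def)
    then show "1 \<le> cmod (p * exp (of_real c * herglotz p))"
      unfolding cmod_herglotz_exp \<rho>_def .
  qed simp
  then show ?thesis unfolding herglotz_exp_regular(3) c_def by simp
qed

text \<open>Here \<open>K\<close> bounds the sum of all kernels divided by
  \<open>1 - \<rho> ^ 2\<close>: the notch at hand contributes at most
  \<open>1 / (d - h) ^ 2\<close>, and every other pole, at distance at least \<open>s / 2\<close>,
  at most \<open>4 / s ^ 2\<close>. With \<open>c = 1 / (2 * K)\<close> the claim on a notch circle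
  becomes \<open>x * exp (1 - x) \<le> 1\<close> for \<open>x = \<rho> ^ 2\<close>.\<close>

lemma radius_upper:
  "conformal_radius \<Omega> 0 * exp (card Z / (2 * (1 / (d - h)\<^sup>2 + card Z * (4 / s\<^sup>2)))) \<le> 1"
proof -
  define K where "K = 1 / (d - h)\<^sup>2 + card Z * (4 / s\<^sup>2)"
  define c where "c = 1 / (2 * K)"
  have s0: "s > 0" using d by linarith
  have dh: "d - h > 0" using h_le d by auto
  have K0: "K > 0" unfolding K_def using dh by (intro add_pos_nonneg) auto
  have "conformal_radius \<Omega> 0 * cmod (exp (of_real c * herglotz 0)) \<le> 1"
  proof (rule conformal_radius_upper[OF open_domain starlike_imp_simply_connected[OF starlike_domain]
        bounded_domain zero_in_domain herglotz_exp_regular(1,2)])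
    fix p assume p: "p \<in> frontier \<Omega>"
    note fr = frontier_domain[OF p]
    define \<rho> where "\<rho> = cmod p"
    have \<rho>: "1 - d \<le> \<rho>" "\<rho> \<le> 1" using fr by (auto simp: \<rho>_def)
    have tau: "0 \<le> 1 - \<rho>\<^sup>2" using \<rho> d by (simp add: abs_square_le_1)
    let ?P = "\<lambda>\<zeta>. (1 - \<rho>\<^sup>2) / (cmod (p - \<zeta>))\<^sup>2"
    have "\<rho> * exp (c * (\<Sum>\<zeta>\<in>Z. ?P \<zeta>)) \<le> 1"
      using fr(3)
    proof
      assume "\<exists>\<zeta>\<in>Z. cmod (p - cen \<zeta>) = d"
      then obtain \<xi> where \<xi>: "\<xi> \<in> Z" "cmod (p - cen \<xi>) = d" by blast
      have near: "d - h \<le> cmod (p - \<xi>)" "cmod (p - \<xi>) \<le> d + h"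
        using cmod_minus_cen[OF \<xi>(1), of p] \<xi>(2) by auto
      have "(\<Sum>\<zeta>\<in>Z. ?P \<zeta>) = ?P \<xi> + (\<Sum>\<zeta>\<in>Z - {\<xi>}. ?P \<zeta>)"
        using fin \<xi> by (simp add: sum.remove)
      also have "?P \<xi> \<le> (1 - \<rho>\<^sup>2) / (d - h)\<^sup>2"
        using near tau dh by (intro divide_left_mono power_mono mult_pos_pos zero_less_power) auto
      also have "(\<Sum>\<zeta>\<in>Z - {\<xi>}. ?P \<zeta>) \<le> of_nat (card (Z - {\<xi>})) * ((1 - \<rho>\<^sup>2) * (4 / s\<^sup>2))"
      proof (rule sum_bounded_above)
        fix \<zeta> assume \<zeta>: "\<zeta> \<in> Z - {\<xi>}"
        have "s \<le> cmod (\<zeta> - \<xi>)" using sep \<zeta> \<xi> by auto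
        also have "\<dots> \<le> cmod (p - \<zeta>) + cmod (p - \<xi>)"
          using norm_triangle_ineq4[of "p - \<xi>" "p - \<zeta>"] by simp
        finally have "s / 2 \<le> cmod (p - \<zeta>)" using near h_le d by linarith
        then have "?P \<zeta> \<le> (1 - \<rho>\<^sup>2) / (s / 2)\<^sup>2"
          using s0 tau by (intro divide_left_mono power_mono mult_pos_pos zero_less_power) auto
        then show "?P \<zeta> \<le> (1 - \<rho>\<^sup>2) * (4 / s\<^sup>2)" by (simp add: power_divide)
      qed
      also have "\<dots> \<le> of_nat (card Z) * ((1 - \<rho>\<^sup>2) * (4 / s\<^sup>2))"
        using fin tau by (intro mult_right_mono) (auto intro: card_mono)
      finally have "(\<Sum>\<zeta>\<in>Z. ?P \<zeta>) \<le> (1 - \<rho>\<^sup>2) * K"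
        by (simp add: K_def algebra_simps)
      then have "c * (\<Sum>\<zeta>\<in>Z. ?P \<zeta>) \<le> (1 - \<rho>\<^sup>2) / 2"
        using K0 by (simp add: c_def field_simps)
      then have "exp (c * (\<Sum>\<zeta>\<in>Z. ?P \<zeta>)) \<le> exp ((1 - \<rho>\<^sup>2) / 2)" by simp
      then have "\<rho> * exp (c * (\<Sum>\<zeta>\<in>Z. ?P \<zeta>)) \<le> \<rho> * exp ((1 - \<rho>\<^sup>2) / 2)"
        using \<rho> d by (intro mult_left_mono) auto
      moreover have "(\<rho> * exp ((1 - \<rho>\<^sup>2) / 2))\<^sup>2 \<le> 1\<^sup>2"
      proof -
        have "\<rho>\<^sup>2 \<le> exp (\<rho>\<^sup>2 - 1)" using exp_ge_add_one_self[of "\<rho>\<^sup>2 - 1"] by simp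
        then have "\<rho>\<^sup>2 * exp (1 - \<rho>\<^sup>2) \<le> exp (\<rho>\<^sup>2 - 1) * exp (1 - \<rho>\<^sup>2)" by (intro mult_right_mono) auto
        also have "\<dots> = 1" by (simp flip: exp_add)
        also have "\<rho>\<^sup>2 * exp (1 - \<rho>\<^sup>2) = (\<rho> * exp ((1 - \<rho>\<^sup>2) / 2))\<^sup>2"
          by (simp add: power_mult_distrib flip: exp_of_nat_mult)
        finally show ?thesis by simp
      qed
      then have "\<rho> * exp ((1 - \<rho>\<^sup>2) / 2) \<le> 1" by (rule power2_le_imp_le) simp
      ultimately show ?thesis by linarith
    qed (simp add: \<rho>_def)
    then show "cmod (p * exp (of_real c * herglotz p)) \<le> 1"
      unfolding cmod_herglotz_exp \<rho>_def .
  qed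
  then show ?thesis unfolding herglotz_exp_regular(3) c_def K_def by simp
qed

end

section \<open>Recognizing the boundary\<close>

text \<open>At a corner, a point close to \<open>\<Omega>\<close> has to move away from the notch and from the circle at once;
  the displacement \<open>(- 11 / 10 e, 8 / 5 e)\<close>, of length below \<open>2 e\<close>, does both. The radius of the
  notches has the factor \<open>3 / 4\<close> so that only the two cases of \<open>ratio\<close> occur for \<open>e = 2\<^sup>-\<^sup>k\<close>.\<close>

lemma corner_escape:
  fixes x y d e h :: real
  assumes e: "0 < e" "3 * e \<le> 2 * d" and ratio: "2 * d = 3 * e \<or> 3 * e \<le> d"
    and d: "d \<le> 1 / 80" and h: "0 \<le> h" and y: "0 \<le> y"
    and in_disc: "(1 + h + x)\<^sup>2 + y\<^sup>2 < (1 + e)\<^sup>2"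
    and far: "(d - e)\<^sup>2 < x\<^sup>2 + y\<^sup>2" and near: "x\<^sup>2 + y\<^sup>2 \<le> (2 * d)\<^sup>2"
  shows "(1 + h + x - 11 / 10 * e)\<^sup>2 + (y + 8 / 5 * e)\<^sup>2 < 1"
    and "d\<^sup>2 < (x - 11 / 10 * e)\<^sup>2 + (y + 8 / 5 * e)\<^sup>2"
proof -
  have d0: "0 < d" using e by linarith
  have "x\<^sup>2 \<le> (2 * d)\<^sup>2" "y\<^sup>2 \<le> (2 * d)\<^sup>2"
    using near zero_le_power2[of x] zero_le_power2[of y] by linarith+
  then have "\<bar>x\<bar> \<le> 2 * d" "\<bar>y\<bar> \<le> 2 * d"
    using d0 abs_le_square_iff[of x "2 * d"] abs_le_square_iff[of y "2 * d"] by auto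
  then have xy: "- 1 / 40 \<le> x" "y \<le> 1 / 40" using d by auto
  have e1: "e \<le> 1 / 120" using e d by linarith
  have "(1 + h + x - 11 / 10 * e)\<^sup>2 + (y + 8 / 5 * e)\<^sup>2
      = (1 + h + x)\<^sup>2 + y\<^sup>2 + e * (377 / 100 * e - 22 / 10 * (1 + h + x) + 16 / 5 * y)"
    by (simp add: power2_eq_square algebra_simps)
  also have "\<dots> < (1 + e)\<^sup>2 + e * (377 / 100 * e - 22 / 10 * (1 + h + x) + 16 / 5 * y)"
    using in_disc by simp
  also have "\<dots> = 1 + e * (2 + 477 / 100 * e - 22 / 10 * (1 + h + x) + 16 / 5 * y)"
    by (simp add: power2_eq_square algebra_simps)
  also have "\<dots> \<le> 1"
  proof -
    have "2 + 477 / 100 * e - 22 / 10 * (1 + h + x) + 16 / 5 * y \<le> 0"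
      using xy e1 h by (simp add: field_simps)
    then show ?thesis using e by (simp add: mult_nonneg_nonpos)
  qed
  finally show "(1 + h + x - 11 / 10 * e)\<^sup>2 + (y + 8 / 5 * e)\<^sup>2 < 1" .
  show "d\<^sup>2 < (x - 11 / 10 * e)\<^sup>2 + (y + 8 / 5 * e)\<^sup>2"
  proof (cases "x \<le> 0")
    \<comment> \<open>Now \<open>y - x\<close> is at least the distance to the center, hence at
      least \<open>d - e\<close>. The displacement adds \<open>22 / 10 * e * (y - x)\<close> and its
      own square, which outweighs the deficit \<open>2 * e * (d - e) + e * e\<close>.\<close>
    case True
    have "(d - e)\<^sup>2 \<le> (y - x)\<^sup>2"
    proof -
      have "x * y \<le> 0" using True y by (rule mult_nonpos_nonneg)
      then have "x\<^sup>2 + y\<^sup>2 \<le> (y - x)\<^sup>2" by (simp add: power2_eq_square algebra_simps)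
      then show ?thesis using far by linarith
    qed
    then have "d - e \<le> y - x" using True y by (intro power2_le_imp_le[of "d - e" "y - x"]) auto
    then have "e * (d - e) \<le> e * (y - x)" using e by (intro mult_left_mono) auto
    moreover have "0 < e * d" "0 < e * e" using e d0 by auto
    moreover have "(x - 11 / 10 * e)\<^sup>2 + (y + 8 / 5 * e)\<^sup>2
        = x\<^sup>2 + y\<^sup>2 + 22 / 10 * (e * (y - x)) + e * y + 377 / 100 * (e * e)"
      by (simp add: power2_eq_square field_simps)
    moreover have "(d - e)\<^sup>2 = d\<^sup>2 - 2 * (e * (d - e)) - e * e"
      by (simp add: power2_eq_square algebra_simps)
    moreover have "0 \<le> e * y" using e y by simp
    ultimately show ?thesis using far by (simp add: right_diff_distrib)
  next
    case False
    have "(1 + h + x)\<^sup>2 < (1 + e)\<^sup>2" using in_disc zero_le_power2[of y] by linarith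
    then have "1 + h + x < 1 + e" by (rule power2_less_imp_less) (use e in simp)
    then have x: "0 < x" "x < e" using False h by auto
    have pos: "0 < (x - 11 / 10 * e)\<^sup>2" using x e by auto
    \<comment> \<open>Since \<open>0 < x < e\<close>, nearly all of the distance is in
      \<open>y\<close>. If \<open>2 * d = 3 * e\<close>, the vertical displacement alone exceeds
      \<open>d\<close>; if \<open>3 * e \<le> d\<close>, the hypothesis \<open>far\<close> forces
      \<open>d - 8 / 5 * e \<le> y\<close>.\<close>
    have "d \<le> y + 8 / 5 * e"
      using ratio
    proof
      assume "3 * e \<le> d"
      have "(d - 8 / 5 * e)\<^sup>2 \<le> y\<^sup>2"
      proof -
        have "x * x \<le> e * e" using x by (intro mult_mono) auto
        moreover have "e * (3 * e) \<le> e * d" using \<open>3 * e \<le> d\<close> e by (intro mult_left_mono) auto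
        moreover have "(d - 8 / 5 * e)\<^sup>2 = (d - e)\<^sup>2 - 6 / 5 * (e * d) + 39 / 25 * (e * e)"
          by (simp add: power2_eq_square algebra_simps)
        moreover have "0 < e * e" using e by simp
        ultimately show ?thesis using far by (simp add: power2_eq_square[of x])
      qed
      then have "d - 8 / 5 * e \<le> y" using y by (rule power2_le_imp_le)
      then show ?thesis by simp
    qed (use y e in auto)
    then have "d\<^sup>2 \<le> (y + 8 / 5 * e)\<^sup>2" using d0 by (intro power_mono) auto
    then show ?thesis using pos by linarith
  qed
qed

section \<open>Frontier points near a given point, at fine and at coarse mesh\<close>

context notches
begin

lemma cmod_cnj_rotate: "\<zeta> \<in> Z \<Longrightarrow> cmod (z * cnj \<zeta>) = cmod z"
  using unit by (simp add: norm_mult)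

lemma rotate_simps:
  assumes "\<zeta> \<in> Z" shows "\<zeta> * cnj \<zeta> = 1"
  using unit[OF assms] by (simp add: complex_norm_square[symmetric])

lemma exterior_point_near:
  assumes "\<zeta> \<in> Z" "cmod (z - cen \<zeta>) < d + e" "0 < e"
  shows "\<exists>q. q \<notin> \<Omega> \<and> dist z q < e"
proof (cases "d < cmod (z - cen \<zeta>)")
  case True
  define \<rho> where "\<rho> = cmod (z - cen \<zeta>)"
  define q where "q = cen \<zeta> + of_real (d / \<rho>) * (z - cen \<zeta>)"
  have \<rho>: "0 < \<rho>" "d < \<rho>" "\<rho> < d + e" using True d assms by (auto simp: \<rho>_def)
  have "cmod (q - cen \<zeta>) = d" using \<rho> d by (simp add: q_def norm_mult norm_divide \<rho>_def[symmetric])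
  then have "q \<notin> \<Omega>" using assms by (auto simp: in_domain)
  have "z - q = of_real (1 - d / \<rho>) * (z - cen \<zeta>)" by (simp add: q_def algebra_simps)
  then have "dist z q = \<bar>1 - d / \<rho>\<bar> * \<rho>" by (simp only: dist_norm norm_mult norm_of_real \<rho>_def)
  moreover have "\<bar>1 - d / \<rho>\<bar> * \<rho> = \<rho> - d" using \<rho> by (simp add: abs_if field_simps)
  ultimately have "dist z q < e" using \<rho> by simp
  with \<open>q \<notin> \<Omega>\<close> show ?thesis by blast
next
  case False
  then have "z \<notin> \<Omega>" using assms by (auto simp: in_domain)
  then show ?thesis using assms by (intro exI[of _ z]) auto
qed

lemma exterior_point_near_circle:
  assumes "1 - e < cmod z" "cmod z < 1"
  shows "\<exists>q. q \<notin> \<Omega> \<and> dist z q < e"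
proof -
  obtain p where p: "cmod p = 1" "cmod (z - p) = \<bar>1 - cmod z\<bar>"
    using nearest_unit_point by blast
  then show ?thesis using assms by (intro exI[of _ p]) (auto simp: dist_norm in_domain)
qed

lemma radial_shrink:
  assumes "0 < t" "t \<le> cmod z"
  shows "\<exists>w. cmod w = t \<and> dist z w = cmod z - t"
proof -
  have z: "cmod z > 0" using assms by linarith
  let ?w = "of_real (t / cmod z) * z"
  have "z - ?w = of_real (1 - t / cmod z) * z" by (simp add: algebra_simps)
  then have "dist z ?w = \<bar>1 - t / cmod z\<bar> * cmod z" by (simp only: dist_norm norm_mult norm_of_real)
  moreover have "\<bar>1 - t / cmod z\<bar> * cmod z = cmod z - t"
    using assms z by (simp add: abs_if field_simps)
  ultimately have "dist z ?w = cmod z - t" by simp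
  moreover have "cmod ?w = t" using assms z by (simp add: norm_mult norm_divide)
  ultimately show ?thesis by blast
qed

lemma interior_point_near:
  assumes e: "0 < e" "3 * e \<le> 2 * d" and ratio: "2 * d = 3 * e \<or> 3 * e \<le> d"
    and z: "cmod z < 1 + e" "\<And>\<zeta>. \<zeta> \<in> Z \<Longrightarrow> d - e < cmod (z - cen \<zeta>)" and "z \<notin> \<Omega>"
  shows "\<exists>w\<in>\<Omega>. dist z w < 2 * e"
proof (cases "\<exists>\<zeta>\<in>Z. cmod (z - cen \<zeta>) \<le> 2 * d")
  case True
  then obtain \<zeta> where \<zeta>: "\<zeta> \<in> Z" "cmod (z - cen \<zeta>) \<le> 2 * d" by blast
  \<comment> \<open>The rotation by \<open>cnj \<zeta>\<close> puts the center of the notch at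
    \<open>1 + h\<close> on the real axis, and the sign \<open>\<sigma>\<close> reflects into the
    upper half-plane: these are the coordinates of \<open>corner_escape\<close>.\<close>
  define u where "u = (z - cen \<zeta>) * cnj \<zeta>"
  define \<sigma> where "\<sigma> = (if 0 \<le> Im u then 1 else - 1 :: real)"
  have \<sigma>: "\<sigma>\<^sup>2 = 1" "\<sigma> * \<sigma> = 1" "\<sigma> * Im u = \<bar>Im u\<bar>" by (auto simp: \<sigma>_def)
  define v where "v = Complex (- 11 / 10 * e) (\<sigma> * (8 / 5 * e))"
  define w where "w = z + \<zeta> * v"
  have zu: "z * cnj \<zeta> = of_real (1 + h) + u"
    using rotate_simps[OF \<zeta>(1)] by (simp add: u_def cen_def algebra_simps)
  have wu: "w * cnj \<zeta> = of_real (1 + h) + u + v" "(w - cen \<zeta>) * cnj \<zeta> = u + v"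
    using zu rotate_simps[OF \<zeta>(1)] by (simp_all add: w_def u_def algebra_simps)
  have "(cmod (z * cnj \<zeta>))\<^sup>2 < (1 + e)\<^sup>2"
    using z(1) e cmod_cnj_rotate[OF \<zeta>(1)] by (simp add: power_strict_mono)
  then have 1: "(1 + h + Re u)\<^sup>2 + \<bar>Im u\<bar>\<^sup>2 < (1 + e)\<^sup>2"
    unfolding zu cmod_power2 by simp
  have cu: "cmod u = cmod (z - cen \<zeta>)" unfolding u_def by (rule cmod_cnj_rotate[OF \<zeta>(1)])
  have "(d - e)\<^sup>2 < (cmod u)\<^sup>2" using z(2)[OF \<zeta>(1)] e unfolding cu by (intro power_strict_mono) auto
  then have 2: "(d - e)\<^sup>2 < (Re u)\<^sup>2 + \<bar>Im u\<bar>\<^sup>2" by (simp add: cmod_power2)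
  have "(cmod u)\<^sup>2 \<le> (2 * d)\<^sup>2" using \<zeta>(2) unfolding cu by (intro power_mono) auto
  then have 3: "(Re u)\<^sup>2 + \<bar>Im u\<bar>\<^sup>2 \<le> (2 * d)\<^sup>2" by (simp add: cmod_power2)
  have im: "(Im u + \<sigma> * (8 / 5 * e))\<^sup>2 = (\<bar>Im u\<bar> + 8 / 5 * e)\<^sup>2"
  proof -
    have "\<bar>Im u\<bar> + 8 / 5 * e = \<sigma> * (Im u + \<sigma> * (8 / 5 * e))"
      using \<sigma> by (simp add: algebra_simps)
    then show ?thesis using \<sigma> by (simp add: power_mult_distrib)
  qed
  note esc = corner_escape[OF e ratio d(2) less_imp_le[OF h_pos] abs_ge_zero 1 2 3]
  have "(cmod (w * cnj \<zeta>))\<^sup>2 < 1"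
    unfolding wu cmod_power2 using esc(1) im by (simp add: v_def)
  then have w1: "cmod w < 1" using cmod_cnj_rotate[OF \<zeta>(1)] by (simp add: power_less_one_iff abs_square_less_1)
  have "d\<^sup>2 < (cmod ((w - cen \<zeta>) * cnj \<zeta>))\<^sup>2"
    unfolding wu cmod_power2 using esc(2) im by (simp add: v_def)
  then have w2: "d < cmod (w - cen \<zeta>)" 
    using cmod_cnj_rotate[OF \<zeta>(1)] power2_less_imp_less[of d "cmod (w - cen \<zeta>)"] by simp
  have "(cmod v)\<^sup>2 < (2 * e)\<^sup>2"
  proof -
    have "(cmod v)\<^sup>2 = (11 / 10)\<^sup>2 * e\<^sup>2 + \<sigma>\<^sup>2 * ((8 / 5)\<^sup>2 * e\<^sup>2)"
      unfolding cmod_power2 v_def by (simp add: power_mult_distrib power_divide)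
    also have "\<dots> = 377 / 100 * e\<^sup>2" using \<sigma>(1) by (simp add: power2_eq_square)
    finally have "(cmod v)\<^sup>2 = 377 / 100 * e\<^sup>2" .
    moreover have "(2 * e)\<^sup>2 = 4 * e\<^sup>2" "0 < e\<^sup>2" using e by (simp_all add: power_mult_distrib)
    ultimately show ?thesis by linarith
  qed
  then have "cmod v < 2 * e" using e power2_less_imp_less by fastforce
  then have zw: "dist z w < 2 * e"
    using unit[OF \<zeta>(1)] by (simp add: dist_norm w_def norm_mult)
  have "d < cmod (w - cen \<xi>)" if \<xi>: "\<xi> \<in> Z" for \<xi>
  proof (cases "\<xi> = \<zeta>")
    case False
    have "s \<le> cmod (\<zeta> - \<xi>)" using sep \<zeta> \<xi> False by auto
    also have "\<dots> \<le> (1 + h) * cmod (\<zeta> - \<xi>)" using h_pos by (simp add: mult_le_cancel_right1)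
    also have "\<dots> = cmod (cen \<zeta> - cen \<xi>)"
      using h_pos by (simp add: cen_def norm_mult flip: right_diff_distrib del: of_real_add)
    also have "\<dots> \<le> cmod (w - cen \<xi>) + cmod (w - cen \<zeta>)"
      using norm_triangle_ineq4[of "w - cen \<xi>" "w - cen \<zeta>"] by simp
    also have "cmod (w - cen \<zeta>) \<le> dist z w + cmod (z - cen \<zeta>)"
      using norm_triangle_ineq[of "w - z" "z - cen \<zeta>"] by (simp add: dist_norm norm_minus_commute)
    finally show ?thesis using zw \<zeta>(2) d e by linarith
  qed (use w2 in simp)
  then have "w \<in> \<Omega>" using w1 by (simp add: in_domain)
  then show ?thesis using zw by blast
next
  case False
  then have far: "\<And>\<zeta>. \<zeta> \<in> Z \<Longrightarrow> 2 * d < cmod (z - cen \<zeta>)" by force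
  then have "1 \<le> cmod z" using \<open>z \<notin> \<Omega>\<close> d by (force simp: in_domain)
  \<comment> \<open>Any modulus slightly below 1 would do: the point moves by less than
    \<open>21 / 20 * e < d\<close>, while all centers are farther than \<open>2 * d\<close>.\<close>
  then obtain w where w: "cmod w = 1 - e / 20" "dist z w = cmod z - (1 - e / 20)"
    using radial_shrink[of "1 - e / 20" z] e d by auto
  have "d < cmod (w - cen \<zeta>)" if "\<zeta> \<in> Z" for \<zeta>
  proof -
    have "cmod (z - cen \<zeta>) \<le> dist z w + cmod (w - cen \<zeta>)"
      using norm_triangle_ineq[of "z - w" "w - cen \<zeta>"] by (simp add: dist_norm)
    then show ?thesis using far[OF that] w z(1) e by linarith
  qed
  then have "w \<in> \<Omega>" using w e by (simp add: in_domain)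
  moreover have "dist z w < 2 * e" using w z(1) e by linarith
  ultimately show ?thesis by blast
qed

text \<open>The hypotheses on \<open>z\<close> are the necessary conditions of
  \<open>fine_complete\<close> for a frontier point within \<open>e\<close>. Being sufficient for
  one within \<open>2 * e\<close>, they form a legitimate test for a representing function.\<close>

lemma fine_sound:
  assumes e: "0 < e" "3 * e \<le> 2 * d" and ratio: "2 * d = 3 * e \<or> 3 * e \<le> d"
    and z: "cmod z < 1 + e" "\<And>\<zeta>. \<zeta> \<in> Z \<Longrightarrow> d - e < cmod (z - cen \<zeta>)"
      "1 - e < cmod z \<or> (\<exists>\<zeta>\<in>Z. cmod (z - cen \<zeta>) < d + e)"
  shows "ball z (2 * e) \<inter> frontier \<Omega> \<noteq> {}"
proof (cases "z \<in> \<Omega>")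
  case True
  then have "\<exists>q. q \<notin> \<Omega> \<and> dist z q < e"
    using z(3) exterior_point_near exterior_point_near_circle e by (auto simp: in_domain)
  then show ?thesis using ball_meets_frontier[OF True] e by force
next
  case False
  then obtain w where "w \<in> \<Omega>" "dist z w < 2 * e" using interior_point_near[OF e ratio z(1,2)] by blast
  then show ?thesis using ball_meets_frontier[OF _ False] e by force
qed

lemma fine_complete:
  assumes "p \<in> frontier \<Omega>" "dist z p < e"
  shows "cmod z < 1 + e" "\<And>\<zeta>. \<zeta> \<in> Z \<Longrightarrow> d - e < cmod (z - cen \<zeta>)"
      "1 - e < cmod z \<or> (\<exists>\<zeta>\<in>Z. cmod (z - cen \<zeta>) < d + e)"
proof -
  note fr = frontier_domain[OF assms(1)]
  have 1: "cmod (z - c) < cmod (p - c) + e" "cmod (p - c) < cmod (z - c) + e" for c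
    using norm_triangle_ineq[of "z - p" "p - c"] norm_triangle_ineq[of "p - z" "z - c"] assms(2)
    by (auto simp: dist_norm norm_minus_commute)
  show "cmod z < 1 + e" using 1(1)[of 0] fr(1) by simp
  show "d - e < cmod (z - cen \<zeta>)" if "\<zeta> \<in> Z" for \<zeta> using 1(2)[of "cen \<zeta>"] fr(2)[OF that] by simp
  show "1 - e < cmod z \<or> (\<exists>\<zeta>\<in>Z. cmod (z - cen \<zeta>) < d + e)"
    using fr(3) 1(2)[of 0] 1(1) by force
qed

text \<open>Frontier points have modulus at least \<open>1 - d\<close>, and
  \<open>d + e \<le> 7 / 4 * e\<close>: the notches are absorbed into a slightly thicker annulus
  that does not depend on them.\<close>

lemma coarse_complete:
  assumes "p \<in> frontier \<Omega>" "dist z p < e" "4 * d \<le> 3 * e"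
  shows "cmod z < 1 + e" "1 - 7 / 4 * e < cmod z"
proof -
  note fr = frontier_domain[OF assms(1)]
  have "cmod z < cmod p + e" "cmod p < cmod z + e"
    using norm_triangle_sub[of z p] norm_triangle_sub[of p z] assms(2)
    by (auto simp: dist_norm norm_minus_commute)
  then show "cmod z < 1 + e" "1 - 7 / 4 * e < cmod z" using fr assms by linarith+
qed

lemma coarse_sound:
  assumes "4 * d \<le> 3 * e" "e \<le> 1" "cmod z < 1 + e" "1 - 7 / 4 * e < cmod z"
  shows "ball z (2 * e) \<inter> frontier \<Omega> \<noteq> {}"
proof (cases "z \<in> \<Omega>")
  case True
  then obtain q where "q \<notin> \<Omega>" "dist z q < 7 / 4 * e"
    using exterior_point_near_circle[OF assms(4)] by (auto simp: in_domain)
  then show ?thesis using ball_meets_frontier[OF True] assms d by force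
next
  case False
  have "1 - d \<le> cmod z"
  proof (rule ccontr)
    assume lt: "\<not> 1 - d \<le> cmod z"
    then obtain \<zeta> where \<zeta>: "\<zeta> \<in> Z" "cmod (z - cen \<zeta>) \<le> d"
      using False d by (force simp: in_domain)
    then have "1 + h \<le> cmod z + d"
      using norm_triangle_sub[of "cen \<zeta>" z] cmod_cen[OF \<zeta>(1)] by (simp add: norm_minus_commute)
    then show False using lt h_pos by linarith
  qed
  \<comment> \<open>Below modulus \<open>1 - d\<close> no notch is met, so this point lies in the
    domain wherever the notches are; the total move stays below
    \<open>e + 3 / 4 * e + e / 10 < 2 * e\<close>.\<close>
  then obtain w where w: "cmod w = 1 - d - e / 10" "dist z w = cmod z - (1 - d - e / 10)"
    using radial_shrink[of "1 - d - e / 10" z] assms d by auto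
  have "d < cmod (w - cen \<zeta>)" if "\<zeta> \<in> Z" for \<zeta>
    using norm_triangle_sub[of "cen \<zeta>" w] w cmod_cen[OF that] h_pos assms d
    by (simp add: norm_minus_commute)
  then have "w \<in> \<Omega>" using w d assms by (simp add: in_domain)
  then show ?thesis using ball_meets_frontier[OF _ False, of w z "2 * e"] w assms d by force
qed

end

section \<open>The domain of a formula\<close>

text \<open>The tangent half-angle parametrization of the circle: \<open>a\<close> is recovered from a nearby point
  \<open>(x, y)\<close> by rounding \<open>2\<^sup>n y / (1 + x)\<close>.\<close>

definition node :: "nat \<Rightarrow> int \<Rightarrow> complex" where
  "node n a = Complex ((4 ^ n - (of_int a)\<^sup>2) / (4 ^ n + (of_int a)\<^sup>2)) (2 * 2 ^ n * of_int a / (4 ^ n + (of_int a)\<^sup>2))"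

definition models :: "nat \<Rightarrow> form \<Rightarrow> int set" where
  "models n \<phi> = {a. 0 \<le> a \<and> a < 2 ^ n \<and> sat (bit a) \<phi>}"

definition sat_radius :: "nat \<Rightarrow> real" where "sat_radius n = 3 / 4 / 64 ^ n"

text \<open>This is \<open>16 / 9\<close> times the square of the radius, within the range that the
  locale \<open>notches\<close> prescribes, and a unit fraction, which keeps the common denominators
  simple.\<close>

definition sat_shift :: "nat \<Rightarrow> real" where "sat_shift n = 1 / 4096 ^ n"

definition sat_domain :: "nat \<Rightarrow> form \<Rightarrow> complex set" where
  "sat_domain n \<phi> = notched_disc (node n ` models n \<phi>) (sat_shift n) (sat_radius n)"

lemma sat_cong: "(\<And>v. v \<in> vars \<phi> \<Longrightarrow> \<alpha> v = \<beta> v) \<Longrightarrow> sat \<alpha> \<phi> = sat \<beta> \<phi>"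
  by (induction \<phi>) auto

text \<open>Formulas contain no constants, so every instance has \<open>1 \<le> n\<close>; this
  guarantees that the notches are small enough.\<close>

lemma vars_not_empty: "vars \<phi> \<noteq> {}"
  by (induction \<phi>) auto

lemma finite_models: "finite (models n \<phi>)"
  by (rule finite_subset[of _ "{0..<2 ^ n}"]) (auto simp: models_def)

lemma card_models:
  assumes "vars \<phi> \<subseteq> {..<n}"
  shows "card (models n \<phi>) = sharp_SAT n \<phi>"
  unfolding sharp_SAT_def
proof (rule bij_betw_same_card)
  let ?f = "\<lambda>a::int. restrict (bit a) {..<n}" and ?A = "{\<alpha> \<in> {..<n} \<rightarrow>\<^sub>E (UNIV :: bool set). sat \<alpha> \<phi>}"
  have sat: "sat (restrict (bit a) {..<n}) \<phi> = sat (bit a) \<phi>" for a :: int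
    using assms by (intro sat_cong) auto
  show "bij_betw ?f (models n \<phi>) ?A"
  proof (rule bij_betw_imageI)
    show "inj_on ?f (models n \<phi>)"
    proof (rule inj_onI)
      fix a b assume ab: "a \<in> models n \<phi>" "b \<in> models n \<phi>" "?f a = ?f b"
      have *: "\<not> bit c m" if "c \<in> models n \<phi>" "n \<le> m" for c m
      proof -
        have "take_bit n c = c" using that by (simp add: models_def take_bit_int_eq_self)
        then show ?thesis using that bit_take_bit_iff[of n c m] by (metis not_le)
      qed
      have "bit a m = bit b m" for m
      proof (cases "m < n")
        case True
        then show ?thesis using fun_cong[OF ab(3), of m] by simp
      qed (use ab * in auto)
      then show "a = b" by (auto intro: bit_eqI)
    qed
    show "?f ` models n \<phi> = ?A"
    proof (intro equalityI subsetI)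
      fix \<alpha> assume \<alpha>: "\<alpha> \<in> ?A"
      define a :: int where "a = horner_sum of_bool 2 (map \<alpha> [0..<n])"
      have bit_a: "bit a m \<longleftrightarrow> m < n \<and> \<alpha> m" for m
        unfolding a_def by (auto simp: bit_horner_sum_bit_iff)
      have "a = take_bit n a" by (rule bit_eqI) (auto simp: bit_a bit_take_bit_iff)
      then have "0 \<le> a" "a < 2 ^ n" by (metis take_bit_nonnegative, metis take_bit_int_less_exp)
      moreover have "?f a = \<alpha>" using \<alpha> by (auto simp: bit_a PiE_def extensional_def fun_eq_iff)
      ultimately have "a \<in> models n \<phi>" using sat[of a] \<alpha> by (auto simp: models_def)
      then show "\<alpha> \<in> ?f ` models n \<phi>" using \<open>?f a = \<alpha>\<close> by blast
    qed (auto simp: sat models_def)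
  qed
qed

section \<open>Geometry of the nodes\<close>

lemma denom_pos: "0 < (4::real) ^ n + (of_int a)\<^sup>2"
  by (simp add: add_pos_nonneg)

lemma pow4: "(4::real) ^ n = (2 ^ n)\<^sup>2" by (simp add: power2_eq_square flip: power_mult_distrib)

lemma pow64: "(64::real) ^ n = (2 ^ n) ^ 6" and pow4096: "(4096::real) ^ n = (2 ^ n) ^ 12"
proof -
  have swap: "((2::real) ^ m) ^ n = (2 ^ n) ^ m" for m by (simp add: mult.commute flip: power_mult)
  show "(64::real) ^ n = (2 ^ n) ^ 6" "(4096::real) ^ n = (2 ^ n) ^ 12"
    using swap[of 6] swap[of 12] by simp_all
qed

lemma cmod_node: "cmod (node n a) = 1"
proof -
  have *: "((X - Y) / (X + Y))\<^sup>2 + (2 * M * b / (X + Y))\<^sup>2 = 1"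
    if "X + Y > 0" "X = M\<^sup>2" "Y = b\<^sup>2" for X Y M b :: real
  proof -
    have "((X - Y) / (X + Y))\<^sup>2 + (2 * M * b / (X + Y))\<^sup>2 = ((X - Y)\<^sup>2 + 4 * (X * Y)) / (X + Y)\<^sup>2"
      by (simp add: that(2,3) power_divide power_mult_distrib add_divide_distrib)
    moreover have "(X - Y)\<^sup>2 + 4 * (X * Y) = (X + Y)\<^sup>2" by (simp add: power2_eq_square algebra_simps)
    moreover have "X + Y \<noteq> 0" using that(1) by linarith
    ultimately show ?thesis by simp
  qed
  have "(cmod (node n a))\<^sup>2 = 1"
    unfolding cmod_power2 node_def complex.sel
    by (rule *[OF denom_pos pow4 refl])
  then show ?thesis by (simp add: power2_eq_1_iff) (smt (verit) norm_ge_zero)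
qed

lemma node_half_angle:
  "Im (node n a) = of_int a / 2 ^ n * (1 + Re (node n a))"
  using denom_pos[of n a] by (simp add: node_def pow4 field_simps power2_eq_square)

lemma Re_node_nonneg:
  assumes "0 \<le> a" "a < 2 ^ n" shows "0 \<le> Re (node n a)"
proof -
  have "real_of_int a < 2 ^ n" using assms(2) by (metis of_int_less_iff of_int_numeral of_int_power)
  then have "(real_of_int a)\<^sup>2 \<le> (2 ^ n)\<^sup>2" using assms by (intro power_mono) auto
  then show ?thesis using denom_pos[of n a] by (simp add: node_def pow4)
qed

text \<open>The half-angle tangent \<open>t = a / 2 ^ n\<close> makes \<open>y - t * (1 + x)\<close>
  vanish at the node, and its coefficients are at most 1 in modulus. This one linear form both
  separates the nodes and identifies the node next to a point.\<close>

lemma half_angle_bound: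
  assumes a: "0 \<le> a" "a < 2 ^ n"
  shows "\<bar>Im z - of_int a / 2 ^ n * (1 + Re z)\<bar> \<le> 2 * cmod (z - node n a)"
proof -
  define t where "t = of_int a / (2::real) ^ n"
  have "real_of_int a < 2 ^ n" using a(2) by (metis of_int_less_iff of_int_numeral of_int_power)
  then have t: "0 \<le> t" "t \<le> 1" using a by (auto simp: t_def)
  define x y where "x = Re (z - node n a)" and "y = Im (z - node n a)"
  have xy: "\<bar>x\<bar> \<le> cmod (z - node n a)" "\<bar>y\<bar> \<le> cmod (z - node n a)"
    unfolding x_def y_def by (rule abs_Re_le_cmod, rule abs_Im_le_cmod)
  have "Im z - t * (1 + Re z) = y - t * x"
    using node_half_angle[of n a] by (simp add: x_def y_def t_def[symmetric] algebra_simps)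
  also have "\<bar>\<dots>\<bar> \<le> \<bar>y\<bar> + t * \<bar>x\<bar>" using t by (simp add: abs_mult order_trans[OF abs_triangle_ineq4])
  finally have "\<bar>Im z - t * (1 + Re z)\<bar> \<le> \<bar>y\<bar> + t * \<bar>x\<bar>" .
  moreover have "t * \<bar>x\<bar> \<le> 1 * \<bar>x\<bar>" using t by (intro mult_right_mono) auto
  ultimately show ?thesis using xy unfolding t_def by linarith
qed

text \<open>At the node of \<open>a\<close>, the linear form belonging to \<open>b\<close> takes the
  value \<open>(a - b) / 2 ^ n * (1 + Re (node n a))\<close>, and the last factor is at least 1 on
  the right half of the circle.\<close>

lemma node_separated:
  assumes a: "0 \<le> a" "a < 2 ^ n" and b: "0 \<le> b" "b < 2 ^ n" and "a \<noteq> b"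
  shows "1 / 2 / 2 ^ n \<le> cmod (node n a - node n b)"
proof -
  have "1 / 2 ^ n \<le> \<bar>of_int a - of_int b\<bar> / (2::real) ^ n"
    using \<open>a \<noteq> b\<close> by (intro divide_right_mono) (auto simp flip: of_int_diff of_int_abs)
  also have "\<dots> * 1 \<le> \<bar>of_int a - of_int b\<bar> / (2::real) ^ n * (1 + Re (node n a))"
    using Re_node_nonneg[OF a] by (intro mult_left_mono) auto
  also have "\<dots> = \<bar>(of_int a - of_int b) / 2 ^ n * (1 + Re (node n a))\<bar>"
    using Re_node_nonneg[OF a] by (simp add: abs_mult)
  also have "(of_int a - of_int b) / 2 ^ n * (1 + Re (node n a))
      = Im (node n a) - of_int b / 2 ^ n * (1 + Re (node n a))"
    using node_half_angle[of n a] by (simp add: diff_divide_distrib left_diff_distrib)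
  also have "\<bar>\<dots>\<bar> \<le> 2 * cmod (node n a - node n b)" by (rule half_angle_bound[OF b])
  finally show ?thesis by simp
qed

lemma notches_sat:
  assumes "1 \<le> n"
  shows "notches (node n ` models n \<phi>) (sat_shift n) (sat_radius n) (1 / 2 / 2 ^ n)"
proof
  have p: "(64::real) ^ n \<ge> 64" "(32::real) ^ n \<ge> 32"
    using assms self_le_power[of "64::real" n] self_le_power[of "32::real" n] by simp_all
  show "finite (node n ` models n \<phi>)" using finite_models by simp
  show "cmod \<zeta> = 1" if "\<zeta> \<in> node n ` models n \<phi>" for \<zeta> using that cmod_node by auto
  show "1 / 2 / 2 ^ n \<le> cmod (\<zeta> - \<xi>)"
    if "\<zeta> \<in> node n ` models n \<phi>" "\<xi> \<in> node n ` models n \<phi>" "\<zeta> \<noteq> \<xi>" for \<zeta> \<xi>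
  proof -
    from that obtain a b where "\<zeta> = node n a" "\<xi> = node n b" "a \<in> models n \<phi>" "b \<in> models n \<phi>"
      by blast
    then show ?thesis using node_separated[of a n b] that(3) by (auto simp: models_def)
  qed
  show "0 < sat_radius n" by (simp add: sat_radius_def)
  show "sat_radius n \<le> 1 / 80" using p by (simp add: sat_radius_def field_simps)
  have "(64::real) ^ n = 2 ^ n * 32 ^ n" by (simp flip: power_mult_distrib)
  then show "5 * sat_radius n \<le> 1 / 2 / 2 ^ n" using p by (simp add: sat_radius_def field_simps)
  have "(4096::real) ^ n = (64 ^ n)\<^sup>2" by (simp add: power2_eq_square flip: power_mult_distrib)
  then show "(sat_radius n)\<^sup>2 \<le> sat_shift n" "sat_shift n \<le> 2 * (sat_radius n)\<^sup>2"
    by (simp_all add: sat_radius_def sat_shift_def power_divide power2_eq_square field_simps)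
qed

lemma inj_on_node: "inj_on (node n) (models n \<phi>)"
proof (rule inj_onI, rule ccontr)
  fix a b assume "a \<in> models n \<phi>" "b \<in> models n \<phi>" "node n a = node n b" "a \<noteq> b"
  then have "1 / 2 / 2 ^ n \<le> (0::real)" using node_separated[of a n b] by (auto simp: models_def)
  moreover have "0 < 1 / 2 / (2::real) ^ n" by simp
  ultimately show False by linarith
qed

text \<open>The unit is one notch, \<open>d ^ 2 / 2\<close>; the radius determines \<open>v\<close>
  up to \<open>2 / 5\<close>, leaving room for the floor before the \<open>1 / 2\<close> that
  rounding tolerates. The first error is at most \<open>5 * M * q\<close>, the second at most
  \<open>3 * M * q + 10 * M ^ 4 * q ^ 2\<close>; both are far below \<open>2 / 5\<close> already for
  \<open>M = 2\<close>.\<close>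

lemma count_from_radius_aux:
  fixes M q r v :: real
  assumes M: "2 \<le> M" and q: "q = 1 / M ^ 6" and v: "0 \<le> v" "v \<le> M"
    and dh: "d = 3 / 4 * q" "h = q\<^sup>2"
    and lower: "1 \<le> r * exp ((d + h)\<^sup>2 / (2 * (1 - d)\<^sup>2) * v)"
    and upper: "r * exp (v / (2 * (1 / (d - h)\<^sup>2 + v * (4 / (1 / 2 / M)\<^sup>2)))) \<le> 1"
  shows "d\<^sup>2 / 2 * (v - 2 / 5) \<le> 1 - r" "1 - r \<le> d\<^sup>2 / 2 * (v + 2 / 5)"
proof -
  have pw: "M ^ 6 \<ge> 64" "M ^ 5 \<ge> 32" "M ^ 8 \<ge> 256" 
    using power_mono[OF M, of 6] power_mono[OF M, of 5] power_mono[OF M, of 8] by simp_all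
  have q1: "0 < q" "q \<le> 1 / 64" using pw M by (auto simp: q field_simps)
  have Mq: "M * q \<le> 1 / 32" using pw M by (simp add: q field_simps eval_nat_numeral)
  have M3q: "M ^ 4 * q\<^sup>2 \<le> 1 / 256" using pw M by (simp add: q field_simps eval_nat_numeral)
  have d0: "0 < d" using q1 by (simp add: dh)
  have h_eq: "h = 4 / 3 * q * d" by (simp add: dh power2_eq_square)
  show "1 - r \<le> d\<^sup>2 / 2 * (v + 2 / 5)"
  proof -
    define c where "c = (d + h)\<^sup>2 / (2 * (1 - d)\<^sup>2)"
    have "1 - c * v \<le> exp (- (c * v))" using exp_ge_add_one_self[of "- (c * v)"] by simp
    also have "\<dots> \<le> r" using lower by (simp add: c_def exp_minus field_simps)
    finally have "1 - r \<le> c * v" by simp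
    also have "c * v \<le> d\<^sup>2 / 2 * (1 + 5 * q) * v"
    proof (rule mult_right_mono)
      have "(d + h)\<^sup>2 = d\<^sup>2 * (1 + 4 / 3 * q)\<^sup>2" by (simp add: h_eq power2_eq_square algebra_simps)
      moreover have "(1 + 4 / 3 * q)\<^sup>2 \<le> (1 + 5 * q) * (1 - d)\<^sup>2"
      proof -
        have "(1 + 5 * q) * (1 - d)\<^sup>2 - (1 + 4 / 3 * q)\<^sup>2
            = q * (5 / 6 + q * (- 1255 / 144) + 45 / 16 * q\<^sup>2)"
          by (simp add: dh power2_eq_square field_simps)
        also have "\<dots> \<ge> 0"
        proof (rule mult_nonneg_nonneg)
          show "0 \<le> 5 / 6 + q * (- 1255 / 144) + 45 / 16 * q\<^sup>2"
            using q1 zero_le_power2[of q] by linarith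
        qed (use q1 in simp)
        finally show ?thesis by simp
      qed
      ultimately have "(d + h)\<^sup>2 \<le> d\<^sup>2 * ((1 + 5 * q) * (1 - d)\<^sup>2)" using mult_left_mono by fastforce
      then show "c \<le> d\<^sup>2 / 2 * (1 + 5 * q)" using q1 by (simp add: c_def dh field_simps)
    qed (rule v)
    also have "\<dots> = d\<^sup>2 / 2 * (v + 5 * (v * q))" by (simp add: algebra_simps)
    also have "\<dots> \<le> d\<^sup>2 / 2 * (v + 2 / 5)"
    proof (rule mult_left_mono)
      have "v * q \<le> M * q" using v q1 by (intro mult_right_mono) auto
      then show "v + 5 * (v * q) \<le> v + 2 / 5" using Mq by simp
    qed simp
    finally show ?thesis .
  qed
  show "d\<^sup>2 / 2 * (v - 2 / 5) \<le> 1 - r"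
  proof -
    define K where "K = 1 / (d - h)\<^sup>2 + v * (4 / (1 / 2 / M)\<^sup>2)"
    have dmh: "d - h = d * (1 - 4 / 3 * q)" by (simp add: h_eq algebra_simps)
    have K0: "0 < K" unfolding K_def using d0 q1 v by (intro add_pos_nonneg) (auto simp: dmh)
    define x where "x = v / (2 * K)"
    have x0: "0 \<le> x" using K0 v by (simp add: x_def)
    have "r * (1 + x) \<le> 1"
    proof (cases "0 \<le> r")
      case True
      then have "r * (1 + x) \<le> r * exp x" using exp_ge_add_one_self by (intro mult_left_mono) auto
      then show ?thesis using upper by (simp add: x_def K_def)
    next
      case False
      then have "r * (1 + x) \<le> 0" using x0 by (intro mult_nonpos_nonneg) auto
      then show ?thesis by simp
    qed
    then have "x / (1 + x) \<le> 1 - r" using x0 by (simp add: field_simps)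
    moreover have "x / (1 + x) = v / (2 * K + v)"
      using K0 v by (simp add: x_def field_simps)
    moreover have "d\<^sup>2 / 2 * (v - 2 / 5) \<le> v / (2 * K + v)"
    proof -
      \<comment> \<open>\<open>T\<close> compares one notch with \<open>1 / (2 * K + v)\<close>, the
        loss per notch that the upper bound on the radius guarantees. It is close to 1, and the goal
        becomes \<open>(T - 1) * v \<le> 2 / 5 * T\<close>.\<close>
      define T where "T = d\<^sup>2 / 2 * (2 * K + v)"
      have T_eq: "T = d\<^sup>2 * K + d\<^sup>2 / 2 * v" by (simp add: T_def algebra_simps)
      have "d\<^sup>2 * K = 1 / (1 - 4 / 3 * q)\<^sup>2 + 16 * v * M\<^sup>2 * d\<^sup>2"
      proof -
        have "d\<^sup>2 * (1 / (d * (1 - 4 / 3 * q))\<^sup>2) = 1 / (1 - 4 / 3 * q)\<^sup>2"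
          using d0 by (simp add: power_mult_distrib)
        moreover have "d\<^sup>2 * (v * (4 / (1 / 2 / M)\<^sup>2)) = 16 * v * M\<^sup>2 * d\<^sup>2"
          by (simp add: power_divide)
        ultimately show ?thesis unfolding K_def dmh distrib_left by simp
      qed
      moreover have "1 / (1 - 4 / 3 * q)\<^sup>2 \<le> 1 + 3 * q"
      proof -
        have "(1 + 3 * q) * (1 - 4 / 3 * q)\<^sup>2 - 1 = q * (1 / 3 + q * (- 56 / 9) + 16 / 3 * q\<^sup>2)"
          by (simp add: power2_eq_square field_simps)
        also have "\<dots> \<ge> 0"
        proof (rule mult_nonneg_nonneg)
          show "0 \<le> 1 / 3 + q * (- 56 / 9) + 16 / 3 * q\<^sup>2"
            using q1 zero_le_power2[of q] by linarith
        qed (use q1 in simp)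
        finally show ?thesis using q1 by (simp add: divide_le_eq)
      qed
      moreover have "16 * v * M\<^sup>2 * d\<^sup>2 = 9 * v * (M\<^sup>2 * q\<^sup>2)" by (simp add: dh power2_eq_square)
      moreover have "d\<^sup>2 / 2 * v \<le> v * (M\<^sup>2 * q\<^sup>2)"
      proof -
        have "q\<^sup>2 * 1 \<le> q\<^sup>2 * M\<^sup>2" using M by (intro mult_left_mono) (auto simp: one_le_power)
        moreover have "d\<^sup>2 / 2 = 9 / 32 * q\<^sup>2" by (simp add: dh power_mult_distrib power_divide)
        moreover have "0 \<le> q\<^sup>2" "q\<^sup>2 * M\<^sup>2 = M\<^sup>2 * q\<^sup>2" by simp_all
        ultimately have "d\<^sup>2 / 2 \<le> M\<^sup>2 * q\<^sup>2" by linarith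
        then show ?thesis using mult_right_mono[OF _ v(1)] unfolding mult.commute[of v] by blast
      qed
      ultimately have T: "T \<le> 1 + 3 * q + 10 * v * (M\<^sup>2 * q\<^sup>2)"
        using T_eq by linarith
      have T0: "1 \<le> T"
      proof -
        have "(1 - 4 / 3 * q)\<^sup>2 \<le> 1" using q1 by (simp add: power_le_one)
        then have "1 \<le> 1 / (1 - 4 / 3 * q)\<^sup>2" using q1 by simp
        moreover have "0 \<le> 16 * v * M\<^sup>2 * d\<^sup>2" "0 \<le> d\<^sup>2 / 2 * v" using v by auto
        ultimately show ?thesis using T_eq \<open>d\<^sup>2 * K = _\<close> by linarith
      qed
      have "(T - 1) * v \<le> (3 * q + 10 * v * (M\<^sup>2 * q\<^sup>2)) * v"
        using T v by (intro mult_right_mono) auto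
      also have "\<dots> = 3 * (v * q) + 10 * (v\<^sup>2 * (M\<^sup>2 * q\<^sup>2))" by (simp add: power2_eq_square algebra_simps)
      also have "\<dots> \<le> 3 * (M * q) + 10 * (M\<^sup>2 * (M\<^sup>2 * q\<^sup>2))"
        using v q1 by (intro add_mono mult_left_mono mult_right_mono power_mono) auto
      also have "M\<^sup>2 * (M\<^sup>2 * q\<^sup>2) = M ^ 4 * q\<^sup>2" by (simp add: eval_nat_numeral)
      also have "3 * (M * q) + 10 * (M ^ 4 * q\<^sup>2) \<le> 2 / 5 * 1" using Mq M3q by simp
      also have "\<dots> \<le> 2 / 5 * T" using T0 by simp
      finally have "T * (v - 2 / 5) \<le> v" by (simp add: algebra_simps)
      moreover have "d\<^sup>2 / 2 * (v - 2 / 5) * (2 * K + v) = T * (v - 2 / 5)" by (simp add: T_def)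
      moreover have "0 < 2 * K + v" using K0 v by linarith
      ultimately show ?thesis by (subst pos_le_divide_eq) linarith+
    qed
    ultimately show ?thesis by linarith
  qed
qed

text \<open>By \<open>1 - r \<approx> v \<delta>\<^sup>2 / 2\<close> with \<open>\<delta>\<^sup>2 / 2 = 9 / (32 \<cdot> 2\<^sup>1\<^sup>2\<^sup>n)\<close>, the count is \<open>32 (2\<^sup>2\<^sup>0\<^sup>n - R) / (9 \<cdot> 2\<^sup>8\<^sup>n)\<close>
  rounded.\<close>

lemma count_from_radius:
  assumes "1 \<le> n" "vars \<phi> \<subseteq> {..<n}" "R = \<lfloor>2 ^ (20 * n) * conformal_radius (sat_domain n \<phi>) 0\<rfloor>"
  shows "(64 * ((2 ^ n) ^ 20 - R) + 9 * (2 ^ n) ^ 8) div (18 * (2 ^ n) ^ 8) = int (sharp_SAT n \<phi>)"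
proof -
  interpret notches "node n ` models n \<phi>" "sat_shift n" "sat_radius n" "1 / 2 / 2 ^ n"
    by (rule notches_sat) fact
  define M :: real where "M = 2 ^ n"
  define r where "r = conformal_radius (sat_domain n \<phi>) 0"
  define v where "v = real (sharp_SAT n \<phi>)"
  have M2: "2 \<le> M" using assms(1) self_le_power[of "2::real" n] by (simp add: M_def)
  have card: "card (node n ` models n \<phi>) = sharp_SAT n \<phi>"
    using card_image[OF inj_on_node] card_models[OF assms(2)] by simp
  have "sharp_SAT n \<phi> \<le> card {0..<2 ^ n :: int}"
    unfolding card_models[OF assms(2), symmetric] by (rule card_mono) (auto simp: models_def)
  then have "sharp_SAT n \<phi> \<le> 2 ^ n" by (simp add: nat_power_eq)
  then have vM: "v \<le> M" unfolding v_def M_def by (metis of_nat_le_iff of_nat_numeral of_nat_power)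
  have M6: "(64::real) ^ n = M ^ 6" "(4096::real) ^ n = (M ^ 6)\<^sup>2"
    by (simp_all add: M_def pow64 pow4096 flip: power_mult)
  have rad: "sat_radius n = 3 / 4 * (1 / M ^ 6)" and shift: "sat_shift n = (1 / M ^ 6)\<^sup>2"
    by (simp_all add: sat_radius_def sat_shift_def M6 power_divide)
  have lower: "1 \<le> r * exp ((sat_radius n + sat_shift n)\<^sup>2 / (2 * (1 - sat_radius n)\<^sup>2) * v)"
    using radius_lower unfolding r_def card sat_domain_def v_def .
  have upper: "r * exp (v / (2 * (1 / (sat_radius n - sat_shift n)\<^sup>2 + v * (4 / (1 / 2 / M)\<^sup>2)))) \<le> 1"
    using radius_upper unfolding r_def card sat_domain_def v_def M_def .
  have "0 \<le> v" by (simp add: v_def)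
  note bounds = count_from_radius_aux[OF M2 refl \<open>0 \<le> v\<close> vM rad shift lower upper]
  define W where "W = 9 / 32 * M ^ 8"
  have "M ^ 20 * ((sat_radius n)\<^sup>2 / 2) = W"
    using M2 by (simp add: W_def rad power_divide power_mult_distrib field_simps eval_nat_numeral)
  then have W: "W * (v - 2 / 5) \<le> M ^ 20 * (1 - r)" "M ^ 20 * (1 - r) \<le> W * (v + 2 / 5)"
    using mult_left_mono[OF bounds(1), of "M ^ 20"] mult_left_mono[OF bounds(2), of "M ^ 20"] M2
    by (simp_all add: mult.assoc[symmetric])
  have M20: "(2::real) ^ (20 * n) = M ^ 20" by (simp add: M_def mult.commute power_mult)
  have R: "M ^ 20 * (1 - r) \<le> M ^ 20 - of_int R" "M ^ 20 - of_int R < M ^ 20 * (1 - r) + 1"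
    using assms(3) unfolding r_def M20 by (simp_all add: algebra_simps) linarith+
  \<comment> \<open>The floor loses less than 1, at most \<open>1 / 72\<close> of a notch, and
    \<open>2 / 5 + 1 / 72 < 1 / 2\<close>. Multiplying by 64 makes the unit
    \<open>64 * W = 18 * M ^ 8\<close> an integer, and \<open>32 * W\<close> is the half unit added
    for rounding.\<close>
  have W72: "72 \<le> W" using power_mono[OF M2, of 8] by (simp add: W_def)
  define D where "D = M ^ 20 - of_int R"
  have 1: "64 * W * v \<le> 64 * D + 32 * W" "64 * D + 32 * W < 64 * W * (v + 1)"
    using R W W72 by (simp_all add: D_def algebra_simps)
  have eq1: "real_of_int (64 * ((2 ^ n) ^ 20 - R) + 9 * (2 ^ n) ^ 8) = 64 * D + 32 * W"
    by (simp add: D_def W_def M_def)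
  have eq2: "real_of_int (18 * (2 ^ n) ^ 8) = 64 * W" by (simp add: W_def M_def)
  have "\<lfloor>real_of_int (64 * ((2 ^ n) ^ 20 - R) + 9 * (2 ^ n) ^ 8) / real_of_int (18 * (2 ^ n) ^ 8)\<rfloor>
      = int (sharp_SAT n \<phi>)"
    unfolding eq1 eq2
    using 1 W72 by (intro floor_unique) (simp_all add: v_def field_simps)
  then show ?thesis by (simp only: floor_divide_of_int_eq)
qed

text \<open>This bounds the length of the solver's answer by \<open>20 * n + 1\<close>, so that
  postprocessing takes linear time.\<close>

lemma conformal_radius_sat_domain:
  assumes "1 \<le> n"
  shows "0 \<le> conformal_radius (sat_domain n \<phi>) 0" "conformal_radius (sat_domain n \<phi>) 0 \<le> 1"
proof -
  interpret notches "node n ` models n \<phi>" "sat_shift n" "sat_radius n" "1 / 2 / 2 ^ n"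
    by (rule notches_sat) fact
  define r where "r = conformal_radius (sat_domain n \<phi>) 0"
  obtain x where x: "1 \<le> r * exp x" using radius_lower unfolding r_def sat_domain_def by blast
  then have "0 < r * exp x" by linarith
  then have r0: "0 < r" by (simp add: zero_less_mult_iff)
  obtain y where y: "0 \<le> y" "r * exp y \<le> 1"
    using radius_upper unfolding r_def sat_domain_def by (metis add_nonneg_nonneg divide_nonneg_nonneg
        mult_nonneg_nonneg of_nat_0_le_iff zero_le_numeral zero_le_one zero_le_power2)
  have "r * 1 \<le> r * exp y" using r0 y(1) by (intro mult_left_mono) auto
  then show "0 \<le> conformal_radius (sat_domain n \<phi>) 0" "conformal_radius (sat_domain n \<phi>) 0 \<le> 1"
    using r0 y(2) unfolding r_def by linarith+
qed

text \<open>With all distances multiplied by common denominators: \<open>a\<close> is the only index whose node can be near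
  the point, \<open>V\<close> stands for its squared distance from the center of the notch, and \<open>g\<close> for the ratio of
  \<open>64\<^sup>-\<^sup>n / 2\<close> and the mesh size.\<close>

definition boundary_test :: "nat \<Rightarrow> form \<Rightarrow> set_rep" where
  "boundary_test n \<phi> k i j = (let G = 2 ^ k in
     i\<^sup>2 + j\<^sup>2 < (G + 1)\<^sup>2 \<and>
     (if k \<le> 6 * n then 4 * G < 7 \<or> (4 * G - 7)\<^sup>2 < 16 * (i\<^sup>2 + j\<^sup>2)
      else let M = 2 ^ n; a = (2 * M * j + (G + i)) div (2 * (G + i)); N = M\<^sup>2 + a\<^sup>2; H = M ^ 12;
             g = G div (2 * M ^ 6);
             V = 4 * ((i * N * H - G * (H + 1) * (M\<^sup>2 - a\<^sup>2))\<^sup>2 + (j * N * H - G * (H + 1) * (2 * M * a))\<^sup>2)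
        in (a \<in> models n \<phi> \<longrightarrow> (N * H * (3 * g - 2))\<^sup>2 < V) \<and>
           ((G - 1)\<^sup>2 < i\<^sup>2 + j\<^sup>2 \<or> a \<in> models n \<phi> \<and> V < (N * H * (3 * g + 2))\<^sup>2)))"

section \<open>The integer test and the distances it stands for\<close>

lemma square_less_iff: "0 \<le> x \<Longrightarrow> 0 \<le> y \<Longrightarrow> x\<^sup>2 < y\<^sup>2 \<longleftrightarrow> x < (y::real)"
  by (meson power_strict_mono power2_less_imp_less zero_less_numeral)

lemma cmod_grid_less:
  fixes i j :: int and c :: real
  assumes "0 \<le> c"
  shows "cmod (Complex (i / 2 ^ k) (j / 2 ^ k)) < c \<longleftrightarrow> i\<^sup>2 + j\<^sup>2 < (2 ^ k * c)\<^sup>2"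
    and "c < cmod (Complex (i / 2 ^ k) (j / 2 ^ k)) \<longleftrightarrow> (2 ^ k * c)\<^sup>2 < i\<^sup>2 + j\<^sup>2"
proof -
  define z where "z = Complex (i / 2 ^ k) (j / 2 ^ k)"
  have sq: "i\<^sup>2 + j\<^sup>2 = (2 ^ k * cmod z)\<^sup>2"
    by (simp add: z_def cmod_power2 power_mult_distrib power_divide distrib_left)
  show "cmod (Complex (i / 2 ^ k) (j / 2 ^ k)) < c \<longleftrightarrow> i\<^sup>2 + j\<^sup>2 < (2 ^ k * c)\<^sup>2"
    unfolding sq z_def[symmetric]
    using assms by (subst square_less_iff) auto
  show "c < cmod (Complex (i / 2 ^ k) (j / 2 ^ k)) \<longleftrightarrow> (2 ^ k * c)\<^sup>2 < i\<^sup>2 + j\<^sup>2"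
    unfolding sq z_def[symmetric]
    using assms by (subst square_less_iff) auto
qed

text \<open>With \<open>D = 2 ^ k + i\<close>, the quotient is
  \<open>2 ^ n * y / (1 + x) = 2 ^ n * j / D\<close> rounded to the nearest integer. The linear form
  is smaller than \<open>1 / 4 / 2 ^ n\<close>, and dividing it by \<open>1 + x > 1 / 2\<close>
  leaves a rounding error below one half.\<close>

lemma rounded_half_angle:
  fixes i j a :: int
  assumes a: "0 \<le> a" "a < 2 ^ n" and n: "1 \<le> n"
    and z: "cmod (Complex (i / 2 ^ k) (j / 2 ^ k) - node n a) < 1 / 8 / 2 ^ n"
  shows "(2 * 2 ^ n * j + (2 ^ k + i)) div (2 * (2 ^ k + i)) = a"
proof -
  define z where "z = Complex (i / 2 ^ k) (j / 2 ^ k)"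
  have p: "(2::real) ^ n \<ge> 2" using n self_le_power[of "2::real" n] by simp
  have "Re (node n a) - Re z \<le> cmod (z - node n a)"
    using abs_Re_le_cmod[of "z - node n a"] by simp
  moreover have "1 / 8 / (2::real) ^ n \<le> 1 / 8" using p by (simp add: field_simps)
  ultimately have pos: "1 / 2 < 1 + Re z"
    using assms(4) Re_node_nonneg[OF a] unfolding z_def[symmetric] by linarith
  have "\<bar>Im z - of_int a / 2 ^ n * (1 + Re z)\<bar> < 1 / 4 / 2 ^ n"
    using half_angle_bound[OF a, of z] assms(4) unfolding z_def[symmetric] by simp
  also have "\<dots> \<le> 1 / 2 / 2 ^ n * (1 + Re z)" using pos by (simp add: field_simps)
  finally have *: "\<bar>Im z - of_int a / 2 ^ n * (1 + Re z)\<bar> < 1 / 2 / 2 ^ n * (1 + Re z)" .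
  define D where "D = 2 ^ k + i"
  have Dz: "1 + Re z = D / 2 ^ k" by (simp add: z_def D_def field_simps)
  have "0 < D / (2::real) ^ k" using pos Dz by linarith
  then have D: "0 < D" by (simp add: zero_less_divide_iff)
  have "\<bar>2 * 2 ^ n * j - 2 * a * D\<bar> < real_of_int D"
  proof -
    have "\<bar>j / 2 ^ k - a / 2 ^ n * (D / 2 ^ k)\<bar> * (2 * 2 ^ n * 2 ^ k)
        < 1 / 2 / 2 ^ n * (D / 2 ^ k) * (2 * 2 ^ n * (2 ^ k :: real))"
      using * unfolding Dz by (intro mult_strict_right_mono) (auto simp: z_def)
    also have "\<bar>j / 2 ^ k - a / 2 ^ n * (D / 2 ^ k)\<bar> * (2 * 2 ^ n * (2 ^ k :: real))
        = \<bar>(j / 2 ^ k - a / 2 ^ n * (D / 2 ^ k)) * (2 * 2 ^ n * 2 ^ k)\<bar>" by (simp add: abs_mult)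
    also have "(j / 2 ^ k - a / 2 ^ n * (D / 2 ^ k)) * (2 * 2 ^ n * (2 ^ k :: real)) = 2 * 2 ^ n * j - 2 * a * D"
      by (simp add: field_simps)
    finally show ?thesis by simp
  qed
  then have "real_of_int \<bar>2 * 2 ^ n * j - 2 * a * D\<bar> < real_of_int D" by simp
  then have "\<bar>2 * 2 ^ n * j - 2 * a * D\<bar> < D" by (simp only: of_int_less_iff)
  then have "(2 * 2 ^ n * j + D) div (2 * D) = a"
    using D by (intro int_div_pos_eq[where r = "2 * 2 ^ n * j + D - 2 * D * a"]) (auto simp: algebra_simps)
  then show ?thesis by (simp add: D_def)
qed

text \<open>Everything is multiplied by \<open>K = 2 * N * H * 2 ^ k\<close>, which clears the
  denominators of the grid, the node and the shift. For \<open>k > 6 * n\<close> the ratio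
  \<open>g\<close> is an exact power of two and the notch radius is \<open>3 * g / 2\<close> mesh
  sizes; \<open>g = 1\<close> and \<open>g \<ge> 2\<close> are the two alternatives at the
  end.\<close>

lemma notch_test:
  fixes i j a :: int
  assumes "6 * n < k"
  defines "G \<equiv> 2 ^ k" and "M \<equiv> 2 ^ n" and "N \<equiv> (2 ^ n)\<^sup>2 + a\<^sup>2" and "H \<equiv> (2 ^ n) ^ 12"
    and "g \<equiv> 2 ^ k div (2 * (2 ^ n) ^ 6)"
  defines "V \<equiv> 4 * ((i * N * H - G * (H + 1) * (M\<^sup>2 - a\<^sup>2))\<^sup>2 + (j * N * H - G * (H + 1) * (2 * M * a))\<^sup>2)"
    and "z \<equiv> Complex (i / 2 ^ k) (j / 2 ^ k)" and "c \<equiv> of_real (1 + sat_shift n) * node n a"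
  shows "(N * H * (3 * g - 2))\<^sup>2 < V \<longleftrightarrow> sat_radius n - 1 / 2 ^ k < cmod (z - c)" (is ?A)
    and "V < (N * H * (3 * g + 2))\<^sup>2 \<longleftrightarrow> cmod (z - c) < sat_radius n + 1 / 2 ^ k" (is ?B)
    and "2 * sat_radius n = 3 * (1 / 2 ^ k) \<or> 3 * (1 / 2 ^ k) \<le> sat_radius n"
proof -
  obtain l where l: "k = 6 * n + 1 + l" using assms(1) less_imp_add_positive[of "6 * n" k] by (metis add.assoc add.commute less_iff_Suc_add plus_1_eq_Suc)
  have Gl: "2 ^ k = 2 * (2 ^ n) ^ 6 * (2::int) ^ l"
    by (simp add: l power_add mult.commute[of 6] power_mult)
  then have g: "g = 2 ^ l" by (simp add: g_def)
  define rM rG rN rH rg :: real where "rM = 2 ^ n" and "rG = 2 ^ k" and "rN = 4 ^ n + (of_int a)\<^sup>2"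
    and "rH = rM ^ 12" and "rg = 2 ^ l"
  have pos: "0 < rM" "0 < rG" "0 < rN" "0 < rH" "1 \<le> rg"
    using denom_pos[of n a] by (auto simp: rM_def rG_def rN_def rH_def rg_def)
  have N: "real_of_int N = rN" by (simp add: N_def rN_def pow4)
  have G: "rG = 2 * rM ^ 6 * rg"
    using arg_cong[OF Gl, of real_of_int] by (simp add: rG_def rM_def rg_def)
  have d: "sat_radius n = 3 / 4 / rM ^ 6"
    by (simp add: sat_radius_def rM_def pow64)
  have h: "sat_shift n = 1 / rH"
    by (simp add: sat_shift_def rH_def rM_def pow4096)
  have radius: "2 * rG * (sat_radius n) = 3 * rg" using pos by (simp add: G d)
  define K where "K = 2 * rN * rH * rG"
  have K: "0 < K" using pos by (simp add: K_def)
  have node: "Re (node n a) = (rM\<^sup>2 - (of_int a)\<^sup>2) / rN" "Im (node n a) = 2 * rM * of_int a / rN"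
    by (simp_all add: node_def rN_def rM_def pow4)
  have alg: "rN * rH * rG * (x / rG - (1 + 1 / rH) * (y / rN)) = x * rN * rH - rG * (rH + 1) * y" for x y
    using pos by (simp add: field_simps)
  have "Re (rN * rH * rG * (z - c)) = rN * rH * rG * (i / rG - (1 + 1 / rH) * Re (node n a))"
    and "Im (rN * rH * rG * (z - c)) = rN * rH * rG * (j / rG - (1 + 1 / rH) * Im (node n a))"
    by (simp_all add: z_def c_def h rG_def[symmetric])
  then have "Re (rN * rH * rG * (z - c)) = i * rN * rH - rG * (rH + 1) * (rM\<^sup>2 - (of_int a)\<^sup>2)"
    and "Im (rN * rH * rG * (z - c)) = j * rN * rH - rG * (rH + 1) * (2 * rM * of_int a)"
    by (simp_all only: node alg)
  then have "real_of_int V = 4 * (cmod (rN * rH * rG * (z - c)))\<^sup>2"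
    unfolding cmod_power2 V_def
    by (simp add: N G_def M_def H_def rM_def[symmetric] rG_def[symmetric] rH_def[symmetric])
  then have V: "real_of_int V = (K * cmod (z - c))\<^sup>2"
    using pos by (simp add: norm_mult K_def power_mult_distrib)
  have minus: "real_of_int (N * H * (3 * g - 2)) = K * (sat_radius n - 1 / 2 ^ k)"
    and plus: "real_of_int (N * H * (3 * g + 2)) = K * (sat_radius n + 1 / 2 ^ k)"
  proof -
    have "K * sat_radius n = rN * rH * (3 * rg)" using radius by (simp add: K_def mult_ac)
    moreover have "K * (1 / 2 ^ k) = rN * rH * 2" using pos by (simp add: K_def rG_def[symmetric])
    ultimately show "real_of_int (N * H * (3 * g - 2)) = K * (sat_radius n - 1 / 2 ^ k)"
      "real_of_int (N * H * (3 * g + 2)) = K * (sat_radius n + 1 / 2 ^ k)"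
      by (simp_all add: N g H_def rM_def[symmetric] rH_def[symmetric] rg_def[symmetric] right_diff_distrib distrib_left)
  qed
  have e: "1 / 2 ^ k \<le> sat_radius n"
    using radius pos by (simp add: rG_def field_simps)
  have "(N * H * (3 * g - 2))\<^sup>2 < V \<longleftrightarrow> (real_of_int (N * H * (3 * g - 2)))\<^sup>2 < real_of_int V"
    by (metis of_int_less_iff of_int_power)
  also have "\<dots> \<longleftrightarrow> K * (sat_radius n - 1 / 2 ^ k) < K * cmod (z - c)"
    unfolding V minus using K e by (intro square_less_iff) auto
  finally show ?A using K by simp
  have "V < (N * H * (3 * g + 2))\<^sup>2 \<longleftrightarrow> real_of_int V < (real_of_int (N * H * (3 * g + 2)))\<^sup>2"
    by (metis of_int_less_iff of_int_power)
  also have "\<dots> \<longleftrightarrow> K * cmod (z - c) < K * (sat_radius n + 1 / 2 ^ k)"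
    unfolding V plus using K by (intro square_less_iff) (auto simp: sat_radius_def)
  finally show ?B using K by simp
  show "2 * sat_radius n = 3 * (1 / 2 ^ k) \<or> 3 * (1 / 2 ^ k) \<le> sat_radius n"
  proof (cases l)
    case 0
    then have "rg = 1" by (simp add: rg_def)
    then show ?thesis using radius pos by (auto simp: rG_def field_simps)
  next
    case (Suc l')
    then have "2 \<le> rg" by (simp add: rg_def)
    then show ?thesis using radius pos by (auto simp: rG_def field_simps)
  qed
qed

lemma boundary_test_iff:
  fixes i j :: int and k :: nat and \<phi> :: form
  assumes n: "1 \<le> n"
  defines "z \<equiv> Complex (i / 2 ^ k) (j / 2 ^ k)" and "e \<equiv> 1 / 2 ^ k"
    and "Z \<equiv> node n ` models n \<phi>" and "c \<equiv> \<lambda>\<zeta>. of_real (1 + sat_shift n) * \<zeta>"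
  shows "boundary_test n \<phi> k i j \<longleftrightarrow> cmod z < 1 + e \<and>
    (if k \<le> 6 * n then 1 - 7 / 4 * e < cmod z
     else (\<forall>\<zeta>\<in>Z. sat_radius n - e < cmod (z - c \<zeta>)) \<and>
          (1 - e < cmod z \<or> (\<exists>\<zeta>\<in>Z. cmod (z - c \<zeta>) < sat_radius n + e)))"
proof -
  interpret notches Z "sat_shift n" "sat_radius n" "1 / 2 / 2 ^ n"
    unfolding Z_def by (rule notches_sat) fact
  have e0: "0 < e" by (simp add: e_def)
  have Ge: "2 ^ k * e = 1" by (simp add: e_def)
  have 1: "i\<^sup>2 + j\<^sup>2 < (2 ^ k + 1)\<^sup>2 \<longleftrightarrow> cmod z < 1 + e"
  proof -
    have "i\<^sup>2 + j\<^sup>2 < (2 ^ k + 1)\<^sup>2 \<longleftrightarrow> real_of_int (i\<^sup>2 + j\<^sup>2) < real_of_int ((2 ^ k + 1)\<^sup>2)"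
      by (simp only: of_int_less_iff)
    then show ?thesis
      using cmod_grid_less(1)[of "1 + e" i k j] e0 Ge by (simp add: z_def distrib_left)
  qed
  show ?thesis
  proof (cases "k \<le> 6 * n")
    case True
    have "4 * 2 ^ k < (7::int) \<or> (4 * 2 ^ k - 7)\<^sup>2 < 16 * (i\<^sup>2 + j\<^sup>2) \<longleftrightarrow> 1 - 7 / 4 * e < cmod z"
    \<comment> \<open>This happens only for \<open>k = 0\<close>, where the inner radius of the
      annulus is negative and comparing squares would give a wrong answer.\<close>
    proof (cases "4 * 2 ^ k < (7::int)")
      case lt: True
      then have "real_of_int (4 * 2 ^ k) < real_of_int 7" by (simp only: of_int_less_iff)
      then have "1 - 7 / 4 * e < 0" by (simp add: e_def field_simps)
      then show ?thesis using lt by (smt (verit) norm_ge_zero)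
    next
      case False
      then have "real_of_int 7 \<le> real_of_int (4 * 2 ^ k)" by (simp only: of_int_le_iff not_less)
      then have nn: "0 \<le> 1 - 7 / 4 * e" by (simp add: e_def field_simps)
      have "(4 * 2 ^ k - 7)\<^sup>2 < 16 * (i\<^sup>2 + j\<^sup>2)
          \<longleftrightarrow> real_of_int ((4 * 2 ^ k - 7)\<^sup>2) < real_of_int (16 * (i\<^sup>2 + j\<^sup>2))"
        by (simp only: of_int_less_iff)
      also have "real_of_int ((4 * 2 ^ k - 7)\<^sup>2) = 16 * (2 ^ k * (1 - 7 / 4 * e))\<^sup>2"
        by (simp add: right_diff_distrib e_def power2_eq_square field_simps)
      also have "16 * (2 ^ k * (1 - 7 / 4 * e))\<^sup>2 < real_of_int (16 * (i\<^sup>2 + j\<^sup>2))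
          \<longleftrightarrow> (2 ^ k * (1 - 7 / 4 * e))\<^sup>2 < real_of_int (i\<^sup>2 + j\<^sup>2)"
        unfolding of_int_mult of_int_numeral by (rule mult_less_cancel_left_pos) simp
      finally show ?thesis
        unfolding cmod_grid_less(2)[OF nn, of i k j, folded z_def] using False by simp
    qed
    then show ?thesis using True 1 by (simp add: boundary_test_def Let_def)
  next
    case False
    then have k: "6 * n < k" by simp
    define a where "a = (2 * 2 ^ n * j + (2 ^ k + i)) div (2 * (2 ^ k + i))"
    note nt = notch_test(1,2)[OF k, where i = i and j = j and a = a]
    have e_le: "3 * e \<le> 2 * sat_radius n" using notch_test(3)[OF k] d(1) unfolding e_def by linarith
    \<comment> \<open>A notch within reach has its node at distance below \<open>17 / 10\<close>
      radii, where rounding finds its index. Elsewhere the candidate may be meaningless, or 0 from a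
      division by 0: no notch is then within reach, and the comparisons with \<open>V\<close> are
      true distance comparisons for any index.\<close>
    have a_eq: "a = b" if b: "b \<in> models n \<phi>" "cmod (z - c (node n b)) < sat_radius n + e" for b
      unfolding a_def
    proof (rule rounded_half_angle)
      have "node n b \<in> Z" using b by (simp add: Z_def)
      from cmod_minus_cen(2)[OF this, of z]
      have "cmod (z - node n b) < sat_radius n + e + sat_shift n"
        using b(2) unfolding c_def cen_def by linarith
      also have "\<dots> \<le> 17 / 10 * sat_radius n" using e_le h_le d by linarith
      also have "\<dots> < 1 / 8 / 2 ^ n"
      proof -
        have "(64::real) ^ n = 2 ^ n * 32 ^ n" "32 \<le> (32::real) ^ n"
          using n self_le_power[of "32::real" n] by (simp_all flip: power_mult_distrib)
        then show ?thesis by (simp add: sat_radius_def field_simps)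
      qed
      finally show "cmod (Complex (i / 2 ^ k) (j / 2 ^ k) - node n b) < 1 / 8 / 2 ^ n"
        by (simp add: z_def)
    qed (use b n in \<open>auto simp: models_def\<close>)
    have "(\<forall>\<zeta>\<in>Z. sat_radius n - e < cmod (z - c \<zeta>)) \<longleftrightarrow>
        (a \<in> models n \<phi> \<longrightarrow> sat_radius n - e < cmod (z - c (node n a)))"
    proof
      assume *: "a \<in> models n \<phi> \<longrightarrow> sat_radius n - e < cmod (z - c (node n a))"
      show "\<forall>\<zeta>\<in>Z. sat_radius n - e < cmod (z - c \<zeta>)"
        unfolding Z_def
      proof
        fix \<zeta> assume "\<zeta> \<in> node n ` models n \<phi>"
        then obtain b where b: "b \<in> models n \<phi>" "\<zeta> = node n b" by blast
        show "sat_radius n - e < cmod (z - c \<zeta>)"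
        proof (cases "cmod (z - c \<zeta>) < sat_radius n + e")
          case True
          then show ?thesis using a_eq[of b] b * by blast
        qed (use e0 in linarith)
      qed
    qed (simp add: Z_def)
    moreover have "(\<exists>\<zeta>\<in>Z. cmod (z - c \<zeta>) < sat_radius n + e) \<longleftrightarrow>
        a \<in> models n \<phi> \<and> cmod (z - c (node n a)) < sat_radius n + e"
      using a_eq unfolding Z_def by blast
    moreover have "(2 ^ k - 1)\<^sup>2 < i\<^sup>2 + j\<^sup>2 \<longleftrightarrow> 1 - e < cmod z"
    proof -
      have nn: "0 \<le> 1 - e" by (simp add: e_def)
      have "(2 ^ k - 1)\<^sup>2 < i\<^sup>2 + j\<^sup>2 \<longleftrightarrow> real_of_int ((2 ^ k - 1)\<^sup>2) < real_of_int (i\<^sup>2 + j\<^sup>2)"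
        by (simp only: of_int_less_iff)
      then show ?thesis
        using cmod_grid_less(2)[OF nn, of i k j] Ge by (simp add: z_def right_diff_distrib)
    qed
    ultimately show ?thesis
      using False 1 nt(1,2) unfolding boundary_test_def Let_def a_def[symmetric] z_def e_def c_def by simp
  qed
qed

lemma represents_boundary_test:
  assumes n: "1 \<le> n"
  shows "represents (boundary_test n \<phi>) (frontier (sat_domain n \<phi>))"
proof -
  interpret notches "node n ` models n \<phi>" "sat_shift n" "sat_radius n" "1 / 2 / 2 ^ n"
    by (rule notches_sat) fact
  note iff = boundary_test_iff[OF n, of \<phi>, folded cen_def]
  \<comment> \<open>The origin of the threshold: with radius \<open>3 / 4 / 64 ^ n\<close> the
    condition for the annulus test says precisely \<open>k \<le> 6 * n\<close>.\<close>
  have coarse: "4 * sat_radius n \<le> 3 * (1 / 2 ^ k)" if "k \<le> 6 * n" for k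
  proof -
    have "(2::real) ^ k \<le> 2 ^ (6 * n)" using that by (intro power_increasing) auto
    then show ?thesis by (simp add: sat_radius_def pow64 mult.commute[of 6] power_mult field_simps)
  qed
  have complete: "boundary_test n \<phi> k i j"
    if p: "p \<in> frontier \<Omega>" "dist (Complex (of_int i / 2 ^ k) (of_int j / 2 ^ k)) p < 1 / 2 ^ k" for k i j p
  proof (cases "k \<le> 6 * n")
    case True
    then show ?thesis unfolding iff using coarse_complete[OF p coarse] by simp
  next
    case False
    then show ?thesis unfolding iff using fine_complete[OF p] by simp
  qed
  have sound: "ball (Complex (of_int i / 2 ^ k) (of_int j / 2 ^ k)) (2 * (1 / 2 ^ k)) \<inter> frontier \<Omega> \<noteq> {}"
    if t: "boundary_test n \<phi> k i j" for k i j
  proof (cases "k \<le> 6 * n")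
    case True
    then show ?thesis using t unfolding iff by (intro coarse_sound coarse) auto
  next
    case False
    then have ratio: "2 * sat_radius n = 3 * (1 / 2 ^ k) \<or> 3 * (1 / 2 ^ k) \<le> sat_radius n"
      by (intro notch_test(3)) simp
    then have "3 * (1 / 2 ^ k) \<le> 2 * sat_radius n" using d(1) by linarith
    then show ?thesis using t False ratio unfolding iff by (intro fine_sound) auto
  qed
  show ?thesis
    unfolding represents_def Let_def
  proof (intro conjI allI impI)
    show "bounded (frontier (sat_domain n \<phi>))"
      using bounded_subset[OF bounded_closure[OF bounded_domain]] by (simp add: sat_domain_def frontier_def)
    fix k i j
    let ?z = "Complex (of_int i / 2 ^ k) (of_int j / 2 ^ k)"
    show "boundary_test n \<phi> k i j" if "ball ?z (1 / 2 ^ k) \<inter> frontier (sat_domain n \<phi>) \<noteq> {}"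
      using that complete unfolding sat_domain_def by fastforce
    show "\<not> boundary_test n \<phi> k i j" if "ball ?z (2 / 2 ^ k) \<inter> frontier (sat_domain n \<phi>) = {}"
      using that sound[of k i j] unfolding sat_domain_def by auto
  qed
qed

lemma admissible_sat_domain: "1 \<le> n \<Longrightarrow> admissible_domain (sat_domain n \<phi>)"
  unfolding sat_domain_def by (rule notches.admissible[OF notches_sat])

section \<open>Programs and their cost\<close>

lemma len_pos: "1 \<le> len z" by (simp add: len_def)

lemma abs_less_len: "\<bar>z\<bar> < 2 ^ len z"
proof -
  have "nat \<bar>z\<bar> < 2 * 2 ^ floor_log (nat \<bar>z\<bar>)" by (rule floor_log_exp2_gt)
  then have "int (nat \<bar>z\<bar>) < int (2 * 2 ^ floor_log (nat \<bar>z\<bar>))" by (simp only: of_nat_less_iff)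
  then show ?thesis by (simp add: len_def)
qed

lemma len_leI:
  assumes "\<bar>z\<bar> < 2 ^ m" "1 \<le> m" shows "len z \<le> m"
proof (cases "z = 0")
  case False
  have "(2::nat) ^ floor_log (nat \<bar>z\<bar>) \<le> nat \<bar>z\<bar>" using False by (intro floor_log_exp2_le) simp
  also have "\<dots> < 2 ^ m" using assms(1) by (simp add: nat_less_iff)
  finally have "floor_log (nat \<bar>z\<bar>) < m" by (simp add: power_strict_increasing_iff)
  then show ?thesis by (simp add: len_def)
qed (use assms in \<open>simp add: len_def\<close>)

lemma len_mono: "\<bar>x\<bar> \<le> \<bar>y\<bar> \<Longrightarrow> len x \<le> len y"
  using abs_less_len[of y] len_pos[of y] by (intro len_leI) auto

lemma len_0 [simp]: "len 0 = 1" and len_1 [simp]: "len 1 = 1"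
  using len_leI[of 0 1] len_leI[of 1 1] len_pos[of 0] len_pos[of 1] by auto

lemma len_power2 [simp]: "len (2 ^ m) = m + 1"
proof (rule antisym)
  show "len (2 ^ m) \<le> m + 1" by (rule len_leI) auto
  show "m + 1 \<le> len (2 ^ m)"
    using abs_less_len[of "2 ^ m"] by (simp add: Suc_le_eq)
qed

lemma len_int_le: "len (int n) \<le> n + 1"
proof (rule len_leI)
  have "n < 2 ^ (n + 1)" by (meson less_exp less_trans lessI less_add_one)
  then show "\<bar>int n\<bar> < 2 ^ (n + 1)" by (metis abs_of_nat of_nat_less_iff of_nat_numeral of_nat_power)
qed simp

lemma len_int_le': "1 \<le> n \<Longrightarrow> len (int n) \<le> n"
proof (rule len_leI)
  show "\<bar>int n\<bar> < 2 ^ n" by (metis abs_of_nat of_nat_less_iff of_nat_numeral of_nat_power less_exp)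
qed

lemma len_int_mono: "m \<le> n \<Longrightarrow> len (int m) \<le> len (int n)"
  by (rule len_mono) simp

lemma len_add: "len (x + y) \<le> len x + len y"
proof (rule len_leI)
  have *: "a + b \<le> a * b" if "2 \<le> a" "2 \<le> b" for a b :: int
    using mult_mono[of 1 "a - 1" 1 "b - 1"] that by (simp add: algebra_simps)
  have "(2::int) ^ 1 \<le> 2 ^ len z" for z using len_pos by (intro power_increasing) auto
  then have "(2::int) ^ len x + 2 ^ len y \<le> 2 ^ (len x + len y)"
    unfolding power_add by (intro *) auto
  then show "\<bar>x + y\<bar> < 2 ^ (len x + len y)" using abs_less_len[of x] abs_less_len[of y] by linarith
qed (use len_pos[of x] in simp)

lemma len_minus [simp]: "len (- x) = len x" by (simp add: len_def)

lemma len_diff: "len (x - y) \<le> len x + len y" using len_add[of x "- y"] by simp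

lemma len_mult: "len (x * y) \<le> len x + len y"
proof (rule len_leI)
  show "\<bar>x * y\<bar> < 2 ^ (len x + len y)"
    unfolding abs_mult power_add by (intro mult_strict_mono' abs_less_len) auto
qed (use len_pos[of x] in simp)

lemma abs_div_le: "\<bar>x div y\<bar> \<le> \<bar>x :: int\<bar>"
proof -
  have *: "\<bar>a div b\<bar> \<le> \<bar>a\<bar>" if "0 < b" for a b :: int
  proof (cases "0 \<le> a")
    case True
    then show ?thesis using that zdiv_mono2[of a 1 b] pos_imp_zdiv_nonneg_iff[of b a] by simp
  next
    case False
    have "a * b \<le> a" using mult_left_mono_neg[of 1 b a] that False by simp
    then have "a * b div b \<le> a div b" using that by (intro zdiv_mono1)
    then have "a \<le> a div b" using that by simp
    moreover have "a div b < 0" using that False by (simp add: div_neg_pos_less0)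
    ultimately show ?thesis by linarith
  qed
  consider "y = 0" | "0 < y" | "0 < - y" by linarith
  then show ?thesis
  proof cases
    case 3
    then show ?thesis using *[of "- y" "- x"] by (simp add: div_minus_minus)
  qed (use * in auto)
qed

lemma len_div: "len (x div y) \<le> len x"
  by (rule len_mono) (rule abs_div_le)

text \<open>Crude for all operations but multiplication, yet uniform: for an expression of fixed
  shape, the length of the value is linear in the lengths of the registers read.\<close>

lemma len_apply_op: "len (apply_op f x y) \<le> len x + len y"
  using len_add[of x y] len_diff[of x y] len_mult[of x y] len_div[of x y] by (cases f) auto

section \<open>Total-correctness triples with a cost bound\<close>

definition runs :: "(int \<Rightarrow> int) \<Rightarrow> prog \<Rightarrow> mem \<Rightarrow> nat \<Rightarrow> (mem \<Rightarrow> bool) \<Rightarrow> bool" where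
  "runs Q c s T P \<longleftrightarrow> (\<exists>t s'. exec Q c s t s' \<and> t \<le> T \<and> P s')"

lemma runsI: "exec Q c s t s' \<Longrightarrow> t \<le> T \<Longrightarrow> P s' \<Longrightarrow> runs Q c s T P"
  by (auto simp: runs_def)

lemma runs_mono:
  assumes "runs Q c s T P" "T \<le> T'" "\<And>s'. P s' \<Longrightarrow> P' s'" shows "runs Q c s T' P'"
  using assms unfolding runs_def by (meson order_trans)

lemma runs_Seq:
  assumes "runs Q c1 s T1 P1" "\<And>s1. P1 s1 \<Longrightarrow> runs Q c2 s1 T2 P" "T1 + T2 \<le> T"
  shows "runs Q (Seq c1 c2) s T P"
proof -
  obtain t1 s1 where 1: "exec Q c1 s t1 s1" "t1 \<le> T1" "P1 s1" using assms(1) by (auto simp: runs_def)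
  obtain t2 s2 where 2: "exec Q c2 s1 t2 s2" "t2 \<le> T2" "P s2"
    using assms(2)[OF 1(3)] by (auto simp: runs_def)
  show ?thesis using exec_Seq[OF 1(1) 2(1)] 1 2 assms(3) by (auto intro!: runsI)
qed

lemma runs_If:
  assumes "val a s > 0 \<Longrightarrow> runs Q c1 s T P" "\<not> val a s > 0 \<Longrightarrow> runs Q c2 s T P"
    "1 + val_cost a s + T \<le> T'"
  shows "runs Q (If a c1 c2) s T' P"
proof (cases "val a s > 0")
  case True
  then obtain t s' where *: "exec Q c1 s t s'" "t \<le> T" "P s'" using assms(1) by (auto simp: runs_def)
  show ?thesis by (rule runsI[OF exec_IfTrue[OF True *(1)]]) (use * assms(3) in auto)
next
  case False
  then obtain t s' where *: "exec Q c2 s t s'" "t \<le> T" "P s'" using assms(2) by (auto simp: runs_def)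
  show ?thesis by (rule runsI[OF exec_IfFalse[OF False *(1)]]) (use * assms(3) in auto)
qed

lemma runs_Set: "P (s(addr d s := val a s)) \<Longrightarrow>
    1 + val_cost a s + addr_cost d s + len (val a s) \<le> T \<Longrightarrow> runs Q (Set d a) s T P"
  by (rule runsI[OF exec_Set[OF refl]])

lemma runs_WhileFalse: "\<not> val a s > 0 \<Longrightarrow> P s \<Longrightarrow> 1 + val_cost a s \<le> T \<Longrightarrow> runs Q (While a c) s T P"
  by (rule runsI[OF exec_WhileFalse])

lemma runs_WhileTrue:
  assumes "val a s > 0" "runs Q c s T1 P1" "\<And>s1. P1 s1 \<Longrightarrow> runs Q (While a c) s1 T2 P"
    "1 + val_cost a s + T1 + T2 \<le> T"
  shows "runs Q (While a c) s T P"
proof -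
  obtain t1 s1 where 1: "exec Q c s t1 s1" "t1 \<le> T1" "P1 s1" using assms(2) by (auto simp: runs_def)
  obtain t2 s2 where 2: "exec Q (While a c) s1 t2 s2" "t2 \<le> T2" "P s2"
    using assms(3)[OF 1(3)] by (auto simp: runs_def)
  show ?thesis by (rule runsI[OF exec_WhileTrue[OF assms(1) 1(1) 2(1)]]) (use 1 2 assms(4) in auto)
qed

section \<open>Compilation of arithmetic expressions, with positivity tests as 0/1 values\<close>

datatype expr = ELit int | EReg nat | EOp binop expr expr | EPos expr

fun denote :: "expr \<Rightarrow> mem \<Rightarrow> int" where
  "denote (ELit z) s = z"
| "denote (EReg r) s = s r"
| "denote (EOp f a b) s = apply_op f (denote a s) (denote b s)"
| "denote (EPos a) s = of_bool (denote a s > 0)"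

fun regs :: "expr \<Rightarrow> nat set" where
  "regs (ELit z) = {}"
| "regs (EReg r) = {r}"
| "regs (EOp f a b) = regs a \<union> regs b"
| "regs (EPos a) = regs a"

text \<open>The number of scratch registers above the target: while \<open>b\<close> is evaluated
  one register higher, the target has to keep the value of \<open>a\<close>. Nesting to the left is
  therefore free.\<close>

fun depth :: "expr \<Rightarrow> nat" where
  "depth (ELit z) = 0"
| "depth (EReg r) = 0"
| "depth (EOp f a b) = max (depth a) (Suc (depth b))"
| "depth (EPos a) = depth a"

fun compile :: "expr \<Rightarrow> nat \<Rightarrow> prog" where
  "compile (ELit z) m = Set (Reg m) (Lit z)"
| "compile (EReg r) m = Set (Reg m) (At (Reg r))"
| "compile (EOp f a b) m = Seq (compile a m) (Seq (compile b (Suc m))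
     (Op f (Reg m) (At (Reg m)) (At (Reg (Suc m)))))"
| "compile (EPos a) m = Seq (compile a m) (If (At (Reg m)) (Set (Reg m) (Lit 1)) (Set (Reg m) (Lit 0)))"

text \<open>The factor \<open>K\<close> depends on the expression alone, so that linear bounds
  compose with constants that do not depend on the instance.\<close>

definition size_within :: "expr \<Rightarrow> nat \<Rightarrow> bool" where
  "size_within e K \<longleftrightarrow> (\<forall>s L. 1 \<le> L \<longrightarrow> (\<forall>r\<in>regs e. len (s r) \<le> L) \<longrightarrow> len (denote e s) \<le> K * L)"

lemma size_withinD:
  "size_within e K \<Longrightarrow> 1 \<le> L \<Longrightarrow> (\<And>r. r \<in> regs e \<Longrightarrow> len (s r) \<le> L) \<Longrightarrow> len (denote e s) \<le> K * L"
  by (simp add: size_within_def)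

lemma size_within_exists: "\<exists>K. size_within e K"
proof (induction e)
  case (ELit z)
  show ?case by (intro exI[of _ "len z"]) (auto simp: size_within_def)
next
  case (EReg r)
  show ?case by (intro exI[of _ 1]) (auto simp: size_within_def)
next
  case (EOp f a b)
  then obtain K1 K2 where K: "size_within a K1" "size_within b K2" by blast
  have "len (denote (EOp f a b) s) \<le> (K1 + K2) * L"
    if "1 \<le> L" "\<forall>r\<in>regs (EOp f a b). len (s r) \<le> L" for s L
    using len_apply_op[of f "denote a s" "denote b s"] size_withinD[OF K(1) that(1), of s]
      size_withinD[OF K(2) that(1), of s] that(2)
    by (simp add: distrib_right)
  then show ?case unfolding size_within_def by blast
next
  case (EPos a)
  show ?case by (intro exI[of _ 1]) (auto simp: size_within_def)
qed

definition runs_within :: "expr \<Rightarrow> prog \<Rightarrow> nat \<Rightarrow> (mem \<Rightarrow> mem \<Rightarrow> bool) \<Rightarrow> bool" where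
  "runs_within e c K P \<longleftrightarrow> (\<forall>Q s L. 1 \<le> L \<longrightarrow> (\<forall>r\<in>regs e. len (s r) \<le> L) \<longrightarrow> runs Q c s (K * L) (P s))"

lemma runs_withinD:
  "runs_within e c K P \<Longrightarrow> 1 \<le> L \<Longrightarrow> (\<And>r. r \<in> regs e \<Longrightarrow> len (s r) \<le> L) \<Longrightarrow> runs Q c s (K * L) (P s)"
  by (simp add: runs_within_def)

lemma runs_withinI:
  "(\<And>Q s L. 1 \<le> L \<Longrightarrow> \<forall>r\<in>regs e. len (s r) \<le> L \<Longrightarrow> runs Q c s (K * L) (P s)) \<Longrightarrow> runs_within e c K P"
  by (simp add: runs_within_def)

lemma le_mult_ge_1: "1 \<le> L \<Longrightarrow> x \<le> x * (L :: nat)"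
  by simp

abbreviation (input) computed :: "nat \<Rightarrow> expr \<Rightarrow> mem \<Rightarrow> mem \<Rightarrow> bool" where
  "computed m e s s' \<equiv> s' m = denote e s \<and> (\<forall>r. r < m \<or> m + depth e < r \<longrightarrow> s' r = s r)"

lemma compile_runs:
  assumes "regs e \<subseteq> {..<m}"
  shows "\<exists>K. runs_within e (compile e m) K (computed m e)"
  using assms
proof (induction e arbitrary: m)
  case (ELit z)
  have "runs_within (ELit z) (compile (ELit z) m) (1 + 2 * len z + len (int m)) (computed m (ELit z))"
  proof (rule runs_withinI)
    fix Q s and L :: nat assume L: "1 \<le> L"
    have "runs Q (compile (ELit z) m) s (1 + 2 * len z + len (int m)) (computed m (ELit z) s)"
      by (auto intro!: runs_Set)
    then show "runs Q (compile (ELit z) m) s ((1 + 2 * len z + len (int m)) * L) (computed m (ELit z) s)"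
      by (rule runs_mono) (rule le_mult_ge_1[OF L], simp)
  qed
  then show ?case by blast
next
  case (EReg r)
  have "runs_within (EReg r) (compile (EReg r) m) (3 + len (int r) + len (int m)) (computed m (EReg r))"
    unfolding compile.simps
  proof (intro runs_withinI runs_Set)
    fix s and L :: nat assume L: "1 \<le> L" "\<forall>r\<in>regs (EReg r). len (s r) \<le> L"
    have "1 + len (int r) + len (int m) \<le> (1 + len (int r) + len (int m)) * L"
      by (rule le_mult_ge_1[OF L(1)])
    moreover have "(3 + len (int r) + len (int m)) * L = (1 + len (int r) + len (int m)) * L + 2 * L"
      by (simp add: algebra_simps)
    moreover have "len (s r) \<le> L" using L(2) by simp
    ultimately show "1 + val_cost (At (Reg r)) s + addr_cost (Reg m) s + len (val (At (Reg r)) s)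
        \<le> (3 + len (int r) + len (int m)) * L"
      unfolding val_cost.simps addr_cost.simps val.simps addr.simps by linarith
  qed simp
  then show ?case by blast
next
  case (EOp f a b)
  obtain Ka where Ka: "runs_within a (compile a m) Ka (computed m a)"
    using EOp.IH(1)[of m] EOp.prems by auto
  have "regs b \<subseteq> {..<Suc m}" using EOp.prems by (auto simp: less_Suc_eq)
  then obtain Kb where Kb: "runs_within b (compile b (Suc m)) Kb (computed (Suc m) b)"
    using EOp.IH(2)[of "Suc m"] by auto
  obtain La Lb where La: "size_within a La" and Lb: "size_within b Lb" using size_within_exists by metis
  define c where "c = 1 + 2 * len (int m) + len (int (Suc m)) + 2 * La + 2 * Lb"
  have "runs_within (EOp f a b) (compile (EOp f a b) m) (Ka + (Kb + c)) (computed m (EOp f a b))"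
    unfolding compile.simps
  proof (rule runs_withinI)
    fix Q s and L :: nat assume L: "1 \<le> L" and s: "\<forall>r\<in>regs (EOp f a b). len (s r) \<le> L"
    show "runs Q (Seq (compile a m) (Seq (compile b (Suc m)) (Op f (Reg m) (At (Reg m)) (At (Reg (Suc m))))))
        s ((Ka + (Kb + c)) * L) (computed m (EOp f a b) s)"
    proof (rule runs_Seq[OF runs_withinD[OF Ka L]])
      fix s1 assume s1: "computed m a s s1"
      have same: "\<forall>r\<in>regs b. s1 r = s r" using s1 EOp.prems by auto
      then have eb: "denote b s1 = denote b s" by (induction b) auto
      show "runs Q (Seq (compile b (Suc m)) (Op f (Reg m) (At (Reg m)) (At (Reg (Suc m))))) s1 ((Kb + c) * L) (computed m (EOp f a b) s)"
      proof (rule runs_Seq[OF runs_withinD[OF Kb L]])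
        show "len (s1 r) \<le> L" if "r \<in> regs b" for r using that s same by auto
        fix s2 assume s2: "computed (Suc m) b s1 s2"
        have la: "len (denote a s) \<le> La * L" "len (denote b s) \<le> Lb * L"
          using size_withinD[OF La L, of s] size_withinD[OF Lb L, of s] s by auto
        define a0 where "a0 = 1 + 2 * len (int m) + len (int (Suc m))"
        have a0: "a0 \<le> a0 * L" by (rule le_mult_ge_1[OF L])
        have c: "c * L = a0 * L + 2 * (La * L) + 2 * (Lb * L)" by (simp add: c_def a0_def algebra_simps)
        have vals: "s2 m = denote a s" "s2 (Suc m) = denote b s" using s1 s2 eb by auto
        show "runs Q (Op f (Reg m) (At (Reg m)) (At (Reg (Suc m)))) s2 (c * L) (computed m (EOp f a b) s)"
        proof (rule runsI[OF exec_Op[OF refl]])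
          show "1 + val_cost (At (Reg m)) s2 + val_cost (At (Reg (Suc m))) s2 + addr_cost (Reg m) s2
            + len (apply_op f (val (At (Reg m)) s2) (val (At (Reg (Suc m))) s2)) \<le> c * L"
            unfolding val_cost.simps addr_cost.simps val.simps addr.simps vals c
            using la len_apply_op[of f "denote a s" "denote b s"] a0 unfolding a0_def by linarith
        qed (use s1 s2 vals in auto)
      qed (simp add: algebra_simps)
    qed (use s in \<open>auto simp: algebra_simps\<close>)
  qed
  then show ?case by blast
next
  case (EPos a)
  obtain Ka where Ka: "runs_within a (compile a m) Ka (computed m a)"
    using EPos.IH[of m] EPos.prems by auto
  obtain La where La: "size_within a La" using size_within_exists by metis
  define c where "c = 4 + 2 * len (int m) + La"
  have "runs_within (EPos a) (compile (EPos a) m) (Ka + c) (computed m (EPos a))"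
    unfolding compile.simps
  proof (rule runs_withinI)
    fix Q s and L :: nat assume L: "1 \<le> L" and s: "\<forall>r\<in>regs (EPos a). len (s r) \<le> L"
    show "runs Q (Seq (compile a m) (If (At (Reg m)) (Set (Reg m) (Lit 1)) (Set (Reg m) (Lit 0)))) s ((Ka + c) * L) (computed m (EPos a) s)"
    proof (rule runs_Seq[OF runs_withinD[OF Ka L]])
      fix s1 assume s1: "computed m a s s1"
      have la: "len (denote a s) \<le> La * L" using size_withinD[OF La L, of s] s by auto
      show "runs Q (If (At (Reg m)) (Set (Reg m) (Lit 1)) (Set (Reg m) (Lit 0))) s1 (c * L) (computed m (EPos a) s)"
      proof (rule runs_If[where T = "3 + len (int m)"])
        define a0 where "a0 = 4 + 2 * len (int m)"
        have a0: "a0 \<le> a0 * L" by (rule le_mult_ge_1[OF L])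
        have c: "c * L = a0 * L + La * L" by (simp add: c_def a0_def algebra_simps)
        have v: "s1 m = denote a s" using s1 by simp
        show "1 + val_cost (At (Reg m)) s1 + (3 + len (int m)) \<le> c * L"
          unfolding val_cost.simps addr_cost.simps val.simps addr.simps v c
          using la a0 a0_def by linarith
      qed (use s1 in \<open>auto intro!: runs_Set\<close>)
    qed (use s in \<open>auto simp: algebra_simps\<close>)
  qed
  then show ?case by blast
qed

section \<open>Assignments and straight-line blocks\<close>

definition assign :: "nat \<Rightarrow> expr \<Rightarrow> prog" where
  "assign d e = Seq (compile e 16) (Set (Reg d) (At (Reg 16)))"

abbreviation (input) assigned :: "nat \<Rightarrow> expr \<Rightarrow> mem \<Rightarrow> mem \<Rightarrow> bool" where
  "assigned d e s s' \<equiv> s' d = denote e s \<and> (\<forall>r. r \<noteq> d \<and> (r < 16 \<or> 32 \<le> r) \<longrightarrow> s' r = s r)"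

lemma assign_runs:
  assumes "regs e \<subseteq> {..<16}" "depth e < 16"
  shows "\<exists>K. runs_within e (assign d e) K (assigned d e)"
proof -
  obtain K where K: "runs_within e (compile e 16) K (computed 16 e)"
    using compile_runs[OF assms(1)] by auto
  obtain La where La: "size_within e La" using size_within_exists by metis
  define c where "c = 1 + len 16 + len (int d) + 2 * La"
  have "runs_within e (assign d e) (K + c) (assigned d e)"
    unfolding assign_def
  proof (rule runs_withinI)
    fix Q s and L :: nat assume L: "1 \<le> L" and s: "\<forall>r\<in>regs e. len (s r) \<le> L"
    show "runs Q (Seq (compile e 16) (Set (Reg d) (At (Reg 16)))) s ((K + c) * L) (assigned d e s)"
    proof (rule runs_Seq[OF runs_withinD[OF K L]])
      fix s1 assume s1: "computed 16 e s s1"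
      have la: "len (denote e s) \<le> La * L" using size_withinD[OF La L, of s] s by auto
      define a0 where "a0 = 1 + len 16 + len (int d)"
      have a0: "a0 \<le> a0 * L" by (rule le_mult_ge_1[OF L])
      have c: "c * L = a0 * L + 2 * (La * L)" by (simp add: c_def a0_def algebra_simps)
      have v: "s1 16 = denote e s" using s1 by simp
      show "runs Q (Set (Reg d) (At (Reg 16))) s1 (c * L) (assigned d e s)"
      proof (rule runs_Set)
        show "1 + val_cost (At (Reg 16)) s1 + addr_cost (Reg d) s1 + len (val (At (Reg 16)) s1) \<le> c * L"
          unfolding val_cost.simps addr_cost.simps val.simps addr.simps v c
          using la a0 a0_def by simp
      qed (use s1 assms(2) v in auto)
    qed (use s in \<open>auto simp: algebra_simps\<close>)
  qed
  then show ?thesis by blast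
qed

text \<open>Variables are kept in registers below 16; the registers from 16 to 31 hold intermediate results.\<close>

fun block :: "(nat \<times> expr) list \<Rightarrow> prog" where
  "block [] = Skip"
| "block ((d, e) # xs) = Seq (assign d e) (block xs)"

text \<open>The registers that are live at the start: only those read before they are overwritten
  need a size bound on entry.\<close>

fun reads :: "(nat \<times> expr) list \<Rightarrow> nat set" where
  "reads [] = {}"
| "reads ((d, e) # xs) = regs e \<union> (reads xs - {d})"

fun updates :: "(nat \<times> expr) list \<Rightarrow> mem \<Rightarrow> mem" where
  "updates [] s = s"
| "updates ((d, e) # xs) s = updates xs (s(d := denote e s))"

definition agree :: "mem \<Rightarrow> mem \<Rightarrow> bool" where
  "agree s t \<longleftrightarrow> (\<forall>r. r < 16 \<or> 32 \<le> r \<longrightarrow> s r = t r)"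

definition simple :: "expr \<Rightarrow> bool" where
  "simple e \<longleftrightarrow> regs e \<subseteq> {..<16} \<and> depth e < 16"

lemma denote_cong: "(\<And>r. r \<in> regs e \<Longrightarrow> s r = t r) \<Longrightarrow> denote e s = denote e t"
  by (induction e) auto

lemma updates_agree:
  "\<forall>x\<in>set xs. simple (snd x) \<Longrightarrow> agree s t \<Longrightarrow> agree (updates xs s) (updates xs t)"
proof (induction xs arbitrary: s t)
  case (Cons x xs)
  obtain d e where x: "x = (d, e)" by (cases x)
  have "denote e s = denote e t"
    using Cons.prems by (intro denote_cong) (auto simp: x simple_def agree_def)
  then have "agree (s(d := denote e s)) (t(d := denote e t))" using Cons.prems(2) by (simp add: agree_def)
  then show ?case using Cons by (simp add: x)
qed simp

lemma updates_other: "d \<notin> fst ` set xs \<Longrightarrow> updates xs s d = s d"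
  by (induction xs arbitrary: s) auto

text \<open>The cost of a later block depends on the sizes of what this one has written, hence the
  clause about the updated registers.\<close>

definition block_within :: "(nat \<times> expr) list \<Rightarrow> nat \<Rightarrow> bool" where
  "block_within xs K \<longleftrightarrow> (\<forall>Q s L. 1 \<le> L \<longrightarrow> (\<forall>r\<in>reads xs. len (s r) \<le> L) \<longrightarrow>
     (\<forall>d\<in>fst ` set xs. len (updates xs s d) \<le> K * L) \<and>
     runs Q (block xs) s (K * L) (\<lambda>t. agree t (updates xs s)))"

lemma block_withinD:
  assumes "block_within xs K" "1 \<le> L" "\<And>r. r \<in> reads xs \<Longrightarrow> len (s r) \<le> L"
  shows "runs Q (block xs) s (K * L) (\<lambda>t. agree t (updates xs s))"
    and "d \<in> fst ` set xs \<Longrightarrow> len (updates xs s d) \<le> K * L"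
  using assms by (auto simp: block_within_def)

text \<open>After one assignment the registers read by the rest are bounded by
  \<open>(1 + Z) * L\<close> in place of \<open>L\<close>. The constants thus multiply along the
  block, but the block is fixed.\<close>

lemma block_within_exists: "\<forall>x\<in>set xs. simple (snd x) \<Longrightarrow> \<exists>K. block_within xs K"
proof (induction xs)
  case Nil
  have "block_within [] 1"
    by (auto simp: block_within_def agree_def intro!: runsI[OF exec_Skip])
  then show ?case by blast
next
  case (Cons x xs)
  obtain d e where x: "x = (d, e)" by (cases x)
  have e: "regs e \<subseteq> {..<16}" "depth e < 16" and xs: "\<forall>x\<in>set xs. simple (snd x)"
    using Cons.prems by (auto simp: x simple_def)
  obtain K1 where K1: "runs_within e (assign d e) K1 (assigned d e)" using assign_runs[OF e] by blast
  obtain Z where Z: "size_within e Z" using size_within_exists by blast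
  obtain K2 where K2: "block_within xs K2" using Cons.IH[OF xs] by blast
  have reads_xs: "reads xs \<subseteq> {..<16}" using xs by (induction xs) (auto simp: simple_def)
  have "block_within (x # xs) (K1 + (Z + K2 * (1 + Z)))"
    unfolding block_within_def
  proof (intro allI impI conjI)
    fix Q s and L :: nat assume L: "1 \<le> L" and s: "\<forall>r\<in>reads (x # xs). len (s r) \<le> L"
    define s1 where "s1 = s(d := denote e s)"
    have size: "len (denote e s) \<le> Z * L" using s by (intro size_withinD[OF Z L]) (simp add: x)
    have L1: "1 \<le> (1 + Z) * L" using L by simp
    have s1: "len (s1 r) \<le> (1 + Z) * L" if "r \<in> reads xs" for r
      using that s size by (auto simp: s1_def x intro: trans_le_add2 trans_le_add1)
    have K: "K2 * ((1 + Z) * L) \<le> (K1 + (Z + K2 * (1 + Z))) * L" "Z * L \<le> (K1 + (Z + K2 * (1 + Z))) * L"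
      "K1 * L + K2 * ((1 + Z) * L) \<le> (K1 + (Z + K2 * (1 + Z))) * L"
      by (simp_all add: algebra_simps)
    show "\<forall>a\<in>fst ` set (x # xs). len (updates (x # xs) s a) \<le> (K1 + (Z + K2 * (1 + Z))) * L"
    proof
      fix a assume a: "a \<in> fst ` set (x # xs)"
      show "len (updates (x # xs) s a) \<le> (K1 + (Z + K2 * (1 + Z))) * L"
      proof (cases "a \<in> fst ` set xs")
        case True
        then have "len (updates xs s1 a) \<le> K2 * ((1 + Z) * L)" using s1 by (intro block_withinD(2)[OF K2 L1])
        from order_trans[OF this K(1)] show ?thesis by (simp only: x s1_def updates.simps)
      next
        case False
        then have "updates (x # xs) s a = denote e s" using a updates_other[OF False, of s1] by (simp add: x s1_def)
        with order_trans[OF size K(2)] show ?thesis by (simp only:)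
      qed
    qed
    show "runs Q (block (x # xs)) s ((K1 + (Z + K2 * (1 + Z))) * L) (\<lambda>t. agree t (updates (x # xs) s))"
      unfolding x block.simps
    proof (rule runs_Seq[OF runs_withinD[OF K1 L]])
      fix t assume "assigned d e s t"
      then have t: "agree t s1" by (auto simp: agree_def s1_def)
      have "agree (updates xs t) (updates xs s1)" by (rule updates_agree[OF xs t])
      moreover have "runs Q (block xs) t (K2 * ((1 + Z) * L)) (\<lambda>u. agree u (updates xs t))"
        using t s1 reads_xs by (intro block_withinD[OF K2 L1]) (auto simp: agree_def)
      ultimately show "runs Q (block xs) t (K2 * ((1 + Z) * L)) (\<lambda>u. agree u (updates ((d, e) # xs) s))"
        by (elim runs_mono) (auto simp: agree_def s1_def)
    qed (use s K(3) in \<open>auto simp: x\<close>)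
  qed
  then show ?case by blast
qed

text \<open>Repeated squaring. With factor \<open>2\<^sup>\<beta>\<close> and remaining exponent \<open>x\<close> the potential
  \<open>2x + \<beta>(2x - 1)\<close> drops by at least \<open>x + \<beta>\<close>, the size of the registers, in every round.\<close>

abbreviation "EAdd \<equiv> EOp Add"
abbreviation "ESub \<equiv> EOp Sub"
abbreviation "EMul \<equiv> EOp Mult"
abbreviation "EDiv \<equiv> EOp Div"

text \<open>Register 10 holds the remaining exponent, 11 the accumulator, 12 the current factor. The
  accumulator is multiplied by 1 plus the parity of the exponent times the factor minus 1, which
  selects the factor or 1 without a branch.\<close>

definition pow_body :: "(nat \<times> expr) list" where
  "pow_body = [(11, EMul (EReg 11) (EAdd (ELit 1) (EMul (ESub (EReg 12) (ELit 1))
        (ESub (EReg 10) (EMul (ELit 2) (EDiv (EReg 10) (ELit 2))))))),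
     (12, EMul (EReg 12) (EReg 12)), (10, EDiv (EReg 10) (ELit 2))]"

definition pow_loop :: prog where
  "pow_loop = While (At (Reg 10)) (block pow_body)"

definition pow_potential :: "nat \<Rightarrow> nat \<Rightarrow> nat" where
  "pow_potential x \<beta> = (if x = 0 then 0 else 2 * x + \<beta> * (2 * x - 1))"

lemma pow_potential_step:
  assumes "0 < x" "1 \<le> \<beta>"
  shows "pow_potential (x div 2) (2 * \<beta>) + (x + \<beta>) \<le> pow_potential x \<beta>"
proof -
  obtain y where y: "x = 2 * y \<or> x = 2 * y + 1" by (metis evenE oddE)
  show ?thesis
  proof (cases "y = 0")
    case True
    then show ?thesis using y assms by (auto simp: pow_potential_def)
  next
    case False
    then obtain w where w: "y = Suc w" using not0_implies_Suc by blast
    show ?thesis using y by (auto simp: pow_potential_def w algebra_simps)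
  qed
qed

abbreviation (input) kept :: "mem \<Rightarrow> mem \<Rightarrow> bool" where
  "kept s t \<equiv> \<forall>r. r < 10 \<or> r \<in> {13..<16} \<or> 32 \<le> r \<longrightarrow> t r = s r"

text \<open>The accumulator stays below the factor, so \<open>\<beta>\<close> controls the length of
  both.\<close>

definition pow_loop_within :: "nat \<Rightarrow> bool" where
  "pow_loop_within K \<longleftrightarrow> (\<forall>Q s x \<beta>. s 10 = int x \<longrightarrow> s 12 = 2 ^ \<beta> \<longrightarrow> 1 \<le> \<beta> \<longrightarrow> 0 < s 11 \<longrightarrow> s 11 < 2 ^ \<beta> \<longrightarrow>
     runs Q pow_loop s (K * (pow_potential x \<beta> + 1)) (\<lambda>t. t 11 = s 11 * 2 ^ (\<beta> * x) \<and> kept s t))"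

text \<open>Doubling \<open>x\<close> times would cost quadratically many bit operations. With
  squaring, the halving exponents and the doubling lengths both form geometric series, and the total
  is linear in \<open>x\<close>.\<close>

lemma pow_loop_runs: "\<exists>K. pow_loop_within K"
proof -
  obtain B where B: "block_within pow_body B"
    using block_within_exists[of pow_body] by (auto simp: pow_body_def simple_def)
  define K where "K = 2 * B + 4 + len 10"
  have "runs Q pow_loop s (K * (pow_potential x \<beta> + 1)) (\<lambda>t. t 11 = s 11 * 2 ^ (\<beta> * x) \<and> kept s t)"
    if "s 10 = int x" "s 12 = 2 ^ \<beta>" "1 \<le> \<beta>" "0 < s 11" "s 11 < 2 ^ \<beta>" for Q s x \<beta>
    using that
  proof (induction x arbitrary: s \<beta> rule: less_induct)
    case (less x)
    show ?case
    proof (cases "x = 0")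
      case True
      then show ?thesis unfolding pow_loop_def using less.prems
        by (intro runs_WhileFalse) (auto simp: pow_potential_def K_def)
    next
      case False
      define L where "L = x + \<beta> + 1"
      have L: "1 \<le> L" by (simp add: L_def)
      have lens: "len (s 10) \<le> L" "len (s 11) \<le> L" "len (s 12) \<le> L"
        using len_int_le'[of x] len_leI[of "s 11" \<beta>] False less.prems by (auto simp: L_def)
      let ?P = "\<lambda>t. t 11 = s 11 * 2 ^ (\<beta> * x) \<and> kept s t"
      have body: "runs Q (block pow_body) s (B * L) (\<lambda>t. agree t (updates pow_body s))"
        by (rule block_withinD[OF B L]) (use lens in \<open>auto simp: pow_body_def\<close>)
      show ?thesis unfolding pow_loop_def
      proof (rule runs_WhileTrue[OF _ body])
        show "0 < val (At (Reg 10)) s" using False less.prems by simp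
      next
        fix t assume "agree t (updates pow_body s)"
        moreover have "s 10 - 2 * (s 10 div 2) = (if even x then 0 else 1)"
          unfolding less.prems(1) by (auto elim!: evenE oddE)
        ultimately have t: "t 10 = int (x div 2)" "t 12 = 2 ^ (2 * \<beta>)"
            "t 11 = s 11 * (if even x then 1 else 2 ^ \<beta>)" "kept s t"
          using less.prems
          by (auto simp: agree_def pow_body_def zdiv_int power_mult power2_eq_square mult.commute[of 2])
        have bound: "t 11 < 2 ^ (2 * \<beta>)"
        proof -
          have "s 11 * (if even x then 1 else 2 ^ \<beta>) \<le> s 11 * 2 ^ \<beta>"
            using less.prems by (intro mult_left_mono) auto
          also have "\<dots> < 2 ^ \<beta> * 2 ^ \<beta>" using less.prems by (intro mult_strict_right_mono) auto
          finally show ?thesis using t by (simp add: mult_2 power_add)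
        qed
        have exps: "(if even x then 1 else 2 ^ \<beta>) * 2 ^ (2 * \<beta> * (x div 2)) = (2::int) ^ (\<beta> * x)"
          by (auto elim!: evenE oddE simp: power_add algebra_simps)
        have "runs Q pow_loop t (K * (pow_potential (x div 2) (2 * \<beta>) + 1))
           (\<lambda>u. u 11 = t 11 * 2 ^ (2 * \<beta> * (x div 2)) \<and> kept t u)"
          by (rule less.IH) (use False t bound less.prems in auto)
        then show "runs Q (While (At (Reg 10)) (block pow_body)) t (K * (pow_potential (x div 2) (2 * \<beta>) + 1)) ?P"
          unfolding pow_loop_def by (rule runs_mono) (use t exps in \<open>auto simp: mult.assoc\<close>)
      next
        have "L \<le> 2 * (x + \<beta>)" using False by (simp add: L_def)
        then have "B * L \<le> B * (2 * (x + \<beta>))" by (rule mult_le_mono2)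
        moreover have "1 + val_cost (At (Reg 10)) s \<le> (4 + len 10) * (x + \<beta>)"
        proof -
          have "len 10 \<le> len 10 * (x + \<beta>)" using False by simp
          then show ?thesis using lens(1) False by (simp add: L_def algebra_simps)
        qed
        ultimately have "1 + val_cost (At (Reg 10)) s + B * L \<le> K * (x + \<beta>)"
          by (simp add: K_def algebra_simps)
        moreover have "K * (pow_potential (x div 2) (2 * \<beta>) + (x + \<beta>)) \<le> K * pow_potential x \<beta>"
          using pow_potential_step[of x \<beta>] False less.prems by (intro mult_le_mono2) auto
        ultimately show "1 + val_cost (At (Reg 10)) s + B * L
            + K * (pow_potential (x div 2) (2 * \<beta>) + 1) \<le> K * (pow_potential x \<beta> + 1)"
          by (simp add: distrib_left)
      qed
    qed
  qed
  then show ?thesis unfolding pow_loop_within_def by blast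
qed

abbreviation (input) kept_but :: "nat \<Rightarrow> mem \<Rightarrow> mem \<Rightarrow> bool" where
  "kept_but d s t \<equiv> \<forall>r. r \<noteq> d \<and> (r < 10 \<or> r \<in> {13..<16} \<or> 32 \<le> r) \<longrightarrow> t r = s r"

definition pow2 :: "nat \<Rightarrow> nat \<Rightarrow> prog" where
  "pow2 src d = Seq (block [(10, EReg src), (11, ELit 1), (12, ELit 2)]) (Seq pow_loop (block [(d, EReg 11)]))"

definition pow2_within :: "nat \<Rightarrow> nat \<Rightarrow> nat \<Rightarrow> bool" where
  "pow2_within src d K \<longleftrightarrow> (\<forall>Q s x. s src = int x \<longrightarrow>
     runs Q (pow2 src d) s (K * (x + 1)) (\<lambda>t. t d = 2 ^ x \<and> kept_but d s t))"

lemma pow2_withinD: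
  "pow2_within src d K \<Longrightarrow> s src = int x \<Longrightarrow> x + 1 \<le> L \<Longrightarrow>
     runs Q (pow2 src d) s (K * L) (\<lambda>t. t d = 2 ^ x \<and> kept_but d s t)"
  unfolding pow2_within_def by (meson mult_le_mono2 runs_mono)

lemma pow2_runs:
  assumes "src < 10" "d < 10"
  shows "\<exists>K. pow2_within src d K"
proof -
  obtain K where K: "pow_loop_within K" using pow_loop_runs by blast
  let ?xs = "[(10, EReg src), (11, ELit 1), (12, ELit 2)]" and ?ys = "[(d, EReg 11)]"
  obtain A where A: "block_within ?xs A"
    using block_within_exists[of ?xs] assms by (auto simp: simple_def)
  obtain B where B: "block_within ?ys B"
    using block_within_exists[of ?ys] by (auto simp: simple_def)
  have "runs Q (pow2 src d) s ((A + (4 * K + B)) * (x + 1)) (\<lambda>t. t d = 2 ^ x \<and> kept_but d s t)"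
    if x: "s src = int x" for Q s x
    unfolding pow2_def
  proof (rule runs_Seq)
    show "runs Q (block ?xs) s (A * (x + 1)) (\<lambda>t. agree t (updates ?xs s))"
      by (rule block_withinD[OF A]) (use x len_int_le[of x] in auto)
    fix t assume t': "agree t (updates ?xs s)"
    then have t: "t 10 = int x" "t 11 = 1" "t 12 = 2" "kept s t" using x by (simp_all add: agree_def)
    have loop: "runs Q pow_loop t (4 * K * (x + 1)) (\<lambda>u. u 11 = t 11 * 2 ^ (1 * x) \<and> kept t u)"
    proof (rule runs_mono)
      show "runs Q pow_loop t (K * (pow_potential x 1 + 1)) (\<lambda>u. u 11 = t 11 * 2 ^ (1 * x) \<and> kept t u)"
        by (rule K[unfolded pow_loop_within_def, rule_format]) (use t in auto)
      have "pow_potential x 1 + 1 \<le> 4 * (x + 1)" unfolding pow_potential_def by (cases x) auto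
      from mult_le_mono2[OF this, of K] show "K * (pow_potential x 1 + 1) \<le> 4 * K * (x + 1)"
        by (simp only: mult.assoc mult.left_commute)
    qed
    show "runs Q (Seq pow_loop (block ?ys)) t ((4 * K + B) * (x + 1)) (\<lambda>t. t d = 2 ^ x \<and> kept_but d s t)"
    proof (rule runs_Seq[OF loop])
      fix u assume u: "u 11 = t 11 * 2 ^ (1 * x) \<and> kept t u"
      have "runs Q (block ?ys) u (B * (x + 1)) (\<lambda>v. agree v (updates ?ys u))"
        by (rule block_withinD[OF B]) (use u t in auto)
      then show "runs Q (block ?ys) u (B * (x + 1)) (\<lambda>t. t d = 2 ^ x \<and> kept_but d s t)"
        by (rule runs_mono) (use u t assms in \<open>auto simp: agree_def\<close>)
    qed (simp add: distrib_right)
  qed (simp add: distrib_right)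
  then show ?thesis unfolding pow2_within_def by blast
qed

section \<open>A program for the boundary\<close>

fun epow :: "expr \<Rightarrow> nat \<Rightarrow> expr" where
  "epow e 0 = ELit 1"
| "epow e (Suc n) = EOp Mult (epow e n) e"

lemma denote_epow [simp]: "denote (epow e n) s = denote e s ^ n"
  by (induction n) auto

definition fine_flag :: expr where
  "fine_flag = EPos (ESub (EReg 0) (EMul (ELit 6) (EReg 3)))"

definition in_circle :: expr where
  "in_circle = EPos (ESub (epow (EAdd (EReg 4) (ELit 1)) 2) (EAdd (epow (EReg 1) 2) (epow (EReg 2) 2)))"

definition coarse_test :: expr where
  "coarse_test = EMul in_circle (EPos (EAdd (EPos (ESub (ELit 7) (EMul (ELit 4) (EReg 4))))
     (EPos (ESub (EMul (ELit 16) (EAdd (epow (EReg 1) 2) (epow (EReg 2) 2)))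
       (epow (ESub (EMul (ELit 4) (EReg 4)) (ELit 7)) 2)))))"

definition candidate :: expr where
  "candidate = EDiv (EAdd (EMul (EMul (ELit 2) (EReg 5)) (EReg 2)) (EAdd (EReg 4) (EReg 1)))
     (EMul (ELit 2) (EAdd (EReg 4) (EReg 1)))"

definition range_flag :: expr where
  "range_flag = EMul (EPos (EAdd (EReg 7) (ELit 1))) (EPos (ESub (EReg 5) (EReg 7)))"

definition node_denominator :: expr where
  "node_denominator = EAdd (epow (EReg 5) 2) (epow (EReg 7) 2)"

definition shift_denominator :: expr where
  "shift_denominator = epow (EReg 5) 12"

definition grid_ratio :: expr where
  "grid_ratio = EDiv (EReg 4) (EMul (ELit 2) (epow (EReg 5) 6))"

definition center_distance :: expr where
  "center_distance = EMul (ELit 4) (EAdd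
     (epow (ESub (EMul (EMul (EReg 1) (EReg 6)) (EReg 13))
       (EMul (EMul (EReg 4) (EAdd (EReg 13) (ELit 1))) (ESub (epow (EReg 5) 2) (epow (EReg 7) 2)))) 2)
     (epow (ESub (EMul (EMul (EReg 2) (EReg 6)) (EReg 13))
       (EMul (EMul (EReg 4) (EAdd (EReg 13) (ELit 1))) (EMul (EMul (ELit 2) (EReg 5)) (EReg 7)))) 2))"

definition fine_test :: expr where
  "fine_test = EMul in_circle (EMul
     (EPos (EAdd (ESub (ELit 1) (EReg 9)) (EPos (ESub (EReg 14)
       (epow (EMul (EMul (EReg 6) (EReg 13)) (ESub (EMul (ELit 3) (EReg 8)) (ELit 2))) 2)))))
     (EPos (EAdd (EPos (ESub (EAdd (epow (EReg 1) 2) (epow (EReg 2) 2)) (epow (ESub (EReg 4) (ELit 1)) 2)))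
       (EMul (EReg 9) (EPos (ESub
         (epow (EMul (EMul (EReg 6) (EReg 13)) (EAdd (EMul (ELit 3) (EReg 8)) (ELit 2))) 2) (EReg 14)))))))"

text \<open>Conjunction is a product, disjunction the positivity of a sum, and the implication from
  \<open>b\<close> the positivity of \<open>1 - b\<close> plus the conclusion.\<close>

lemma bool_arith:
  "of_bool (0 < x) * (of_bool (0 < (1 :: int) - of_bool b + of_bool (0 < y)) *
      of_bool (0 < (of_bool (0 < u) :: int) + of_bool b * of_bool (0 < v)))
    = (of_bool (0 < x \<and> (b \<longrightarrow> 0 < y) \<and> (0 < u \<or> b \<and> 0 < v)) :: int)" for x y u v :: int
  by (cases b; cases "0 < y"; cases "0 < u"; cases "0 < v") auto

lemmas expr_defs = fine_flag_def in_circle_def coarse_test_def candidate_def range_flag_def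
  node_denominator_def shift_denominator_def grid_ratio_def center_distance_def fine_test_def

text \<open>Registers 0 to 3 hold \<open>k, i, j, n\<close>, then 4: \<open>2\<^sup>k\<close>, 5: \<open>2\<^sup>n\<close>, 7: the candidate index, 9: its
  truth value, which the fragment \<open>E\<close> computes from register 7.\<close>

definition fine_block :: "(nat \<times> expr) list" where
  "fine_block = [(6, node_denominator), (13, shift_denominator), (8, grid_ratio), (14, center_distance),
     (0, fine_test)]"

definition boundary_prog :: "prog \<Rightarrow> prog" where
  "boundary_prog E = Seq (pow2 0 4) (Seq (block [(8, fine_flag)]) (If (At (Reg 8))
     (Seq (pow2 3 5) (Seq (block [(7, candidate), (8, range_flag)])
       (Seq (If (At (Reg 8)) E (block [(9, ELit 0)])) (block fine_block))))
     (block [(0, coarse_test)])))"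

text \<open>\<open>I\<close> describes the formula's data, which may only depend on registers from
  32 on and so survive the computation of the candidate: nothing for queries and built-in formulas,
  the token list for stored ones. As only registers below 8 are sure to survive \<open>E\<close>,
  the fine block computes its other quantities afterwards.\<close>

definition evaluator :: "(int \<Rightarrow> int) \<Rightarrow> prog \<Rightarrow> nat \<Rightarrow> form \<Rightarrow> (mem \<Rightarrow> bool) \<Rightarrow> nat \<Rightarrow> bool" where
  "evaluator Q E n \<phi> I T \<longleftrightarrow>
     (\<forall>s s'. (\<forall>r\<ge>32. s' r = s r) \<longrightarrow> I s \<longrightarrow> I s') \<and>
     (\<forall>s. I s \<longrightarrow> 0 \<le> s 7 \<longrightarrow> s 7 < 2 ^ n \<longrightarrow>
        runs Q E s T (\<lambda>s'. s' 9 = access \<phi> (s 7) \<and> (\<forall>r<8. s' r = s r)))"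

definition boundary_prog_within :: "nat \<Rightarrow> bool" where
  "boundary_prog_within C \<longleftrightarrow> (\<forall>Q E n \<phi> I T s k i j. evaluator Q E n \<phi> I T \<longrightarrow> I s \<longrightarrow>
     s 0 = int k \<longrightarrow> s 1 = i \<longrightarrow> s 2 = j \<longrightarrow> s 3 = int n \<longrightarrow>
     runs Q (boundary_prog E) s (C * (k + len i + len j + len (int n)) + (if k \<le> 6 * n then 0 else T))
       (\<lambda>s'. s' 0 = of_bool (boundary_test n \<phi> k i j)))"

lemma boundary_prog_runs: "\<exists>C. boundary_prog_within C"
proof -
  let ?flag = "[(8, fine_flag)]" and ?cand = "[(7, candidate), (8, range_flag)]" and ?zero = "[(9, ELit 0)]"
    and ?coarse = "[(0, coarse_test)]"
  obtain Kp where Kp: "pow2_within 0 4 Kp" using pow2_runs[of 0 4] by auto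
  obtain Kq where Kq: "pow2_within 3 5 Kq" using pow2_runs[of 3 5] by auto
  obtain K1 where K1: "block_within ?flag K1"
    using block_within_exists[of ?flag] by (auto simp: simple_def expr_defs numeral_eq_Suc)
  obtain K2 where K2: "block_within ?coarse K2"
    using block_within_exists[of ?coarse] by (auto simp: simple_def expr_defs numeral_eq_Suc)
  obtain K3 where K3: "block_within ?cand K3"
    using block_within_exists[of ?cand] by (auto simp: simple_def expr_defs numeral_eq_Suc)
  obtain K5 where K5: "block_within ?zero K5" using block_within_exists[of ?zero] by (auto simp: simple_def)
  obtain K6 where K6: "block_within fine_block K6"
    using block_within_exists[of fine_block] by (auto simp: fine_block_def simple_def expr_defs numeral_eq_Suc)
  define R where "R = K2 + Kq + K3 + K5 + K6 * (1 + K3)"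
  define C where "C = Kp + K1 + R + (4 + 2 * len 8)"
  have "runs Q (boundary_prog E) s (C * (k + len i + len j + len (int n)) + (if k \<le> 6 * n then 0 else T))
       (\<lambda>s'. s' 0 = of_bool (boundary_test n \<phi> k i j))"
    if ev: "evaluator Q E n \<phi> I T" and I: "I s"
      and s: "s 0 = int k" "s 1 = i" "s 2 = j" "s 3 = int n" for Q E n \<phi> I T s k i j
  proof -
    define L where "L = k + len i + len j + len (int n)"
    have L: "1 \<le> L" "k + 1 \<le> L" "len (int k) \<le> L" "len i \<le> L" "len j \<le> L" "len (int n) \<le> L"
      using len_pos[of i] len_pos[of j] len_int_le[of k] by (auto simp: L_def)
    let ?P = "\<lambda>s'. s' 0 = of_bool (boundary_test n \<phi> k i j)"
    have stable: "(\<And>r. 32 \<le> r \<Longrightarrow> s' r = s r) \<Longrightarrow> I s \<Longrightarrow> I s'" for s s'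
      using ev by (auto simp: evaluator_def)
    have coarse: "runs Q (block ?coarse) t (K2 * L) ?P"
      if t: "t 1 = i" "t 2 = j" "t 4 = 2 ^ k" and k: "k \<le> 6 * n" for t
    proof (rule runs_mono)
      show "runs Q (block ?coarse) t (K2 * L) (\<lambda>u. agree u (updates ?coarse t))"
        by (rule block_withinD[OF K2 L(1)]) (use t L in \<open>auto simp: expr_defs numeral_eq_Suc\<close>)
      have "denote coarse_test t = of_bool (boundary_test n \<phi> k i j)"
        using t k by (auto simp: coarse_test_def in_circle_def boundary_test_def Let_def)
      then show "?P u" if "agree u (updates ?coarse t)" for u using that by (simp add: agree_def)
    qed simp
    have fine: "runs Q (Seq (pow2 3 5) (Seq (block ?cand) (Seq (If (At (Reg 8)) E (block ?zero)) (block fine_block))))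
       t (Kq * L + (K3 * L + (2 + len 8 + (K5 * L + T) + K6 * ((1 + K3) * L)))) ?P"
      if t: "t 1 = i" "t 2 = j" "t 3 = int n" "t 4 = 2 ^ k" "I t" and k: "6 * n < k" for t
    proof -
      define a where "a = (2 * 2 ^ n * j + (2 ^ k + i)) div (2 * (2 ^ k + i))"
      define b :: int where "b = of_bool (a \<in> models n \<phi>)"
      have L1: "1 \<le> (1 + K3) * L" "x \<le> L \<Longrightarrow> x \<le> (1 + K3) * L" for x using L(1) by simp_all
      let ?S = "\<lambda>t. t 1 = i \<and> t 2 = j \<and> t 4 = 2 ^ k \<and> t 5 = 2 ^ n \<and> t 7 = a"
      have last: "runs Q (block fine_block) t (K6 * ((1 + K3) * L)) ?P"
        if t: "?S t" "t 9 = b" and la: "len a \<le> (1 + K3) * L" for t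
      proof (rule runs_mono)
        have lb: "len b \<le> L" using L(1) by (simp add: b_def)
        show "runs Q (block fine_block) t (K6 * ((1 + K3) * L)) (\<lambda>u. agree u (updates fine_block t))"
          by (rule block_withinD[OF K6 L1(1)])
            (use t la lb L L1(2) k in \<open>auto simp: fine_block_def expr_defs numeral_eq_Suc simp del: One_nat_def\<close>)
        define N H g where "N = (2 ^ n)\<^sup>2 + a\<^sup>2" and "H = (2 ^ n :: int) ^ 12" and "g = (2 ^ k :: int) div (2 * (2 ^ n) ^ 6)"
        define V where "V = 4 * ((i * N * H - 2 ^ k * (H + 1) * ((2 ^ n)\<^sup>2 - a\<^sup>2))\<^sup>2
          + (j * N * H - 2 ^ k * (H + 1) * (2 * 2 ^ n * a))\<^sup>2)"
        define u where "u = t(6 := N, 13 := H, 8 := g, 14 := V)"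
        have "denote node_denominator t = N" "denote shift_denominator (t(6 := N)) = H"
          "denote grid_ratio (t(6 := N, 13 := H)) = g" "denote center_distance (t(6 := N, 13 := H, 8 := g)) = V"
          unfolding N_def H_def g_def V_def using t
          by (simp_all add: node_denominator_def shift_denominator_def grid_ratio_def center_distance_def)
        then have "updates fine_block t 0 = denote fine_test u"
          unfolding fine_block_def updates.simps u_def by (simp only: fun_upd_same)
        moreover have "denote fine_test u = of_bool (0 < (2 ^ k + 1)\<^sup>2 - (i\<^sup>2 + j\<^sup>2)) *
          (of_bool (0 < 1 - b + of_bool (0 < V - (N * H * (3 * g - 2))\<^sup>2)) *
           of_bool (0 < of_bool (0 < i\<^sup>2 + j\<^sup>2 - (2 ^ k - 1)\<^sup>2) + b * of_bool (0 < (N * H * (3 * g + 2))\<^sup>2 - V)))"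
        proof -
          have u: "u 1 = i" "u 2 = j" "u 4 = 2 ^ k" "u 9 = b" "u 6 = N" "u 13 = H" "u 8 = g" "u 14 = V"
            using t by (simp_all add: u_def)
          show ?thesis
            unfolding fine_test_def in_circle_def denote.simps apply_op.simps denote_epow u ..
        qed
        moreover have "boundary_test n \<phi> k i j \<longleftrightarrow> i\<^sup>2 + j\<^sup>2 < (2 ^ k + 1)\<^sup>2 \<and>
          (a \<in> models n \<phi> \<longrightarrow> (N * H * (3 * g - 2))\<^sup>2 < V) \<and>
          ((2 ^ k - 1)\<^sup>2 < i\<^sup>2 + j\<^sup>2 \<or> a \<in> models n \<phi> \<and> V < (N * H * (3 * g + 2))\<^sup>2)"
          using k unfolding boundary_test_def Let_def a_def N_def H_def g_def V_def by simp
        ultimately show "?P v" if "agree v (updates fine_block t)" for v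
          using that unfolding b_def bool_arith by (simp add: agree_def)
      qed simp
      have bit: "runs Q (If (At (Reg 8)) E (block ?zero)) t (2 + len 8 + (K5 * L + T)) (\<lambda>t. ?S t \<and> t 9 = b)"
        if h: "?S t" "I t" "t 8 = of_bool (0 \<le> a \<and> a < 2 ^ n)" for t
      proof (rule runs_If)
        assume "0 < val (At (Reg 8)) t"
        then have range: "0 \<le> a" "a < 2 ^ n" using h by auto
        have "runs Q E t T (\<lambda>t'. t' 9 = access \<phi> (t 7) \<and> (\<forall>r<8. t' r = t r))"
          using ev h range by (auto simp: evaluator_def)
        then show "runs Q E t (K5 * L + T) (\<lambda>t. ?S t \<and> t 9 = b)"
          by (rule runs_mono) (use h range in \<open>auto simp: access_def b_def models_def\<close>)
      next
        assume "\<not> 0 < val (At (Reg 8)) t"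
        then have range: "\<not> (0 \<le> a \<and> a < 2 ^ n)" using h by auto
        have "runs Q (block ?zero) t (K5 * L) (\<lambda>u. agree u (updates ?zero t))"
          by (rule block_withinD[OF K5 L(1)]) auto
        then show "runs Q (block ?zero) t (K5 * L + T) (\<lambda>t. ?S t \<and> t 9 = b)"
          by (rule runs_mono) (use h range in \<open>auto simp: b_def models_def agree_def\<close>)
      qed (use h in simp)
      show ?thesis
      proof (rule runs_Seq)
        show "runs Q (pow2 3 5) t (Kq * L) (\<lambda>u. u 5 = 2 ^ n \<and> kept_but 5 t u)"
          using k L(2) by (intro pow2_withinD[OF Kq, where s = t and x = n, OF t(3)]) simp
        fix u assume u': "u 5 = 2 ^ n \<and> kept_but 5 t u"
        have u: "u 1 = i" "u 2 = j" "u 4 = 2 ^ k" "u 5 = 2 ^ n" using u' t by auto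
        have Iu: "I u" by (rule stable[OF _ t(5)]) (use u' in auto)
        have lens: "len (u r) \<le> L" if "r \<in> reads ?cand" for r
          using that u L k by (auto simp: expr_defs)
        have upd: "updates ?cand u 7 = a" "updates ?cand u 8 = of_bool (0 \<le> a \<and> a < 2 ^ n)"
          using u by (auto simp: candidate_def range_flag_def a_def)
        \<comment> \<open>Far from the circle the candidate has no geometric bound, so its length is
          taken from the size clause of the block that computes it.\<close>
        have "len a \<le> K3 * L" using block_withinD(2)[OF K3 L(1), where s = u and d = 7, OF lens] upd by simp
        then have la: "len a \<le> (1 + K3) * L" by simp
        show "runs Q (Seq (block ?cand) (Seq (If (At (Reg 8)) E (block ?zero)) (block fine_block))) u
            (K3 * L + (2 + len 8 + (K5 * L + T) + K6 * ((1 + K3) * L))) ?P"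
        proof (rule runs_Seq[OF block_withinD(1)[OF K3 L(1) lens]])
          fix v assume v: "agree v (updates ?cand u)"
          have "?S v" "v 8 = of_bool (0 \<le> a \<and> a < 2 ^ n)" using v u upd by (simp_all add: agree_def)
          moreover have "I v" by (rule stable[OF _ Iu]) (use v in \<open>auto simp: agree_def\<close>)
          ultimately show "runs Q (Seq (If (At (Reg 8)) E (block ?zero)) (block fine_block)) v
              (2 + len 8 + (K5 * L + T) + K6 * ((1 + K3) * L)) ?P"
            by (intro runs_Seq[OF bit last]) (use la in auto)
        qed simp_all
      qed simp
    qed
    define F where "F = (if k \<le> 6 * n then 0 else T)"
    have "runs Q (boundary_prog E) s (Kp * L + (K1 * L + (2 + len 8 + (R * L + (2 + len 8) + F)))) ?P"
      unfolding boundary_prog_def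
    proof (rule runs_Seq)
      show "runs Q (pow2 0 4) s (Kp * L) (\<lambda>t. t 4 = 2 ^ k \<and> kept_but 4 s t)"
        by (rule pow2_withinD[OF Kp, where s = s and x = k, OF s(1) L(2)])
      fix t assume t: "t 4 = 2 ^ k \<and> kept_but 4 s t"
      have It: "I t" by (rule stable[OF _ I]) (use t in auto)
      show "runs Q (Seq (block ?flag) (If (At (Reg 8))
         (Seq (pow2 3 5) (Seq (block ?cand) (Seq (If (At (Reg 8)) E (block ?zero)) (block fine_block))))
         (block ?coarse))) t (K1 * L + (2 + len 8 + (R * L + (2 + len 8) + F))) ?P"
      proof (rule runs_Seq[OF block_withinD(1)[OF K1 L(1)]])
        show "len (t r) \<le> L" if "r \<in> reads ?flag" for r using that s t L by (auto simp: fine_flag_def)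
        fix u assume u: "agree u (updates ?flag t)"
        have Iu: "I u" by (rule stable[OF _ It]) (use u in \<open>auto simp: agree_def\<close>)
        have u8: "u 8 = of_bool (6 * n < k)" using u t s by (simp add: fine_flag_def agree_def)
        have us: "u 1 = i" "u 2 = j" "u 3 = int n" "u 4 = 2 ^ k" using u t s by (auto simp: agree_def)
        show "runs Q (If (At (Reg 8))
           (Seq (pow2 3 5) (Seq (block ?cand) (Seq (If (At (Reg 8)) E (block ?zero)) (block fine_block))))
           (block ?coarse)) u (2 + len 8 + (R * L + (2 + len 8) + F)) ?P"
        proof (rule runs_If)
          assume "0 < val (At (Reg 8)) u"
          then have k: "6 * n < k" using u8 by (simp split: if_splits)
          show "runs Q (Seq (pow2 3 5) (Seq (block ?cand) (Seq (If (At (Reg 8)) E (block ?zero)) (block fine_block))))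
              u (R * L + (2 + len 8) + F) ?P"
            by (rule runs_mono[OF fine[OF us Iu k]]) (use k in \<open>auto simp: F_def R_def algebra_simps\<close>)
        next
          assume "\<not> 0 < val (At (Reg 8)) u"
          then have k: "k \<le> 6 * n" using u8 by (simp split: if_splits)
          show "runs Q (block ?coarse) u (R * L + (2 + len 8) + F) ?P"
            by (rule runs_mono[OF coarse[OF us(1,2,4) k]]) (auto simp: R_def algebra_simps)
        qed (use u8 in simp)
      qed simp
    qed simp
    moreover have "4 + 2 * len 8 \<le> (4 + 2 * len 8) * L" by (rule le_mult_ge_1[OF L(1)])
    moreover have "C * L = Kp * L + K1 * L + R * L + (4 + 2 * len 8) * L"
      unfolding C_def distrib_right by simp
    ultimately show ?thesis unfolding L_def[symmetric] F_def[symmetric] by (elim runs_mono) linarith+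
  qed
  then show ?thesis unfolding boundary_prog_within_def by blast
qed

section \<open>Counting and evaluating\<close>

definition count_expr :: expr where
  "count_expr = EDiv (EAdd (EMul (ELit 64) (ESub (epow (EReg 5) 20) (EReg 0))) (EMul (ELit 9) (epow (EReg 5) 8)))
     (EMul (ELit 18) (epow (EReg 5) 8))"

definition count_prog :: prog where
  "count_prog = Seq (pow2 1 5) (block [(0, count_expr)])"

definition count_prog_within :: "nat \<Rightarrow> bool" where
  "count_prog_within C \<longleftrightarrow> (\<forall>Q s n R. s 0 = R \<longrightarrow> s 1 = int n \<longrightarrow> len R \<le> 20 * n + 1 \<longrightarrow>
     runs Q count_prog s (C * (n + 1))
       (\<lambda>s'. s' 0 = (64 * ((2 ^ n) ^ 20 - R) + 9 * (2 ^ n) ^ 8) div (18 * (2 ^ n) ^ 8)))"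

lemma count_prog_runs: "\<exists>C. count_prog_within C"
proof -
  obtain Kp where Kp: "pow2_within 1 5 Kp" using pow2_runs[of 1 5] by auto
  obtain K where K: "block_within [(0, count_expr)] K"
    using block_within_exists[of "[(0, count_expr)]"] by (auto simp: simple_def count_expr_def numeral_eq_Suc)
  have "runs Q count_prog s ((Kp + K * 20) * (n + 1))
       (\<lambda>s'. s' 0 = (64 * ((2 ^ n) ^ 20 - R) + 9 * (2 ^ n) ^ 8) div (18 * (2 ^ n) ^ 8))"
    if s: "s 0 = R" "s 1 = int n" "len R \<le> 20 * n + 1" for Q s n R
    unfolding count_prog_def
  proof (rule runs_Seq[OF pow2_withinD[OF Kp, where s = s and x = n, OF s(2) order_refl]])
    fix t assume t: "t 5 = 2 ^ n \<and> kept_but 5 s t"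
    have "runs Q (block [(0, count_expr)]) t (K * 20 * (n + 1)) (\<lambda>u. agree u (updates [(0, count_expr)] t))"
      unfolding mult.assoc[of K]
      by (rule block_withinD[OF K]) (use t s in \<open>auto simp: count_expr_def numeral_eq_Suc\<close>)
    then show "runs Q (block [(0, count_expr)]) t (K * 20 * (n + 1))
       (\<lambda>s'. s' 0 = (64 * ((2 ^ n) ^ 20 - R) + 9 * (2 ^ n) ^ 8) div (18 * (2 ^ n) ^ 8))"
      by (rule runs_mono) (use t s in \<open>auto simp: count_expr_def agree_def\<close>)
  qed (simp add: distrib_right)
  then show ?thesis unfolding count_prog_within_def by blast
qed

definition query_prog :: prog where
  "query_prog = Query (Reg 9) (At (Reg 7))"

lemma evaluator_query: "evaluator (access \<phi>) query_prog n \<phi> (\<lambda>_. True) ((3 + len 7 + len 9) * (n + 1))"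
  unfolding evaluator_def query_prog_def
proof (intro conjI allI impI)
  fix s :: mem assume s: "0 \<le> s 7" "s 7 < 2 ^ n"
  have "len (s 7) \<le> n + 1" using s by (intro len_leI) (auto intro: less_le_trans)
  moreover have "len (access \<phi> (s 7)) = 1" by (simp add: access_def)
  moreover have "3 + len 7 + len 9 \<le> (3 + len 7 + len 9) * (n + 1)" by (rule le_mult_ge_1) simp
  moreover have "(3 + len 7 + len 9) * (n + 1) = (2 + len 7 + len 9) * (n + 1) + (n + 1)"
    by (simp add: algebra_simps)
  moreover have "2 + len 7 + len 9 \<le> (2 + len 7 + len 9) * (n + 1)" by (rule le_mult_ge_1) simp
  ultimately have "1 + val_cost (At (Reg 7)) s + addr_cost (Reg 9) s + len (access \<phi> (val (At (Reg 7)) s))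
      \<le> (3 + len 7 + len 9) * (n + 1)"
    unfolding val_cost.simps addr_cost.simps val.simps addr.simps of_nat_numeral by linarith
  then show "runs (access \<phi>) (Query (Reg 9) (At (Reg 7))) s ((3 + len 7 + len 9) * (n + 1))
      (\<lambda>s'. s' 9 = access \<phi> (s 7) \<and> (\<forall>r<8. s' r = s r))"
    by (rule runsI[OF exec_Query[OF refl]]) auto
qed

text \<open>Linear-time computability of the boundary concerns one fixed formula at a time, which
  may therefore be built into the program, with a constant depending on it.\<close>

fun form_expr :: "form \<Rightarrow> expr" where
  "form_expr (Var v) = ESub (EDiv (EReg 7) (ELit (2 ^ v))) (EMul (ELit 2) (EDiv (EDiv (EReg 7) (ELit (2 ^ v))) (ELit 2)))"
| "form_expr (Neg a) = ESub (ELit 1) (form_expr a)"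
| "form_expr (And a b) = EMul (form_expr a) (form_expr b)"
| "form_expr (Or a b) = ESub (EAdd (form_expr a) (form_expr b)) (EMul (form_expr a) (form_expr b))"

lemma of_bool_bit: "of_bool (bit u v) = u div 2 ^ v - 2 * (u div 2 ^ v div 2)" for u :: int
  by (simp add: bit_iff_odd minus_mult_div_eq_mod mod_2_eq_odd)

lemma denote_form_expr: "denote (form_expr \<phi>) s = access \<phi> (s 7)"
  unfolding access_def by (induction \<phi>) (auto simp: of_bool_bit)

lemma regs_form_expr: "regs (form_expr \<phi>) \<subseteq> {7}"
  by (induction \<phi>) auto

definition form_prog :: "form \<Rightarrow> prog" where
  "form_prog \<phi> = Seq (compile (form_expr \<phi>) 16) (Set (Reg 9) (At (Reg 16)))"

lemma evaluator_form:
  "\<exists>C. \<forall>n. evaluator Q (form_prog \<phi>) n \<phi> (\<lambda>_. True) (C * (n + 1))"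
proof -
  have "regs (form_expr \<phi>) \<subseteq> {..<16}" using regs_form_expr[of \<phi>] by auto
  then obtain K where K: "runs_within (form_expr \<phi>) (compile (form_expr \<phi>) 16) K (computed 16 (form_expr \<phi>))"
    using compile_runs by blast
  have "evaluator Q (form_prog \<phi>) n \<phi> (\<lambda>_. True) ((K + (3 + len 16 + len 9)) * (n + 1))" for n
    unfolding evaluator_def form_prog_def
  proof (intro conjI allI impI)
    fix s :: mem assume s: "0 \<le> s 7" "s 7 < 2 ^ n"
    have l: "len (s 7) \<le> n + 1" using s by (intro len_leI) (auto intro: less_le_trans)
    show "runs Q (Seq (compile (form_expr \<phi>) 16) (Set (Reg 9) (At (Reg 16)))) s
        ((K + (3 + len 16 + len 9)) * (n + 1)) (\<lambda>s'. s' 9 = access \<phi> (s 7) \<and> (\<forall>r<8. s' r = s r))"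
    proof (rule runs_Seq[OF runs_withinD[OF K, of "n + 1"]])
      show "len (s r) \<le> n + 1" if "r \<in> regs (form_expr \<phi>)" for r using that l regs_form_expr[of \<phi>] by auto
      fix t assume t: "computed 16 (form_expr \<phi>) s t"
      then have t16: "t 16 = access \<phi> (s 7)" by (simp add: denote_form_expr)
      show "runs Q (Set (Reg 9) (At (Reg 16))) t ((3 + len 16 + len 9) * (n + 1))
          (\<lambda>s'. s' 9 = access \<phi> (s 7) \<and> (\<forall>r<8. s' r = s r))"
      proof (rule runs_Set)
        have "3 + len 16 + len 9 \<le> (3 + len 16 + len 9) * (n + 1)" by (rule le_mult_ge_1) simp
        moreover have "len (access \<phi> (s 7)) = 1" by (simp add: access_def)
        ultimately show "1 + val_cost (At (Reg 16)) t + addr_cost (Reg 9) t + len (val (At (Reg 16)) t)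
            \<le> (3 + len 16 + len 9) * (n + 1)"
          unfolding val_cost.simps addr_cost.simps val.simps addr.simps t16 of_nat_numeral by linarith
      qed (use t t16 in auto)
    qed (simp_all add: distrib_right)
  qed auto
  then show ?thesis by blast
qed

text \<open>Reading the tokens from right to left, the stack of truth values is kept as the bits of one
  integer, the top of the stack being the lowest bit.\<close>

definition token_step :: "int \<Rightarrow> nat \<Rightarrow> int \<Rightarrow> int" where
  "token_step u c S = (if 4 \<le> c then 2 * S + of_bool (bit u (c - 4))
     else if c = 3 then 2 * (S div 4) + of_bool (odd S \<or> odd (S div 2))
     else if c = 2 then 2 * (S div 4) + of_bool (odd S \<and> odd (S div 2))
     else S + 1 - 2 * (S mod 2))"

lemma token_step_connective:
  fixes S :: int
  shows "token_step u 2 (2 * (2 * S + of_bool B) + of_bool A) = 2 * S + of_bool (A \<and> B)"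
    and "token_step u 3 (2 * (2 * S + of_bool B) + of_bool A) = 2 * S + of_bool (A \<or> B)"
    and "token_step u 1 (2 * S + of_bool A) = 2 * S + of_bool (\<not> A)"
    and "token_step u (v + 4) S = 2 * S + of_bool (bit u v)"
proof -
  have div2: "(2 * X + of_bool A) div 2 = X" for X :: int and A by (cases A) simp_all
  have "(2 * (2 * S + of_bool B) + of_bool A) div (2 * 2) = S"
    by (simp only: zdiv_zmult2_eq div2)
  then have div4: "(2 * (2 * S + of_bool B) + of_bool A) div 4 = S" by simp
  have odd: "odd (2 * X + of_bool A) = A" for X :: int and A by (cases A) simp_all
  show "token_step u 2 (2 * (2 * S + of_bool B) + of_bool A) = 2 * S + of_bool (A \<and> B)"
    "token_step u 3 (2 * (2 * S + of_bool B) + of_bool A) = 2 * S + of_bool (A \<or> B)"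
    unfolding token_step_def div4 div2 odd by simp_all
  have "(2 * S + of_bool A) mod 2 = of_bool A" by (cases A) simp_all
  then show "token_step u 1 (2 * S + of_bool A) = 2 * S + of_bool (\<not> A)"
    unfolding token_step_def by (cases A) simp_all
qed (simp_all add: token_step_def)

text \<open>In Polish notation read from the right, a connective finds its operands on the stack,
  the first one on top. The stack \<open>S\<close> is arbitrary because the value of the second
  operand lies below while the first one is evaluated.\<close>

lemma foldr_token_step: "foldr (token_step u) (tokens \<phi>) S = 2 * S + of_bool (sat (bit u) \<phi>)"
proof (induction \<phi> arbitrary: S)
  case (And a b)
  show ?case by (simp only: tokens.simps foldr_Cons foldr_append o_apply And.IH token_step_connective sat.simps)
next
  case (Or a b)
  show ?case by (simp only: tokens.simps foldr_Cons foldr_append o_apply Or.IH token_step_connective sat.simps)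
qed (simp_all only: tokens.simps foldr_Cons foldr_Nil id_apply o_apply token_step_connective sat.simps)

text \<open>A token lengthens the stack by at most one bit, so its size is bounded by the number of
  tokens read.\<close>

lemma token_step_bounds: "0 \<le> S \<Longrightarrow> 0 \<le> token_step u c S \<and> token_step u c S \<le> 2 * S + 1"
proof -
  assume S: "0 \<le> S"
  then have "2 * (S mod 2) \<le> S + 1" "2 * (S div 4) \<le> 2 * S" "- (2 * (S mod 2)) \<le> S" by presburger+
  then show ?thesis using S by (simp add: token_step_def)
qed

definition stack_top :: expr where
  "stack_top = ESub (EReg 9) (EMul (ELit 2) (EDiv (EReg 9) (ELit 2)))"

definition stack_second :: expr where
  "stack_second = ESub (EDiv (EReg 9) (ELit 2)) (EMul (ELit 2) (EDiv (EDiv (EReg 9) (ELit 2)) (ELit 2)))"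

definition stack_rest :: expr where
  "stack_rest = EMul (ELit 2) (EDiv (EReg 9) (ELit 4))"

text \<open>The four cases of \<open>token_step\<close>, each multiplied by the 0/1 indicator of its
  tokens; register 8 holds the power of two at which the bit of a variable is read.\<close>

definition token_expr :: expr where
  "token_expr = EAdd (EAdd (EAdd
     (EMul (EPos (ESub (EReg 14) (ELit 3))) (EAdd (EMul (ELit 2) (EReg 9))
        (ESub (EDiv (EReg 7) (EReg 8)) (EMul (ELit 2) (EDiv (EDiv (EReg 7) (EReg 8)) (ELit 2))))))
     (EMul (EMul (EPos (ESub (EReg 14) (ELit 2))) (EPos (ESub (ELit 4) (EReg 14))))
        (EAdd stack_rest (ESub (EAdd stack_top stack_second) (EMul stack_top stack_second)))))
     (EMul (EMul (EPos (ESub (EReg 14) (ELit 1))) (EPos (ESub (ELit 3) (EReg 14))))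
        (EAdd stack_rest (EMul stack_top stack_second))))
     (EMul (EPos (ESub (ELit 2) (EReg 14))) (ESub (EAdd (EReg 9) (ELit 1)) (EMul (ELit 2) stack_top)))"

lemma denote_token_expr:
  assumes "s 14 = int c" "s 8 = 2 ^ (c - 4)"
  shows "denote token_expr s = token_step (s 7) c (s 9)"
proof -
  have odd: "x - 2 * (x div 2) = of_bool (odd x)" for x :: int
    by (simp add: minus_mult_div_eq_mod mod_2_eq_odd)
  consider "4 \<le> c" | "c = 3" | "c = 2" | "c \<le> 1" by linarith
  then show ?thesis
    by cases (use assms in \<open>auto simp: token_expr_def stack_top_def stack_second_def stack_rest_def
        token_step_def of_bool_bit odd mod_2_eq_odd\<close>)
qed

text \<open>Register 13 counts the tokens still unread. Register 65 holds the length and token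
  \<open>p\<close> sits in register \<open>p + 66\<close>, so a count of \<open>p + 1\<close> needs
  the offset 65.\<close>

definition token_body :: prog where
  "token_body = Seq (block [(15, EAdd (EReg 13) (ELit 65))]) (Seq (Set (Reg 14) (At (Ind 15)))
     (Seq (block [(13, ESub (EReg 13) (ELit 1)), (8, EMul (EPos (ESub (EReg 14) (ELit 4))) (ESub (EReg 14) (ELit 4)))])
     (Seq (pow2 8 8) (block [(9, token_expr)]))))"

definition token_prog :: prog where
  "token_prog = Seq (Set (Reg 13) (At (Reg 65))) (Seq (Set (Reg 9) (Lit 0))
     (While (At (Reg 13)) token_body))"

definition stored_form :: "form \<Rightarrow> mem \<Rightarrow> bool" where
  "stored_form \<phi> s \<longleftrightarrow> s 65 = int (length (tokens \<phi>)) \<and>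
     (\<forall>k < length (tokens \<phi>). s (k + 66) = int (tokens \<phi> ! k))"

lemma tokens_le: "c \<in> set (tokens \<phi>) \<Longrightarrow> vars \<phi> \<subseteq> {..<n} \<Longrightarrow> c \<le> n + 3"
  by (induction \<phi>) auto

definition token_body_within :: "nat \<Rightarrow> bool" where
  "token_body_within K \<longleftrightarrow> (\<forall>Q s n \<phi> p. vars \<phi> \<subseteq> {..<n} \<longrightarrow> stored_form \<phi> s \<longrightarrow> s 13 = int (Suc p) \<longrightarrow>
     p < length (tokens \<phi>) \<longrightarrow> 0 \<le> s 7 \<longrightarrow> s 7 < 2 ^ n \<longrightarrow> 0 \<le> s 9 \<longrightarrow> s 9 < 2 ^ length (tokens \<phi>) \<longrightarrow>
     runs Q token_body s (K * (n + length (tokens \<phi>) + 70))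
       (\<lambda>t. t 13 = int p \<and> t 9 = token_step (s 7) (tokens \<phi> ! p) (s 9) \<and> (\<forall>r. r < 8 \<or> 32 \<le> r \<longrightarrow> t r = s r)))"

lemma token_body_runs: "\<exists>K. token_body_within K"
proof -
  let ?xs = "[(15, EAdd (EReg 13) (ELit 65))]"
    and ?ys = "[(13, ESub (EReg 13) (ELit 1)), (8, EMul (EPos (ESub (EReg 14) (ELit 4))) (ESub (EReg 14) (ELit 4)))]"
    and ?zs = "[(9, token_expr)]"
  obtain K1 where K1: "block_within ?xs K1" using block_within_exists[of ?xs] by (auto simp: simple_def)
  obtain K2 where K2: "block_within ?ys K2" using block_within_exists[of ?ys] by (auto simp: simple_def)
  obtain Kp where Kp: "pow2_within 8 8 Kp" using pow2_runs[of 8 8] by auto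
  obtain K3 where K3: "block_within ?zs K3" using block_within_exists[of ?zs]
    by (auto simp: simple_def token_expr_def stack_top_def stack_second_def stack_rest_def)
  define c where "c = 4 + len 15 + len 14"
  have "runs Q token_body s ((K1 + (c + (K2 + (Kp + K3)))) * (n + length (tokens \<phi>) + 70))
       (\<lambda>t. t 13 = int p \<and> t 9 = token_step (s 7) (tokens \<phi> ! p) (s 9) \<and> (\<forall>r. r < 8 \<or> 32 \<le> r \<longrightarrow> t r = s r))"
    if \<phi>: "vars \<phi> \<subseteq> {..<n}" "stored_form \<phi> s" and p: "s 13 = int (Suc p)" "p < length (tokens \<phi>)"
      and u: "0 \<le> s 7" "s 7 < 2 ^ n" and S: "0 \<le> s 9" "s 9 < 2 ^ length (tokens \<phi>)" for Q s n \<phi> p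
  proof -
    define L where "L = n + length (tokens \<phi>) + 70"
    define x where "x = tokens \<phi> ! p"
    have L: "1 \<le> L" by (simp add: L_def)
    have x: "x \<le> n + 3" unfolding x_def by (rule tokens_le[OF nth_mem[OF p(2)] \<phi>(1)])
    have sx: "s (p + 66) = int x" using \<phi>(2) p(2) by (simp add: stored_form_def x_def)
    have lens: "len (int (Suc p)) \<le> L" "len (int (p + 66)) \<le> L" "len (int x) \<le> L"
      using len_int_le[of "Suc p"] len_int_le[of "p + 66"] len_int_le[of x] p(2) x by (simp_all add: L_def)
    have "(2::int) ^ length (tokens \<phi>) \<le> 2 ^ L" "(2::int) ^ n \<le> 2 ^ L"
      by (rule power_increasing; simp add: L_def)+
    then have "\<bar>s 9\<bar> < 2 ^ L" "\<bar>s 7\<bar> < 2 ^ L" using S u by linarith+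
    then have l79: "len (s 9) \<le> L" "len (s 7) \<le> L" using len_leI[OF _ L] by auto
    let ?P = "\<lambda>t. t 13 = int p \<and> t 9 = token_step (s 7) x (s 9) \<and> (\<forall>r. r < 8 \<or> 32 \<le> r \<longrightarrow> t r = s r)"
    let ?fr = "\<lambda>t. \<forall>r. r < 8 \<or> 32 \<le> r \<or> r = 9 \<longrightarrow> t r = s r"
    have st4: "runs Q (Seq (pow2 8 8) (block ?zs)) t ((Kp + K3) * L) ?P"
      if t: "?fr t" "t 13 = int p" "t 14 = int x" "t 8 = int (x - 4)" for t
    proof (rule runs_Seq)
      show "runs Q (pow2 8 8) t (Kp * L) (\<lambda>v. v 8 = 2 ^ (x - 4) \<and> kept_but 8 t v)"
        by (rule pow2_withinD[OF Kp, where s = t and x = "x - 4", OF t(4)]) (use x in \<open>simp add: L_def\<close>)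
      fix v assume v: "v 8 = 2 ^ (x - 4) \<and> kept_but 8 t v"
      have vals: "v 8 = 2 ^ (x - 4)" "v 14 = int x" "v 9 = s 9" "v 7 = s 7" "v 13 = int p" using v t by auto
      have "x - 4 + 1 \<le> L" using x by (simp add: L_def)
      then have "runs Q (block ?zs) v (K3 * L) (\<lambda>w. agree w (updates ?zs v))"
        by (intro block_withinD[OF K3 L])
          (use vals l79 lens in \<open>auto simp: token_expr_def stack_top_def stack_second_def stack_rest_def\<close>)
      moreover have "denote token_expr v = token_step (s 7) x (s 9)"
        using denote_token_expr[of v x] vals by simp
      ultimately show "runs Q (block ?zs) v (K3 * L) ?P"
        by (elim runs_mono) (use v t in \<open>auto simp: agree_def\<close>)
    qed (simp add: distrib_right)
    have st3: "runs Q (Seq (block ?ys) (Seq (pow2 8 8) (block ?zs))) t ((K2 + (Kp + K3)) * L) ?P"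
      if t: "?fr t" "t 13 = int (Suc p)" "t 14 = int x" for t
    proof (rule runs_Seq[OF block_withinD(1)[OF K2 L]])
      show "len (t r) \<le> L" if "r \<in> reads ?ys" for r using that t(2,3) lens by auto
      fix v assume v: "agree v (updates ?ys t)"
      show "runs Q (Seq (pow2 8 8) (block ?zs)) v ((Kp + K3) * L) ?P"
      proof (rule st4)
        show "v 8 = int (x - 4)" using v t(3) by (cases "4 < x") (auto simp: agree_def)
      qed (use v t in \<open>auto simp: agree_def\<close>)
    qed (simp add: distrib_right)
    have st2: "runs Q (Seq (Set (Reg 14) (At (Ind 15))) (Seq (block ?ys) (Seq (pow2 8 8) (block ?zs)))) t
        ((c + (K2 + (Kp + K3))) * L) ?P"
      if t: "?fr t" "t 13 = int (Suc p)" "t 15 = int (p + 66)" for t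
    proof (rule runs_Seq)
      have tx: "t (p + 66) = int x" using t(1) sx by simp
      have v: "t (nat (t 15)) = int x" unfolding t(3) nat_int by (rule tx)
      show "runs Q (Set (Reg 14) (At (Ind 15))) t (c * L) (\<lambda>v. v = t(14 := int x))"
      proof (rule runs_Set)
        have "1 + len 15 + len 14 \<le> (1 + len 15 + len 14) * L" by (rule le_mult_ge_1[OF L])
        moreover have "c * L = (1 + len 15 + len 14) * L + 3 * L" unfolding c_def distrib_right by simp
        moreover have "len (t 15) \<le> L" using lens(2) t(3) by simp
        ultimately show "1 + val_cost (At (Ind 15)) t + addr_cost (Reg 14) t + len (val (At (Ind 15)) t) \<le> c * L"
          unfolding val_cost.simps addr_cost.simps val.simps addr.simps of_nat_numeral v
          using lens(3) by linarith
      qed (simp only: addr.simps val.simps v)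
      show "runs Q (Seq (block ?ys) (Seq (pow2 8 8) (block ?zs))) v ((K2 + (Kp + K3)) * L) ?P"
        if "v = t(14 := int x)" for v
        by (rule st3) (use that t in auto)
    qed (simp add: distrib_right)
    have "runs Q token_body s ((K1 + (c + (K2 + (Kp + K3)))) * L) ?P"
      unfolding token_body_def
    proof (rule runs_Seq[OF block_withinD(1)[OF K1 L]])
      show "len (s r) \<le> L" if "r \<in> reads ?xs" for r using that p(1) lens by auto
      fix v assume v: "agree v (updates ?xs s)"
      show "runs Q (Seq (Set (Reg 14) (At (Ind 15))) (Seq (block ?ys) (Seq (pow2 8 8) (block ?zs)))) v
          ((c + (K2 + (Kp + K3))) * L) ?P"
        by (rule st2) (use v p in \<open>auto simp: agree_def\<close>)
    qed (simp add: distrib_right)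
    then show ?thesis by (simp only: L_def x_def)
  qed
  then show ?thesis unfolding token_body_within_def by blast
qed

text \<open>With \<open>p\<close> tokens unread the other \<open>l - p\<close> have been consumed,
  and the stack has at most that many bits.\<close>

lemma token_loop_runs:
  assumes K: "token_body_within K" and \<phi>: "vars \<phi> \<subseteq> {..<n}" and u: "0 \<le> u" "u < 2 ^ n"
  defines "l \<equiv> length (tokens \<phi>)" and "W \<equiv> (K + 2 + len 13) * (n + length (tokens \<phi>) + 70)"
  assumes "p \<le> l" "stored_form \<phi> s" "s 13 = int p" "s 7 = u" "0 \<le> s 9" "s 9 < 2 ^ (l - p)"
  shows "runs Q (While (At (Reg 13)) token_body) s ((p + 1) * W)
     (\<lambda>t. t 9 = foldr (token_step u) (take p (tokens \<phi>)) (s 9) \<and> (\<forall>r<8. t r = s r))"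
  using assms(7-)
proof (induction p arbitrary: s)
  define L where "L = n + length (tokens \<phi>) + 70"
  have W: "W = (K + 2 + len 13) * L" by (simp add: W_def L_def)
  have L: "1 \<le> L" by (simp add: L_def)
  have test: "1 + len 13 + len (int q) \<le> (2 + len 13) * L" if "q \<le> l" for q
  proof -
    have "1 + len 13 \<le> (1 + len 13) * L" by (rule le_mult_ge_1[OF L])
    moreover have "len (int q) \<le> L" using len_int_le[of q] that by (simp add: L_def l_def)
    moreover have "(2 + len 13) * L = (1 + len 13) * L + L" unfolding distrib_right by simp
    ultimately show ?thesis by linarith
  qed
  have W_split: "W = K * L + (2 + len 13) * L" unfolding W distrib_right by simp
  {
    case 0
    show ?case
    proof (rule runs_WhileFalse)
      show "1 + val_cost (At (Reg 13)) s \<le> (0 + 1) * W"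
        using test[of 0] 0 W_split by simp
    qed (use 0 in simp_all)
  next
    case (Suc p)
    have lt: "p < length (tokens \<phi>)" using Suc.prems by (simp add: l_def)
    have S: "s 9 < 2 ^ length (tokens \<phi>)"
    proof -
      have "(2::int) ^ (l - Suc p) \<le> 2 ^ length (tokens \<phi>)" by (rule power_increasing) (simp_all add: l_def)
      then show ?thesis using Suc.prems by linarith
    qed
    have body: "runs Q token_body s (K * L) (\<lambda>t. t 13 = int p \<and> t 9 = token_step (s 7) (tokens \<phi> ! p) (s 9)
        \<and> (\<forall>r. r < 8 \<or> 32 \<le> r \<longrightarrow> t r = s r))"
      unfolding L_def
      by (rule K[unfolded token_body_within_def, rule_format]) (use Suc.prems \<phi> lt S u in auto)
    show ?case
    proof (rule runs_WhileTrue[OF _ body])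
      fix t assume t: "t 13 = int p \<and> t 9 = token_step (s 7) (tokens \<phi> ! p) (s 9)
        \<and> (\<forall>r. r < 8 \<or> 32 \<le> r \<longrightarrow> t r = s r)"
      have t9: "0 \<le> t 9" "t 9 \<le> 2 * s 9 + 1"
        using token_step_bounds[OF Suc.prems(5)] t by auto
      have "t 9 < 2 * 2 ^ (l - Suc p)" using t9 Suc.prems(6) by linarith
      also have "\<dots> = 2 ^ (l - p)" using lt by (simp add: l_def Suc_diff_Suc flip: power_Suc)
      finally have t9': "t 9 < 2 ^ (l - p)" .
      have "stored_form \<phi> t" using Suc.prems(2) t by (simp add: stored_form_def)
      then have "runs Q (While (At (Reg 13)) token_body) t ((p + 1) * W)
          (\<lambda>t'. t' 9 = foldr (token_step u) (take p (tokens \<phi>)) (t 9) \<and> (\<forall>r<8. t' r = t r))"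
        by (intro Suc.IH) (use Suc.prems t t9 t9' in auto)
      then show "runs Q (While (At (Reg 13)) token_body) t ((p + 1) * W)
          (\<lambda>t'. t' 9 = foldr (token_step u) (take (Suc p) (tokens \<phi>)) (s 9) \<and> (\<forall>r<8. t' r = s r))"
      proof (rule runs_mono)
        show "t' 9 = foldr (token_step u) (take (Suc p) (tokens \<phi>)) (s 9) \<and> (\<forall>r<8. t' r = s r)"
          if "t' 9 = foldr (token_step u) (take p (tokens \<phi>)) (t 9) \<and> (\<forall>r<8. t' r = t r)" for t'
          using that t Suc.prems(4) lt by (simp add: take_Suc_conv_app_nth)
      qed simp
    next
      have "val_cost (At (Reg 13)) s = len 13 + len (int (Suc p))" using Suc.prems(3) by simp
      then show "1 + val_cost (At (Reg 13)) s + K * L + (p + 1) * W \<le> (Suc p + 1) * W"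
        using test[of "Suc p"] Suc.prems(1) W_split by simp
    qed (use Suc.prems in simp)
  }
qed

text \<open>The number of tokens times a linear cost per token. This is good enough because stored
  formulas occur only in the polynomial-time reduction.\<close>

lemma evaluator_token:
  "\<exists>C. \<forall>Q n \<phi>. vars \<phi> \<subseteq> {..<n} \<longrightarrow>
     evaluator Q token_prog n \<phi> (stored_form \<phi>) (C * ((length (tokens \<phi>) + 1) * (n + length (tokens \<phi>) + 70)))"
proof -
  obtain K where K: "token_body_within K" using token_body_runs by blast
  define c where "c = 6 + len 13 + len 65 + len 9"
  have "evaluator Q token_prog n \<phi> (stored_form \<phi>)
     ((K + 2 + len 13 + c) * ((length (tokens \<phi>) + 1) * (n + length (tokens \<phi>) + 70)))"
    if \<phi>: "vars \<phi> \<subseteq> {..<n}" for Q n \<phi>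
    unfolding evaluator_def
  proof (intro conjI allI impI)
    show "stored_form \<phi> s'" if "\<forall>r\<ge>32. s' r = s r" "stored_form \<phi> s" for s s'
      using that by (simp add: stored_form_def)
    fix s assume s: "stored_form \<phi> s" "0 \<le> s 7" "s 7 < 2 ^ n"
    define l where "l = length (tokens \<phi>)"
    define B where "B = (l + 1) * (n + l + 70)"
    have B1: "1 \<le> B" by (simp add: B_def)
    have "1 * (l + 70) \<le> B" unfolding B_def by (rule mult_le_mono) auto
    then have ll: "len (int l) \<le> B" using len_int_le[of l] by simp
    have s65: "s 65 = int l" using s(1) by (simp add: stored_form_def l_def)
    have cB: "2 + len 13 + len 65 + len 9 \<le> (2 + len 13 + len 65 + len 9) * B" by (rule le_mult_ge_1[OF B1])
    have c: "c * B = (2 + len 13 + len 65 + len 9) * B + 4 * B"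
      unfolding c_def distrib_right by simp
    have "runs Q token_prog s ((c * B) + (K + 2 + len 13) * B) (\<lambda>s'. s' 9 = access \<phi> (s 7) \<and> (\<forall>r<8. s' r = s r))"
      unfolding token_prog_def
    proof (rule runs_Seq[where ?P1.0 = "\<lambda>t. t = s(13 := int l)"])
      show "runs Q (Set (Reg 13) (At (Reg 65))) s (1 + (len 65 + len (int l)) + len 13 + len (int l))
          (\<lambda>t. t = s(13 := int l))"
        by (rule runs_Set) (use s65 in simp_all)
      fix t assume t: "t = s(13 := int l)"
      show "runs Q (Seq (Set (Reg 9) (Lit 0)) (While (At (Reg 13)) token_body)) t
          ((3 + len 9) + (K + 2 + len 13) * B) (\<lambda>s'. s' 9 = access \<phi> (s 7) \<and> (\<forall>r<8. s' r = s r))"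
      proof (rule runs_Seq[where ?P1.0 = "\<lambda>v. v = t(9 := 0)"])
        show "runs Q (Set (Reg 9) (Lit 0)) t (3 + len 9) (\<lambda>v. v = t(9 := 0))"
          by (rule runs_Set) simp_all
        fix v assume v: "v = t(9 := 0)"
        have "runs Q (While (At (Reg 13)) token_body) v ((l + 1) * ((K + 2 + len 13) * (n + length (tokens \<phi>) + 70)))
            (\<lambda>w. w 9 = foldr (token_step (s 7)) (take l (tokens \<phi>)) (v 9) \<and> (\<forall>r<8. w r = v r))"
          by (rule token_loop_runs[OF K \<phi>]) (use s t v in \<open>auto simp: l_def stored_form_def\<close>)
        then show "runs Q (While (At (Reg 13)) token_body) v ((K + 2 + len 13) * B)
            (\<lambda>s'. s' 9 = access \<phi> (s 7) \<and> (\<forall>r<8. s' r = s r))"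
        proof (rule runs_mono)
          show "(l + 1) * ((K + 2 + len 13) * (n + length (tokens \<phi>) + 70)) \<le> (K + 2 + len 13) * B"
            by (simp only: B_def l_def mult.left_commute order_refl)
          show "w 9 = access \<phi> (s 7) \<and> (\<forall>r<8. w r = s r)"
            if "w 9 = foldr (token_step (s 7)) (take l (tokens \<phi>)) (v 9) \<and> (\<forall>r<8. w r = v r)" for w
            using that v t by (simp add: l_def foldr_token_step access_def)
        qed
      qed simp
    next
      show "1 + (len 65 + len (int l)) + len 13 + len (int l) + (3 + len 9 + (K + 2 + len 13) * B)
          \<le> c * B + (K + 2 + len 13) * B"
        using cB c ll B1 by linarith
    qed
    then show "runs Q token_prog s ((K + 2 + len 13 + c) * ((length (tokens \<phi>) + 1) * (n + length (tokens \<phi>) + 70)))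
        (\<lambda>s'. s' 9 = access \<phi> (s 7) \<and> (\<forall>r<8. s' r = s r))"
      unfolding B_def l_def distrib_right[of "K + 2 + len 13" c] by (simp only: add.commute)
  qed
  then show ?thesis by blast
qed

section \<open>Running a program beside other data\<close>

text \<open>\<open>shift c\<close> runs \<open>c\<close> in the registers from 64 on, with 40, 41, 42 as buffers, so that the registers
  below 40 survive.\<close>

fun load_addr :: "loc \<Rightarrow> nat \<Rightarrow> prog" where
  "load_addr (Reg r) m = Set (Reg m) (Lit (int r + 64))"
| "load_addr (Ind r) m = Seq (Set (Reg m) (At (Reg (r + 64))))
     (If (At (Reg m)) (Op Add (Reg m) (At (Reg m)) (Lit 64)) (Set (Reg m) (Lit 64)))"

fun load_val :: "operand \<Rightarrow> nat \<Rightarrow> prog" where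
  "load_val (Lit z) m = Set (Reg m) (Lit z)"
| "load_val (At l) m = Seq (load_addr l m) (Set (Reg m) (At (Ind m)))"

definition store :: "loc \<Rightarrow> prog" where
  "store d = Seq (load_addr d 41) (Set (Ind 41) (At (Reg 40)))"

fun shift :: "prog \<Rightarrow> prog" where
  "shift Skip = Skip"
| "shift (Set d a) = Seq (load_val a 40) (store d)"
| "shift (Op f d a b) = Seq (load_val a 40) (Seq (load_val b 42)
     (Seq (Op f (Reg 40) (At (Reg 40)) (At (Reg 42))) (store d)))"
| "shift (Query d a) = Seq (load_val a 40) (Seq (Query (Reg 40) (At (Reg 40))) (store d))"
| "shift (Seq c1 c2) = Seq (shift c1) (shift c2)"
| "shift (If a c1 c2) = Seq (load_val a 40) (If (At (Reg 40)) (shift c1) (shift c2))"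
| "shift (While a c) = Seq (load_val a 40) (While (At (Reg 40)) (Seq (shift c) (load_val a 40)))"

definition shifted :: "mem \<Rightarrow> mem \<Rightarrow> mem \<Rightarrow> bool" where
  "shifted s \<sigma> \<tau> \<longleftrightarrow> (\<forall>r. \<tau> (r + 64) = s r) \<and> (\<forall>r<40. \<tau> r = \<sigma> r)"

lemma shifted_buffer: "shifted s \<sigma> \<tau> \<Longrightarrow> m \<in> {40..<64} \<Longrightarrow> shifted s \<sigma> (\<tau>(m := z))"
  by (simp add: shifted_def)

lemma len_small: "m < 64 \<Longrightarrow> len (int m) \<le> 6"
  by (rule len_leI) auto

lemma len_plus_64: "len (x + 64) \<le> 8 * len x"
proof -
  have "len 64 = 7" using len_power2[of 6] by simp
  then show ?thesis using len_add[of x 64] len_pos[of x] by simp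
qed

lemma len_addr: "len (int (addr l s)) \<le> addr_cost l s"
proof (cases l)
  case (Ind r)
  have "len (int (nat (s r))) \<le> len (s r)" by (rule len_mono) simp
  then show ?thesis unfolding Ind addr.simps addr_cost.simps by linarith
qed simp

lemma len_val: "len (val a s) \<le> val_cost a s"
  by (cases a) auto

lemma load_addr_runs:
  assumes \<sigma>: "shifted s \<sigma>\<^sub>0 \<sigma>" and m: "m < 64"
  shows "runs Q (load_addr l m) \<sigma> (60 * addr_cost l s) (\<lambda>\<tau>. \<tau> = \<sigma>(m := int (addr l s) + 64))"
proof (cases l)
  case (Reg r)
  show ?thesis unfolding Reg load_addr.simps
    by (rule runs_Set) (use len_small[OF m] len_plus_64[of "int r"] len_pos[of "int r"] in auto)
next
  case (Ind r)
  have v: "\<sigma> (r + 64) = s r" using \<sigma> by (simp add: shifted_def)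
  have c: "len (int m) \<le> 6" "len (int r + 64) \<le> 8 * len (int r)" "len (s r + 64) \<le> 8 * len (s r)"
    "1 \<le> len (int r)" "1 \<le> len (s r)" "len 64 = 7"
    using len_small[OF m] len_plus_64 len_pos len_power2[of 6] by auto
  show ?thesis unfolding Ind load_addr.simps
  proof (rule runs_Seq[where ?P1.0 = "\<lambda>\<tau>. \<tau> = \<sigma>(m := s r)"])
    show "runs Q (Set (Reg m) (At (Reg (r + 64)))) \<sigma> (1 + (len (int r + 64) + len (s r)) + len (int m) + len (s r))
        (\<lambda>\<tau>. \<tau> = \<sigma>(m := s r))"
      by (rule runs_Set) (simp_all add: v)
    fix \<tau> assume \<tau>: "\<tau> = \<sigma>(m := s r)"
    show "runs Q (If (At (Reg m)) (Op Add (Reg m) (At (Reg m)) (Lit 64)) (Set (Reg m) (Lit 64))) \<tau>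
        (1 + (len (int m) + len (s r)) + (1 + (len (int m) + len (s r)) + 14 + len (int m) + len (s r + 64)))
        (\<lambda>\<tau>. \<tau> = \<sigma>(m := int (addr (Ind r) s) + 64))"
    \<comment> \<open>\<open>addr\<close> turns a negative content into address 0, so every
      nonpositive content has to lead to register 64.\<close>
    proof (rule runs_If)
      assume "0 < val (At (Reg m)) \<tau>"
      then show "runs Q (Op Add (Reg m) (At (Reg m)) (Lit 64)) \<tau>
          (1 + (len (int m) + len (s r)) + 14 + len (int m) + len (s r + 64)) (\<lambda>\<tau>. \<tau> = \<sigma>(m := int (addr (Ind r) s) + 64))"
        by (intro runsI[OF exec_Op[OF refl]]) (use \<tau> c in auto)
    next
      assume "\<not> 0 < val (At (Reg m)) \<tau>"
      then show "runs Q (Set (Reg m) (Lit 64)) \<tau>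
          (1 + (len (int m) + len (s r)) + 14 + len (int m) + len (s r + 64)) (\<lambda>\<tau>. \<tau> = \<sigma>(m := int (addr (Ind r) s) + 64))"
        by (intro runs_Set) (use \<tau> c in auto)
    qed (use \<tau> in simp)
  qed (use c in simp)
qed

lemma load_val_runs:
  assumes \<sigma>: "shifted s \<sigma>\<^sub>0 \<sigma>" and m: "m < 64"
  shows "runs Q (load_val a m) \<sigma> (90 * val_cost a s) (\<lambda>\<tau>. \<tau> = \<sigma>(m := val a s))"
proof (cases a)
  case (Lit z)
  show ?thesis unfolding Lit load_val.simps
    by (rule runs_Set) (use len_small[OF m] len_pos[of z] in auto)
next
  case (At l)
  define x where "x = addr l s"
  have v: "\<sigma> (x + 64) = s x" using \<sigma> by (simp add: shifted_def)
  have c: "len (int m) \<le> 6" "len (int x + 64) \<le> 8 * addr_cost l s" "1 \<le> len (s x)"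
    using len_small[OF m] len_plus_64[of "int x"] len_addr[of l s] len_pos[of "s x"] by (auto simp: x_def)
  have n: "nat (int x + 64) = x + 64" by simp
  show ?thesis unfolding At load_val.simps
  proof (rule runs_Seq[OF load_addr_runs[OF \<sigma> m]])
    fix \<tau> assume \<tau>: "\<tau> = \<sigma>(m := int (addr l s) + 64)"
    have t: "\<tau> m = int x + 64" "\<tau> (x + 64) = s x" using \<tau> m v by (auto simp: x_def)
    show "runs Q (Set (Reg m) (At (Ind m))) \<tau>
        (1 + (len (int m) + len (int x + 64) + len (s x)) + len (int m) + len (s x)) (\<lambda>\<tau>. \<tau> = \<sigma>(m := val (At l) s))"
    proof (rule runs_Set)
      show "\<tau>(addr (Reg m) \<tau> := val (At (Ind m)) \<tau>) = \<sigma>(m := val (At l) s)"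
        unfolding val.simps addr.simps t n using \<tau> by (simp add: x_def)
      show "1 + val_cost (At (Ind m)) \<tau> + addr_cost (Reg m) \<tau> + len (val (At (Ind m)) \<tau>)
          \<le> 1 + (len (int m) + len (int x + 64) + len (s x)) + len (int m) + len (s x)"
        unfolding val_cost.simps val.simps addr.simps addr_cost.simps t n by simp
    qed
  qed (use c in \<open>simp add: x_def\<close>)
qed

lemma load_val_Seq:
  assumes "shifted s \<sigma>\<^sub>0 \<sigma>" "m < 64" "runs Q c (\<sigma>(m := val a s)) T P" "90 * val_cost a s + T \<le> T'"
  shows "runs Q (Seq (load_val a m) c) \<sigma> T' P"
  by (rule runs_Seq[OF load_val_runs[OF assms(1,2)]]) (use assms in auto)

lemma store_runs:
  assumes \<tau>: "shifted s \<sigma> \<tau>" "\<tau> 40 = z"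
  shows "runs Q (store d) \<tau> (20 + 70 * addr_cost d s + 2 * len z) (shifted (s(addr d s := z)) \<sigma>)"
  unfolding store_def
proof (rule runs_Seq[OF load_addr_runs[OF \<tau>(1)]])
  fix \<rho> assume \<rho>: "\<rho> = \<tau>(41 := int (addr d s) + 64)"
  have n: "nat (int (addr d s) + 64) = addr d s + 64" by simp
  have vals: "\<rho> 40 = z" "\<rho> 41 = int (addr d s) + 64" using \<rho> \<tau>(2) by simp_all
  show "runs Q (Set (Ind 41) (At (Reg 40))) \<rho> (20 + 10 * addr_cost d s + 2 * len z) (shifted (s(addr d s := z)) \<sigma>)"
  proof (rule runs_Set)
    show "shifted (s(addr d s := z)) \<sigma> (\<rho>(addr (Ind 41) \<rho> := val (At (Reg 40)) \<rho>))"
      unfolding addr.simps val.simps vals n using \<tau>(1) by (simp add: shifted_def \<rho>)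
    have "len (int (addr d s) + 64) \<le> 8 * addr_cost d s"
      using len_plus_64[of "int (addr d s)"] len_addr[of d s] by linarith
    moreover have "len (int 40) \<le> 6" "len (int 41) \<le> 6" by (rule len_small, simp)+
    ultimately show "1 + val_cost (At (Reg 40)) \<rho> + addr_cost (Ind 41) \<rho> + len (val (At (Reg 40)) \<rho>)
        \<le> 20 + 10 * addr_cost d s + 2 * len z"
      unfolding val_cost.simps val.simps addr.simps addr_cost.simps vals by linarith
  qed
qed simp_all

text \<open>Every operand and address is handled a bounded number of times, and adding 64 lengthens
  an address at most eightfold; 400 is a generous common factor.\<close>

lemma shift_runs:
  "exec Q c s t s' \<Longrightarrow> shifted s \<sigma> \<tau> \<Longrightarrow> runs Q (shift c) \<tau> (400 * t) (shifted s' \<sigma>)"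
proof (induction arbitrary: \<tau> rule: exec.induct)
  case (exec_Skip s)
  then show ?case by (auto intro!: runsI[OF exec.exec_Skip])
next
  case (exec_Set z a s d)
  have "shifted s \<sigma> (\<tau>(40 := z))" by (rule shifted_buffer) (use exec_Set in auto)
  then have "runs Q (store d) (\<tau>(40 := z)) (20 + 70 * addr_cost d s + 2 * len z) (shifted (s(addr d s := z)) \<sigma>)"
    by (rule store_runs) simp
  then show ?case unfolding shift.simps
    by (intro load_val_Seq[OF exec_Set(2)]) (use exec_Set(1) in \<open>auto simp del: fun_upd_apply\<close>)
next
  case (exec_Op z f a s b d)
  have \<tau>: "shifted s \<sigma> (\<tau>(40 := val a s))" "shifted s \<sigma> (\<tau>(40 := z, 42 := val b s))"
    by (intro shifted_buffer exec_Op(2), simp_all)+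
  show ?case unfolding shift.simps
  proof (rule load_val_Seq[OF exec_Op(2), rotated], rule load_val_Seq[OF \<tau>(1), rotated])
    let ?\<tau> = "\<tau>(40 := val a s, 42 := val b s)"
    have vals: "?\<tau> 40 = val a s" "?\<tau> 42 = val b s" by simp_all
    have "len (int 40) \<le> 6" "len (int 42) \<le> 6" by (rule len_small, simp)+
    then have "1 + val_cost (At (Reg 40)) ?\<tau> + val_cost (At (Reg 42)) ?\<tau> + addr_cost (Reg 40) ?\<tau>
        + len (apply_op f (val (At (Reg 40)) ?\<tau>) (val (At (Reg 42)) ?\<tau>)) \<le> 19 + val_cost a s + val_cost b s + len z"
      unfolding val_cost.simps val.simps addr.simps addr_cost.simps vals exec_Op(1)
      using len_val[of a s] len_val[of b s] by linarith
    then have "runs Q (Op f (Reg 40) (At (Reg 40)) (At (Reg 42))) ?\<tau> (19 + val_cost a s + val_cost b s + len z)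
        (\<lambda>\<rho>. \<rho> = \<tau>(40 := z, 42 := val b s))"
      by (rule runsI[OF exec.exec_Op[OF refl]]) (simp add: exec_Op(1) fun_upd_twist)
    then show "runs Q (Seq (Op f (Reg 40) (At (Reg 40)) (At (Reg 42))) (store d)) ?\<tau>
        ((19 + val_cost a s + val_cost b s + len z) + (20 + 70 * addr_cost d s + 2 * len z))
        (shifted (s(addr d s := z)) \<sigma>)"
      by (rule runs_Seq) (auto intro: store_runs \<tau>(2))
    show "90 * val_cost b s + ((19 + val_cost a s + val_cost b s + len z) + (20 + 70 * addr_cost d s + 2 * len z))
        \<le> 91 * val_cost b s + 39 + val_cost a s + 3 * len z + 70 * addr_cost d s" by simp
  qed simp_all
next
  case (exec_Query z a s d)
  have \<tau>: "shifted s \<sigma> (\<tau>(40 := z))" by (rule shifted_buffer) (use exec_Query in auto)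
  have "len (int 40) \<le> 6" by (rule len_small) simp
  then have "runs Q (Query (Reg 40) (At (Reg 40))) (\<tau>(40 := val a s)) (13 + val_cost a s + len z) (\<lambda>\<rho>. \<rho> = \<tau>(40 := z))"
    using len_val[of a s] by (intro runsI[OF exec.exec_Query[OF refl]]) (simp_all add: exec_Query(1))
  then have "runs Q (Seq (Query (Reg 40) (At (Reg 40))) (store d)) (\<tau>(40 := val a s))
      ((13 + val_cost a s + len z) + (20 + 70 * addr_cost d s + 2 * len z)) (shifted (s(addr d s := z)) \<sigma>)"
    by (rule runs_Seq) (auto intro: store_runs \<tau>)
  then show ?case unfolding shift.simps by (rule load_val_Seq[OF exec_Query(2), rotated]) simp_all
next
  case (exec_Seq c1 s t1 s1 c2 t2 s2)
  show ?case unfolding shift.simps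
    by (rule runs_Seq[OF exec_Seq.IH(1)[OF exec_Seq.prems] exec_Seq.IH(2)]) simp_all
next
  case (exec_IfTrue a s c1 t s1 c2)
  then have \<tau>: "shifted s \<sigma> (\<tau>(40 := val a s))" by (intro shifted_buffer) auto
  have "len (int 40) \<le> 6" by (rule len_small) simp
  then have "runs Q (If (At (Reg 40)) (shift c1) (shift c2)) (\<tau>(40 := val a s)) (7 + val_cost a s + 400 * t) (shifted s1 \<sigma>)"
    by (intro runs_If[OF exec_IfTrue.IH[OF \<tau>]]) (use exec_IfTrue(1) len_val[of a s] in auto)
  then show ?case unfolding shift.simps by (rule load_val_Seq[OF exec_IfTrue.prems, rotated]) simp_all
next
  case (exec_IfFalse a s c2 t s1 c1)
  then have \<tau>: "shifted s \<sigma> (\<tau>(40 := val a s))" by (intro shifted_buffer) auto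
  have "len (int 40) \<le> 6" by (rule len_small) simp
  then have "runs Q (If (At (Reg 40)) (shift c1) (shift c2)) (\<tau>(40 := val a s)) (7 + val_cost a s + 400 * t) (shifted s1 \<sigma>)"
    by (intro runs_If[OF _ exec_IfFalse.IH[OF \<tau>]]) (use exec_IfFalse(1) len_val[of a s] in auto)
  then show ?case unfolding shift.simps by (rule load_val_Seq[OF exec_IfFalse.prems, rotated]) simp_all
next
  case (exec_WhileFalse a s c)
  then have \<tau>: "shifted s \<sigma> (\<tau>(40 := val a s))" by (intro shifted_buffer) auto
  have "len (int 40) \<le> 6" by (rule len_small) simp
  then have "runs Q (While (At (Reg 40)) (Seq (shift c) (load_val a 40))) (\<tau>(40 := val a s)) (7 + val_cost a s) (shifted s \<sigma>)"
    by (intro runs_WhileFalse) (use \<tau> exec_WhileFalse(1) len_val[of a s] in auto)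
  then show ?case unfolding shift.simps by (rule load_val_Seq[OF exec_WhileFalse.prems, rotated]) simp_all
next
  case (exec_WhileTrue a s c t1 s1 t2 s2)
  let ?loop = "While (At (Reg 40)) (Seq (shift c) (load_val a 40))" and ?\<tau> = "\<tau>(40 := val a s)"
  have \<tau>: "shifted s \<sigma> ?\<tau>" by (intro shifted_buffer) (use exec_WhileTrue.prems in auto)
  obtain u1 \<rho> where 1: "exec Q (shift c) ?\<tau> u1 \<rho>" "u1 \<le> 400 * t1" "shifted s1 \<sigma> \<rho>"
    using exec_WhileTrue.IH(1)[OF \<tau>] unfolding runs_def by blast
  obtain u2 \<rho>2 where 2: "exec Q (Seq (load_val a 40) ?loop) \<rho> u2 \<rho>2" "u2 \<le> 400 * t2" "shifted s2 \<sigma> \<rho>2"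
    using exec_WhileTrue.IH(2)[OF 1(3)] unfolding runs_def shift.simps by blast
  \<comment> \<open>The induction hypothesis for the remaining rounds begins with loading the loop
    condition, whereas in the shifted loop this load ends the body of the round before. The run is
    cut there and reassembled.\<close>
  obtain v1 \<rho>1 v2 where 3: "exec Q (load_val a 40) \<rho> v1 \<rho>1" "exec Q ?loop \<rho>1 v2 \<rho>2" "u2 = v1 + v2"
    using 2(1) by (cases rule: exec.cases) auto
  have "val (At (Reg 40)) ?\<tau> > 0" using exec_WhileTrue(1) by simp
  from exec.exec_WhileTrue[OF this exec.exec_Seq[OF 1(1) 3(1)] 3(2)]
  have "runs Q ?loop ?\<tau> (7 + val_cost a s + 400 * t1 + 400 * t2) (shifted s2 \<sigma>)"
  proof (rule runsI)
    have "len (int 40) \<le> 6" by (rule len_small) simp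
    then show "1 + val_cost (At (Reg 40)) ?\<tau> + (u1 + v1) + v2 \<le> 7 + val_cost a s + 400 * t1 + 400 * t2"
      using 1(2) 2(2) 3(3) len_val[of a s] by simp
  qed (rule 2)
  then show ?case unfolding shift.simps by (rule load_val_Seq[OF exec_WhileTrue.prems, rotated]) simp_all
qed

text \<open>A step writes at most one register and costs at least 1. As tokens are nonzero, this
  bounds the length of a formula by the time spent producing it.\<close>

lemma exec_support:
  "exec Q c s t s' \<Longrightarrow> finite {r. s r \<noteq> 0} \<Longrightarrow>
     finite {r. s' r \<noteq> 0} \<and> card {r. s' r \<noteq> 0} \<le> card {r. s r \<noteq> 0} + t"
proof (induction rule: exec.induct)
  have upd: "finite {r. (s(a := z)) r \<noteq> 0} \<and> card {r. (s(a := z)) r \<noteq> 0} \<le> card {r. s r \<noteq> 0} + t"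
    if "finite {r. s r \<noteq> 0}" "1 \<le> t" for s :: mem and a z t
  proof -
    have sub: "{r. (s(a := z)) r \<noteq> 0} \<subseteq> insert a {r. s r \<noteq> 0}" by auto
    have "card {r. (s(a := z)) r \<noteq> 0} \<le> card (insert a {r. s r \<noteq> 0})"
      using that by (intro card_mono sub) auto
    also have "\<dots> \<le> card {r. s r \<noteq> 0} + 1" using that by (simp add: card_insert_if)
    finally show ?thesis using that finite_subset[OF sub] by auto
  qed
  {
    case (exec_Set z a s d)
    then show ?case by (intro upd) auto
  next
    case (exec_Op z f a s b d)
    then show ?case by (intro upd) auto
  next
    case (exec_Query z a s d)
    then show ?case by (intro upd) auto
  }
qed auto

section \<open>The reductions\<close>

lemma input_4 [simp]: "input [a, b, c, d] 0 = a" "input [a, b, c, d] (Suc 0) = b" "input [a, b, c, d] 2 = c"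
  "input [a, b, c, d] 3 = d" "4 \<le> r \<Longrightarrow> input [a, b, c, d] r = 0"
  by (simp_all add: input_def numeral_eq_Suc)

lemma input_1 [simp]: "input [a] 0 = a" "r \<noteq> 0 \<Longrightarrow> input [a] r = 0"
  by (simp_all add: input_def)

text \<open>The formula is evaluated only when \<open>k > 6 * n\<close>, where
  \<open>n + 1 \<le> k\<close>, so an evaluation linear in \<open>n\<close> is linear in the
  precision.\<close>

lemma boundary_prog_linear:
  assumes C: "boundary_prog_within C" and E: "evaluator Q E n \<phi> I (c * (n + 1))"
    and s: "I s" "s 0 = int k" "s 1 = i" "s 2 = j" "s 3 = int n"
  shows "runs Q (boundary_prog E) s ((C + c) * (k + len i + len j + len (int n)))
     (\<lambda>s'. s' 0 = of_bool (boundary_test n \<phi> k i j))"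
proof -
  have "runs Q (boundary_prog E) s (C * (k + len i + len j + len (int n)) + (if k \<le> 6 * n then 0 else c * (n + 1)))
     (\<lambda>s'. s' 0 = of_bool (boundary_test n \<phi> k i j))"
    using C E s unfolding boundary_prog_within_def by blast
  then show ?thesis
  proof (rule runs_mono)
    have "(if k \<le> 6 * n then 0 else c * (n + 1)) \<le> c * (k + len i + len j + len (int n))"
    proof (cases "k \<le> 6 * n")
      case False
      then show ?thesis unfolding if_not_P[OF False] by (intro mult_le_mono2) simp
    qed simp
    then show "C * (k + len i + len j + len (int n)) + (if k \<le> 6 * n then 0 else c * (n + 1))
        \<le> (C + c) * (k + len i + len j + len (int n))"
      unfolding distrib_right by linarith
  qed
qed

lemma linear_time_boundary_test: "linear_time (boundary_test n \<phi>)"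
proof -
  obtain C where C: "boundary_prog_within C" using boundary_prog_runs by blast
  obtain c where c: "\<forall>n. evaluator no_access (form_prog \<phi>) n \<phi> (\<lambda>_. True) (c * (n + 1))"
    using evaluator_form by blast
  \<comment> \<open>No input supplies \<open>n\<close> here; like the formula it is a constant of
    the program.\<close>
  define p where "p = Seq (Set (Reg 3) (Lit (int n))) (boundary_prog (form_prog \<phi>))"
  define a where "a = 1 + 2 * len (int n) + len (int 3)"
  have "runs no_access p (input [int k, i, j, 0]) ((a + (C + c) * (1 + len (int n))) * (k + len i + len j))
     (\<lambda>s'. s' 0 = of_bool (boundary_test n \<phi> k i j))" for k i j
  proof -
    define L where "L = k + len i + len j"
    have L: "1 \<le> L" using len_pos[of i] by (simp add: L_def)
    show ?thesis unfolding p_def L_def[symmetric]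
    proof (rule runs_Seq[where ?P1.0 = "\<lambda>t. t = (input [int k, i, j, 0])(3 := int n)"])
      have "a \<le> a * L" by (rule le_mult_ge_1[OF L])
      then show "runs no_access (Set (Reg 3) (Lit (int n))) (input [int k, i, j, 0]) (a * L)
          (\<lambda>t. t = (input [int k, i, j, 0])(3 := int n))"
        by (intro runs_Set) (auto simp: a_def)
      fix t assume t: "t = (input [int k, i, j, 0])(3 := int n)"
      have "runs no_access (boundary_prog (form_prog \<phi>)) t ((C + c) * (k + len i + len j + len (int n)))
          (\<lambda>s'. s' 0 = of_bool (boundary_test n \<phi> k i j))"
        by (rule boundary_prog_linear[OF C c[rule_format]]) (use t in simp_all)
      then show "runs no_access (boundary_prog (form_prog \<phi>)) t ((C + c) * (1 + len (int n)) * L)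
          (\<lambda>s'. s' 0 = of_bool (boundary_test n \<phi> k i j))"
      proof (rule runs_mono)
        have "len (int n) \<le> len (int n) * L" by (rule le_mult_ge_1[OF L])
        then have "L + len (int n) \<le> (1 + len (int n)) * L" unfolding distrib_right by linarith
        then show "(C + c) * (k + len i + len j + len (int n)) \<le> (C + c) * (1 + len (int n)) * L"
          unfolding L_def[symmetric] mult.assoc by (rule mult_le_mono2)
      qed
    qed (simp only: distrib_right order_refl)
  qed
  then have "computes_rep no_access p 0 (boundary_test n \<phi>)
      (\<lambda>k i j. (a + (C + c) * (1 + len (int n))) * (k + len i + len j))"
    unfolding computes_rep_def runs_def by blast
  then show ?thesis unfolding linear_time_def by blast
qed

lemma count_prog_counts:
  assumes A: "computes_conformal_radius A" and C: "count_prog_within C"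
    and \<phi>: "vars \<phi> \<subseteq> {..<n}" and s: "s 0 = A (boundary_test n \<phi>) n" "s 1 = int n"
  shows "runs Q count_prog s (C * (n + 1)) (\<lambda>s'. s' 0 = int (sharp_SAT n \<phi>))"
proof -
  have n: "1 \<le> n" using \<phi> vars_not_empty[of \<phi>] by (cases n) auto
  define R where "R = \<lfloor>2 ^ (20 * n) * conformal_radius (sat_domain n \<phi>) 0\<rfloor>"
  have "A (boundary_test n \<phi>) n = R"
    using A admissible_sat_domain[OF n] represents_boundary_test[OF n] linear_time_boundary_test
    unfolding computes_conformal_radius_def R_def by blast
  then have s0: "s 0 = R" using s(1) by simp
  have len: "len R \<le> 20 * n + 1"
  proof (rule len_leI)
    define r where "r = conformal_radius (sat_domain n \<phi>) 0"
    have r: "0 \<le> r" "r \<le> 1" using conformal_radius_sat_domain[OF n] by (simp_all add: r_def)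
    have "0 \<le> R" using r by (simp add: R_def r_def)
    moreover have "R \<le> 2 ^ (20 * n)"
    proof -
      have "real_of_int R \<le> 2 ^ (20 * n) * r" unfolding R_def r_def by (rule of_int_floor_le)
      also have "\<dots> \<le> 2 ^ (20 * n) * 1" using r by (intro mult_left_mono) auto
      finally have "real_of_int R \<le> real_of_int (2 ^ (20 * n))" by simp
      then show ?thesis by (simp only: of_int_le_iff)
    qed
    moreover have "(2::int) ^ (20 * n) < 2 ^ (20 * n + 1)" by simp
    ultimately show "\<bar>R\<bar> < 2 ^ (20 * n + 1)" by linarith
  qed simp
  have "runs Q count_prog s (C * (n + 1))
       (\<lambda>s'. s' 0 = (64 * ((2 ^ n) ^ 20 - R) + 9 * (2 ^ n) ^ 8) div (18 * (2 ^ n) ^ 8))"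
    using C s0 s(2) len unfolding count_prog_within_def by blast
  then show ?thesis unfolding count_from_radius[OF n \<phi> R_def] .
qed

lemma sharp_SAT_by_one_call:
  assumes A: "computes_conformal_radius A"
  shows "sharp_SAT_by_one_call_linear A"
proof -
  obtain C where C: "boundary_prog_within C" using boundary_prog_runs by blast
  obtain K where K: "count_prog_within K" using count_prog_runs by blast
  define c where "c = 3 + len 7 + len 9"
  define b where "b = 3 + len 0 + len 1"
  \<comment> \<open>The answer of the call overwrites register 0, and \<open>n\<close> is needed
    again for the rounding formula.\<close>
  define pre where "pre = Set (Reg 1) (At (Reg 0))"
  define D where "D = C + c + 2 * b + K + 1"
  have main: "\<exists>\<Omega> f. admissible_domain \<Omega> \<and> represents f (frontier \<Omega>) \<and> linear_time f \<and>
       computes_rep (access \<phi>) (boundary_prog query_prog) (int n) f (\<lambda>k i j. D * (k + len i + len j + len (int n))) \<and>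
       one_call (access \<phi>) A pre count_prog (int n) f n (int (sharp_SAT n \<phi>)) (D * (n + 1))"
    if \<phi>: "vars \<phi> \<subseteq> {..<n}" for n \<phi>
  proof (intro exI conjI)
    have n: "1 \<le> n" using \<phi> vars_not_empty[of \<phi>] by (cases n) auto
    show "admissible_domain (sat_domain n \<phi>)" by (rule admissible_sat_domain[OF n])
    show "represents (boundary_test n \<phi>) (frontier (sat_domain n \<phi>))" by (rule represents_boundary_test[OF n])
    show "linear_time (boundary_test n \<phi>)" by (rule linear_time_boundary_test)
    have "runs (access \<phi>) (boundary_prog query_prog) (input [int k, i, j, int n]) (D * (k + len i + len j + len (int n)))
       (\<lambda>s'. s' 0 = of_bool (boundary_test n \<phi> k i j))" for k i j
    proof (rule runs_mono)
      show "runs (access \<phi>) (boundary_prog query_prog) (input [int k, i, j, int n])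
          ((C + c) * (k + len i + len j + len (int n))) (\<lambda>s'. s' 0 = of_bool (boundary_test n \<phi> k i j))"
        unfolding c_def by (rule boundary_prog_linear[OF C evaluator_query]) simp_all
      show "(C + c) * (k + len i + len j + len (int n)) \<le> D * (k + len i + len j + len (int n))"
        by (rule mult_le_mono1) (simp add: D_def)
    qed
    then show "computes_rep (access \<phi>) (boundary_prog query_prog) (int n) (boundary_test n \<phi>)
        (\<lambda>k i j. D * (k + len i + len j + len (int n)))"
      unfolding computes_rep_def runs_def by blast
    show "one_call (access \<phi>) A pre count_prog (int n) (boundary_test n \<phi>) n (int (sharp_SAT n \<phi>)) (D * (n + 1))"
    proof -
      have "runs (access \<phi>) pre (input [int n]) (2 * b * (n + 1)) (\<lambda>t. t = (input [int n])(1 := int n))"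
        unfolding pre_def
      proof (rule runs_Set)
        define y where "y = b * (n + 1)"
        have "b \<le> y" unfolding y_def by (rule le_mult_ge_1) simp
        moreover have "2 * (n + 1) \<le> y" unfolding y_def by (rule mult_le_mono1) (simp add: b_def)
        moreover have y: "2 * b * (n + 1) = y + y" by (simp add: y_def)
        ultimately show "1 + val_cost (At (Reg 0)) (input [int n]) + addr_cost (Reg 1) (input [int n])
            + len (val (At (Reg 0)) (input [int n])) \<le> 2 * b * (n + 1)"
          using len_int_le[of n] b_def
          unfolding y by simp
      qed simp
      then obtain t1 where 1: "exec (access \<phi>) pre (input [int n]) t1 ((input [int n])(1 := int n))"
          "t1 \<le> 2 * b * (n + 1)"
        by (auto simp: runs_def)
      let ?s = "((input [int n])(1 := int n))(0 := A (boundary_test n \<phi>) n)"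
      have "runs (access \<phi>) count_prog ?s (K * (n + 1)) (\<lambda>s'. s' 0 = int (sharp_SAT n \<phi>))"
        by (rule count_prog_counts[OF A K \<phi>]) simp_all
      then obtain t2 s2 where 2: "exec (access \<phi>) count_prog ?s t2 s2" "t2 \<le> K * (n + 1)" "s2 0 = int (sharp_SAT n \<phi>)"
        by (auto simp: runs_def)
      define N where "N = n + 1"
      have "(2 * b + K + 1) * N \<le> D * N" by (rule mult_le_mono1) (simp add: D_def)
      moreover have "n \<le> N" by (simp add: N_def)
      ultimately have "t1 + n + t2 \<le> D * (n + 1)"
        using 1(2) 2(2) unfolding N_def[symmetric] distrib_right by linarith
      then show ?thesis unfolding one_call_def using 1(1) 2(1,3) by (metis fun_upd_apply input_1(1) zero_neq_one)
    qed
  qed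
  then show ?thesis unfolding sharp_SAT_by_one_call_linear_def by blast
qed

lemma holds_instance_shifted:
  assumes "holds_instance s n \<phi>" "shifted s \<sigma>\<^sub>0 \<sigma>"
  shows "\<sigma> 64 = int n" "stored_form \<phi> \<sigma>"
proof -
  have \<sigma>: "\<sigma> (r + 64) = s r" for r using assms(2) by (simp add: shifted_def)
  show "\<sigma> 64 = int n" using \<sigma>[of 0] assms(1) by (simp add: holds_instance_def)
  have "\<sigma> 65 = int (length (tokens \<phi>))" using \<sigma>[of 1] assms(1) by (simp add: holds_instance_def)
  moreover have "\<sigma> (k + 66) = int (tokens \<phi> ! k)" if "k < length (tokens \<phi>)" for k
    using \<sigma>[of "k + 2"] assms(1) that by (simp add: holds_instance_def add.commute)
  ultimately show "stored_form \<phi> \<sigma>" by (simp add: stored_form_def)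
qed

lemma tokens_pos: "c \<in> set (tokens \<phi>) \<Longrightarrow> 0 < c"
  by (induction \<phi>) auto

lemma length_tokens_le:
  assumes "exec Q c (input [x]) t s" "holds_instance s n \<phi>"
  shows "length (tokens \<phi>) \<le> t + 1"
proof -
  have sub0: "{r. input [x] r \<noteq> 0} \<subseteq> {0}" using input_1(2)[of _ x] by blast
  then have fin0: "finite {r. input [x] r \<noteq> 0}" by (rule finite_subset) simp
  have card0: "card {r. input [x] r \<noteq> 0} \<le> 1" using card_mono[OF _ sub0] by simp
  have fin: "finite {r. s r \<noteq> 0}" "card {r. s r \<noteq> 0} \<le> 1 + t"
    using exec_support[OF assms(1) fin0] card0 by auto
  have "(\<lambda>k. k + 2) ` {..<length (tokens \<phi>)} \<subseteq> {r. s r \<noteq> 0}"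
    using assms(2) tokens_pos[OF nth_mem, of _ \<phi>] by (force simp: holds_instance_def)
  then have "card ((\<lambda>k. k + 2) ` {..<length (tokens \<phi>)}) \<le> card {r. s r \<noteq> 0}" by (rule card_mono[OF fin(1)])
  moreover have "card ((\<lambda>k. k + 2) ` {..<length (tokens \<phi>)}) = length (tokens \<phi>)"
    by (subst card_image) (auto simp: inj_on_def)
  ultimately show ?thesis using fin(2) by simp
qed

lemma shift_from_input:
  assumes "exec Q c (input [int x]) t s" "holds_instance s n \<phi>"
    and \<sigma>: "\<And>r. 64 \<le> r \<Longrightarrow> \<sigma> r = 0" "\<sigma> m = int x" "m < 40"
  shows "runs Q (Seq (Set (Reg 64) (At (Reg m))) (shift c)) \<sigma> (14 + 2 * len (int x) + 400 * t)
     (\<lambda>\<tau>. \<tau> 64 = int n \<and> stored_form \<phi> \<tau> \<and> (\<forall>r<40. \<tau> r = \<sigma> r))"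
proof (rule runs_Seq[where ?P1.0 = "\<lambda>\<tau>. \<tau> = \<sigma>(64 := int x)"])
  have "len (int m) \<le> 6" by (rule len_small) (use \<sigma>(3) in simp)
  moreover have "len (int 64) = 7" using len_power2[of 6] by simp
  ultimately show "runs Q (Set (Reg 64) (At (Reg m))) \<sigma> (14 + 2 * len (int x)) (\<lambda>\<tau>. \<tau> = \<sigma>(64 := int x))"
    by (intro runs_Set) (use \<sigma>(2) in simp_all)
  fix \<tau> assume \<tau>: "\<tau> = \<sigma>(64 := int x)"
  have "\<tau> (r + 64) = input [int x] r" for r using \<sigma>(1) by (cases "r = 0") (simp_all add: \<tau>)
  then have "shifted (input [int x]) \<sigma> \<tau>" by (simp add: shifted_def \<tau>)
  from shift_runs[OF assms(1) this]
  show "runs Q (shift c) \<tau> (400 * t) (\<lambda>\<tau>. \<tau> 64 = int n \<and> stored_form \<phi> \<tau> \<and> (\<forall>r<40. \<tau> r = \<sigma> r))"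
    by (rule runs_mono) (use holds_instance_shifted[OF assms(2)] in \<open>auto simp: shifted_def\<close>)
qed simp

lemma sharp_P_reducible:
  assumes A: "computes_conformal_radius A" and g: "g \<in> sharp_P"
  shows "poly_reducible_to_conformal_radius g A"
proof -
  obtain c C0 d0 where gc: "\<And>x. \<exists>t s n \<phi>. exec no_access c (input [int x]) t s \<and> holds_instance s n \<phi> \<and>
     vars \<phi> \<subseteq> {..<n} \<and> t + n \<le> C0 * len (int x) ^ d0 \<and> g x = sharp_SAT n \<phi>"
    using g unfolding sharp_P_def by blast
  obtain C where C: "boundary_prog_within C" using boundary_prog_runs by blast
  obtain K where K: "count_prog_within K" using count_prog_runs by blast
  obtain Ct where Ct: "\<forall>Q n \<phi>. vars \<phi> \<subseteq> {..<n} \<longrightarrow>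
     evaluator Q token_prog n \<phi> (stored_form \<phi>) (Ct * ((length (tokens \<phi>) + 1) * (n + length (tokens \<phi>) + 70)))"
    using evaluator_token by blast
  \<comment> \<open>The formula is recomputed from \<open>x\<close> for every query point, in the
    registers from 64 on. The token list stays there for \<open>token_prog\<close>, and only
    \<open>n\<close> is copied down.\<close>
  define bd where "bd = Seq (Seq (Set (Reg 64) (At (Reg 3))) (shift c))
    (Seq (Set (Reg 3) (At (Reg 64))) (boundary_prog token_prog))"
  define pre where "pre = Seq (Seq (Set (Reg 64) (At (Reg 0))) (shift c))
    (Seq (Set (Reg 0) (At (Reg 64))) (Set (Reg 1) (At (Reg 64))))"
  \<comment> \<open>The doubling pays for the evaluation, quadratic in the running time of the
    reduction; the additional 1 ensures that the power dominates its base even if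
    \<open>d0 = 0\<close>.\<close>
  define d where "d = 2 * d0 + 1"
  define D where "D = 100 + 500 * C0 + 2 * C + C * C0 + Ct * (219 * (C0 * C0)) + 2 * (K * C0)"
  have "\<exists>\<Omega> f m. admissible_domain \<Omega> \<and> represents f (frontier \<Omega>) \<and> linear_time f \<and>
        computes_rep no_access bd (int x) f (\<lambda>k i j. D * (k + len i + len j + len (int x)) ^ d) \<and>
        one_call no_access A pre count_prog (int x) f m (int (g x)) (D * len (int x) ^ d)" for x
  proof -
    obtain t s n \<phi> where ex: "exec no_access c (input [int x]) t s" and hi: "holds_instance s n \<phi>"
      and \<phi>: "vars \<phi> \<subseteq> {..<n}" and P: "t + n \<le> C0 * len (int x) ^ d0" and gx: "g x = sharp_SAT n \<phi>"
      using gc by blast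
    have n: "1 \<le> n" using \<phi> vars_not_empty[of \<phi>] by (cases n) auto
    define l where "l = length (tokens \<phi>)"
    define p where "p = t + n"
    have l: "l \<le> t + 1" unfolding l_def by (rule length_tokens_le[OF ex hi])
    have ln: "len (int n) \<le> n" by (rule len_int_le'[OF n])
    have bounds: "len (int x) \<le> W ^ d" "W \<le> W ^ d" "p \<le> C0 * W ^ d" "p * p \<le> C0 * C0 * W ^ d" "1 \<le> W ^ d"
      if "len (int x) \<le> W" for W
    proof -
      have W: "1 \<le> W" using that len_pos[of "int x"] by simp
      show W1: "W \<le> W ^ d" using power_increasing[of 1 d W] W by (simp add: d_def)
      then show "len (int x) \<le> W ^ d" "1 \<le> W ^ d" using that W by auto
      have p0: "p \<le> C0 * W ^ d0"
        using P power_mono[OF that, of d0] by (metis (no_types) p_def le_trans mult_le_mono2 zero_le)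
      have "W ^ d0 \<le> W ^ d" using W by (intro power_increasing) (auto simp: d_def)
      then show "p \<le> C0 * W ^ d" using p0 by (meson le_trans mult_le_mono2)
      have "p * p \<le> (C0 * W ^ d0) * (C0 * W ^ d0)" using p0 by (intro mult_le_mono)
      also have "\<dots> = C0 * C0 * W ^ (2 * d0)" by (simp add: mult_2 power_add)
      also have "\<dots> \<le> C0 * C0 * W ^ d" using W by (intro mult_le_mono2 power_increasing) (auto simp: d_def)
      finally show "p * p \<le> C0 * C0 * W ^ d" .
    qed
    have p1: "1 \<le> p" using n by (simp add: p_def)
    define T where "T = Ct * ((l + 1) * (n + l + 70))"
    have T: "T \<le> Ct * (219 * (p * p))"
    proof -
      \<comment> \<open>From \<open>l \<le> t + 1\<close> and \<open>1 \<le> p\<close>, additive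
        constants are absorbed into multiples of \<open>p = t + n\<close>; \<open>219\<close> is
        \<open>3 * 73\<close>.\<close>
      have "(l + 1) * (n + l + 70) \<le> (3 * p) * (73 * p)"
        using l p1 n by (intro mult_le_mono) (auto simp: p_def)
      then show ?thesis unfolding T_def by (intro mult_le_mono2) simp
    qed
    have small: "len (int 3) \<le> 6" "len (int 0) \<le> 6" "len (int 1) \<le> 6" by (rule len_small, simp)+
    have l64: "len (int 64) = 7" using len_power2[of 6] by simp
    show ?thesis
    proof (intro exI conjI)
      show "admissible_domain (sat_domain n \<phi>)" by (rule admissible_sat_domain[OF n])
      show "represents (boundary_test n \<phi>) (frontier (sat_domain n \<phi>))" by (rule represents_boundary_test[OF n])
      show "linear_time (boundary_test n \<phi>)" by (rule linear_time_boundary_test)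
      have "runs no_access bd (input [int k, i, j, int x]) (D * (k + len i + len j + len (int x)) ^ d)
         (\<lambda>s'. s' 0 = of_bool (boundary_test n \<phi> k i j))" for k i j
      proof -
        define W where "W = k + len i + len j + len (int x)"
        note b = bounds[of W]
        have "runs no_access bd (input [int k, i, j, int x]) ((14 + 2 * len (int x) + 400 * t) +
            ((14 + 2 * n) + (C * (k + len i + len j + len (int n)) + T)))
            (\<lambda>s'. s' 0 = of_bool (boundary_test n \<phi> k i j))"
          unfolding bd_def
        proof (rule runs_Seq[OF shift_from_input[OF ex hi]])
          fix \<tau> assume \<tau>: "\<tau> 64 = int n \<and> stored_form \<phi> \<tau> \<and> (\<forall>r<40. \<tau> r = input [int k, i, j, int x] r)"
          show "runs no_access (Seq (Set (Reg 3) (At (Reg 64))) (boundary_prog token_prog)) \<tau>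
              ((14 + 2 * n) + (C * (k + len i + len j + len (int n)) + T))
              (\<lambda>s'. s' 0 = of_bool (boundary_test n \<phi> k i j))"
          proof (rule runs_Seq[where ?P1.0 = "\<lambda>\<rho>. \<rho> = \<tau>(3 := int n)"])
            show "runs no_access (Set (Reg 3) (At (Reg 64))) \<tau> (14 + 2 * n) (\<lambda>\<rho>. \<rho> = \<tau>(3 := int n))"
              by (rule runs_Set) (use \<tau> small l64 ln in simp_all)
            fix \<rho> assume \<rho>: "\<rho> = \<tau>(3 := int n)"
            have ev: "evaluator no_access token_prog n \<phi> (stored_form \<phi>) T"
              using Ct \<phi> unfolding T_def l_def by blast
            have "stored_form \<phi> \<rho>" using \<tau> \<rho> by (simp add: stored_form_def)
            moreover have "\<rho> 0 = int k" "\<rho> 1 = i" "\<rho> 2 = j" "\<rho> 3 = int n" using \<tau> \<rho> by simp_all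
            ultimately have "runs no_access (boundary_prog token_prog) \<rho>
                (C * (k + len i + len j + len (int n)) + (if k \<le> 6 * n then 0 else T))
                (\<lambda>s'. s' 0 = of_bool (boundary_test n \<phi> k i j))"
              using C ev unfolding boundary_prog_within_def by blast
            then show "runs no_access (boundary_prog token_prog) \<rho> (C * (k + len i + len j + len (int n)) + T)
                (\<lambda>s'. s' 0 = of_bool (boundary_test n \<phi> k i j))"
              by (rule runs_mono) auto
          qed simp
        qed simp_all
        then show ?thesis unfolding W_def[symmetric]
        proof (rule runs_mono)
          have W: "len (int x) \<le> W" by (simp add: W_def)
          define S where "S = C * (k + len i + len j + len (int n))"
          define Y where "Y = C * (W ^ d + C0 * W ^ d)"
          have "S \<le> Y" unfolding S_def Y_def
          proof (rule mult_le_mono2)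
            have "k + len i + len j + len (int n) \<le> W + p" using ln by (simp add: W_def p_def)
            then show "k + len i + len j + len (int n) \<le> W ^ d + C0 * W ^ d" using b(2,3)[OF W] by linarith
          qed
          moreover have "T \<le> Ct * (219 * (C0 * C0 * W ^ d))"
            using T b(4)[OF W] by (meson le_trans mult_le_mono2)
          moreover have "400 * t + 2 * n \<le> 400 * (C0 * W ^ d)" using b(3)[OF W] by (simp add: p_def)
          moreover have "D * W ^ d = 100 * W ^ d + 500 * (C0 * W ^ d) + Y + C * W ^ d
              + Ct * (219 * (C0 * C0 * W ^ d)) + 2 * (K * C0) * W ^ d"
            unfolding D_def Y_def by (simp add: algebra_simps)
          ultimately show "(14 + 2 * len (int x) + 400 * t) + ((14 + 2 * n) + (C * (k + len i + len j + len (int n)) + T))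
              \<le> D * W ^ d"
            using b(1,5)[OF W] unfolding S_def[symmetric] by linarith
        qed
      qed
      then show "computes_rep no_access bd (int x) (boundary_test n \<phi>)
          (\<lambda>k i j. D * (k + len i + len j + len (int x)) ^ d)"
        unfolding computes_rep_def runs_def by blast
      define X where "X = len (int x) ^ d"
      note b = bounds[OF order_refl, folded X_def]
      have "runs no_access pre (input [int x]) ((14 + 2 * len (int x) + 400 * t) + ((14 + 2 * n) + (14 + 2 * n)))
          (\<lambda>s'. s' 0 = int n \<and> s' 1 = int n)"
        unfolding pre_def
      proof (rule runs_Seq[OF shift_from_input[OF ex hi]])
        fix \<tau> assume \<tau>: "\<tau> 64 = int n \<and> stored_form \<phi> \<tau> \<and> (\<forall>r<40. \<tau> r = input [int x] r)"
        show "runs no_access (Seq (Set (Reg 0) (At (Reg 64))) (Set (Reg 1) (At (Reg 64)))) \<tau>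
            ((14 + 2 * n) + (14 + 2 * n)) (\<lambda>s'. s' 0 = int n \<and> s' 1 = int n)"
        proof (rule runs_Seq[where ?P1.0 = "\<lambda>\<rho>. \<rho> = \<tau>(0 := int n)"])
          show "runs no_access (Set (Reg 0) (At (Reg 64))) \<tau> (14 + 2 * n) (\<lambda>\<rho>. \<rho> = \<tau>(0 := int n))"
            by (rule runs_Set) (use \<tau> small l64 ln in simp_all)
          fix \<rho> assume \<rho>: "\<rho> = \<tau>(0 := int n)"
          show "runs no_access (Set (Reg 1) (At (Reg 64))) \<rho> (14 + 2 * n) (\<lambda>s'. s' 0 = int n \<and> s' 1 = int n)"
            by (rule runs_Set) (use \<tau> \<rho> small l64 ln in simp_all)
        qed simp
      qed simp_all
      then obtain t1 s1 where 1: "exec no_access pre (input [int x]) t1 s1" "s1 0 = int n" "s1 1 = int n"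
          "t1 \<le> (14 + 2 * len (int x) + 400 * t) + ((14 + 2 * n) + (14 + 2 * n))"
        by (auto simp: runs_def)
      have "runs no_access count_prog (s1(0 := A (boundary_test n \<phi>) n)) (K * (n + 1)) (\<lambda>s'. s' 0 = int (sharp_SAT n \<phi>))"
        by (rule count_prog_counts[OF A K \<phi>]) (use 1 in simp_all)
      then obtain t2 s2 where 2: "exec no_access count_prog (s1(0 := A (boundary_test n \<phi>) n)) t2 s2"
          "t2 \<le> K * (n + 1)" "s2 0 = int (sharp_SAT n \<phi>)"
        by (auto simp: runs_def)
      have "K * (n + 1) \<le> K * (2 * (C0 * X))" using b(3) n by (intro mult_le_mono2) (simp add: p_def)
      then have "t2 \<le> K * (2 * (C0 * X))" using 2(2) by (rule order_trans[rotated])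
      moreover have "400 * t + 5 * n \<le> 500 * (C0 * X)" using b(3) by (simp add: p_def)
      moreover have "D * X = 100 * X + 500 * (C0 * X) + (2 * C + C * C0 + Ct * (219 * (C0 * C0))) * X + K * (2 * (C0 * X))"
        unfolding D_def by (simp add: algebra_simps)
      ultimately have "t1 + n + t2 \<le> D * X" using 1(4) b(1,5) by linarith
      then show "one_call no_access A pre count_prog (int x) (boundary_test n \<phi>) n (int (g x)) (D * len (int x) ^ d)"
        unfolding one_call_def gx X_def[symmetric] using 1(1,2) 2(1,3) by blast
    qed
  qed
  then show ?thesis unfolding poly_reducible_to_conformal_radius_def by blast
qed

theorem theorem1p10:
  fixes A :: solver
  assumes "computes_conformal_radius A"
  shows "sharp_SAT_by_one_call_linear A \<and>
         (\<forall>g \<in> sharp_P. poly_reducible_to_conformal_radius g A)"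
  using sharp_SAT_by_one_call[OF assms] sharp_P_reducible[OF assms] by blast

end
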